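(* Under the hierarchical sampling setup and supersample construction described in the context, assume the loss is $\lambda$-Lipschitz in its first argument: $|\ell(w,z)-\ell(w',z)|\le\lambda\,\rho(w,w')$ for all $w,w'\in\mathcal W$, $z\in\mathcal Z$. Then $$\mathrm{gen}(P_{W\mid\mu})\le 2\lambda\sum_{l=1}^{L}\frac{1}{N_l}\sum_{i_{1:l}}\Big|\mathbb{E}_{\tilde\mu_l^{i_{1:l}},\,U_l^{i_{1:l}}}\,\mathbb{W}\Big(P_{W\mid\tilde\mu_l^{i_{1:l}},U_l^{i_{1:l}}},\,P_{W\mid\tilde\mu_l^{i_{1:l}}}\Big)\Big|,$$ where $\mathbb{W}$ is the Wasserstein-1 distance on $(\mathcal W,\rho)$.
   Context: Hierarchical sampling setup. Fix integers $L\ge 1$ (the depth) and branching factors $n_1,\dots,n_L\ge 1$; set $N_0=1$ and $N_l=\prod_{k=1}^l n_k$. Nodes at depth $l\in\{1,\dots,L\}$ are indexed by $i_{1:l}=(i_1,\dots,i_l)$ with $i_k\in\{1,\dots,n_k\}$. Let $\mathcal Z$ be a measurable data space. Let $\mathcal P_L=\mathcal Z$ and, for $0\le l<L$, let $\mathcal P_l$ be the set of probability measures on $\mathcal P_{l+1}$. A fixed meta-distribution $D\in\mathcal P_0$ is given. The random tree $\mu=(\mu_l^{i_{1:l}})$: $\mu_1^{i_1}$ i.i.d. $D$; for $l\ge2$, conditionally on depths $<l$, the $\mu_l^{i_{1:l}}$ are independent with $\mu_l^{i_{1:l}}\sim\mu_{l-1}^{i_{1:l-1}}$; leaves $\mu_L^{i_{1:L}}\in\mathcal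 Z$ are data points. For $\nu\in\mathcal P_l$, "$Z\sim\nu$" means drawing $\nu_{l+1}\sim\nu,\dots,\nu_L\sim\nu_{L-1}$ with fresh randomness and setting $Z=\nu_L$. $(\mathcal W,\rho)$ is a metric hypothesis space, $\ell:\mathcal W\times\mathcal Z\to\mathbb R$ a measurable loss, $P_{W\mid\mu}$ a Markov kernel from the tree to $\mathcal W$. $\hat L(w,\mu)=\frac1{N_L}\sum_{i_{1:L}}\ell(w,\mu_L^{i_{1:L}})$, $L(w)=\mathbb{E}_{Z\sim D}\ell(w,Z)$, $\mathrm{gen}(P_{W\mid\mu})=\mathbb{E}[L(W)-\hat L(W,\mu)]$. Supersample construction. For every depth $l\ge1$ and index $i_{1:l}$ let $U_l^{i_{1:l}}$ be uniform on $\{1,2\}$, all mutually independent and independent of everything else. At depth 1, $\tilde\mu_1^{i_1}=(\mu_{1,1}^{i_1},\mu_{1,2}^{i_1})\sim D^{\otimes2}$ independently over $i_1$. For $l\ge2$, conditionally on all depths $<l$, $\tilde\mu_l^{i_{1:l}}=(\mu_{l,1}^{i_{1:l}},\mu_{l,2}^{i_{1:l}})$ are two independent draws from the selected parent $\mu_{l-1}^{i_{1:l-1}}:=\mu_{l-1,U_{l-1}^{i_{1:l-1}}}^{i_{1:l-1}}$, independently over nodes. The selected node is $\mu_l^{i_{1:l}}:=\mu_{l,U_l^{i_{1:l}}}^{i_{1:l}}$ and the ghost node is $\bar\mu_l^{i_{1:l}}:=\mu_{l,3-U_l^{i_{1:l}}}^{i_{1:l}}$. The selected nodes form a tree with the same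 law as the hierarchical tree, and $W\sim P_{W\mid\mu}$ is computed from this selected tree. $P_{W\mid\tilde\mu_l^{i_{1:l}},U_l^{i_{1:l}}}$ and $P_{W\mid\tilde\mu_l^{i_{1:l}}}$ denote the conditional laws of $W$ given $(\tilde\mu_l^{i_{1:l}},U_l^{i_{1:l}})$ and given $\tilde\mu_l^{i_{1:l}}$ respectively. *)

theory Defs
  imports "HOL-Probability.Probability"
begin

definition nodes :: "(nat \<Rightarrow> nat) \<Rightarrow> nat \<Rightarrow> nat list set" where
  "nodes n l = {v. length v = l \<and> (\<forall>k<l. v ! k < n (Suc k))}"

definition upto_nodes :: "(nat \<Rightarrow> nat) \<Rightarrow> nat \<Rightarrow> nat list set" where
  "upto_nodes n l = (\<Union>k\<in>{1..l}. nodes n k)"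

definition Nprod :: "(nat \<Rightarrow> nat) \<Rightarrow> nat \<Rightarrow> nat" where
  "Nprod n l = (\<Prod>k=1..l. n k)"

(* supersample content of a node: ((first draw, second draw), U);  U = True selects the first *)
definition sel :: "('x \<times> 'x) \<times> bool \<Rightarrow> 'x" where
  "sel a = (if snd a then fst (fst a) else snd (fst a))"

definition ghost :: "('x \<times> 'x) \<times> bool \<Rightarrow> 'x" where
  "ghost a = (if snd a then snd (fst a) else fst (fst a))"

definition coin :: "bool measure" where
  "coin = measure_pmf (bernoulli_pmf (1/2))"

definition Xp :: "(nat \<Rightarrow> 'x measure) \<Rightarrow> nat list \<Rightarrow> ('x \<times> 'x) measure" where
  "Xp X v = X (length v) \<Otimes>\<^sub>M X (length v)"

definition Xn :: "(nat \<Rightarrow> 'x measure) \<Rightarrow> nat list \<Rightarrow> (('x \<times> 'x) \<times> bool) measure" where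
  "Xn X v = Xp X v \<Otimes>\<^sub>M count_space UNIV"

definition node_law ::
  "'x measure \<Rightarrow> (nat \<Rightarrow> 'x \<Rightarrow> 'x measure) \<Rightarrow> (nat list \<Rightarrow> ('x \<times> 'x) \<times> bool)
     \<Rightarrow> nat list \<Rightarrow> (('x \<times> 'x) \<times> bool) measure" where
  "node_law D \<kappa> \<omega> v =
     (let P = (if length v \<le> 1 then D else \<kappa> (length v) (sel (\<omega> (butlast v))))
      in (P \<Otimes>\<^sub>M P) \<Otimes>\<^sub>M coin)"

definition merge_level :: "(nat \<Rightarrow> nat) \<Rightarrow> nat \<Rightarrow> (nat list \<Rightarrow> 'a) \<Rightarrow> (nat list \<Rightarrow> 'a) \<Rightarrow> nat list \<Rightarrow> 'a" where
  "merge_level n l \<omega> \<eta> = (\<lambda>v. if v \<in> nodes n l then \<eta> v else \<omega> v)"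

definition state_space :: "(nat \<Rightarrow> nat) \<Rightarrow> (nat \<Rightarrow> 'x measure) \<Rightarrow> nat
     \<Rightarrow> (nat list \<Rightarrow> ('x \<times> 'x) \<times> bool) measure" where
  "state_space n X l = PiM (upto_nodes n l) (Xn X)"

fun supersample :: "(nat \<Rightarrow> nat) \<Rightarrow> (nat \<Rightarrow> 'x measure) \<Rightarrow> 'x measure
     \<Rightarrow> (nat \<Rightarrow> 'x \<Rightarrow> 'x measure) \<Rightarrow> nat \<Rightarrow> (nat list \<Rightarrow> ('x \<times> 'x) \<times> bool) measure" where
  "supersample n X D \<kappa> 0 = return (state_space n X 0) (\<lambda>_. undefined)"
| "supersample n X D \<kappa> (Suc l) =
     supersample n X D \<kappa> l \<bind>
       (\<lambda>\<omega>. distr (PiM (nodes n (Suc l)) (node_law D \<kappa> \<omega>))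
                   (state_space n X (Suc l)) (merge_level n (Suc l) \<omega>))"

definition sel_tree :: "(nat \<Rightarrow> nat) \<Rightarrow> nat \<Rightarrow> (nat list \<Rightarrow> ('x \<times> 'x) \<times> bool) \<Rightarrow> nat list \<Rightarrow> 'x" where
  "sel_tree n L \<omega> = (\<lambda>v\<in>upto_nodes n L. sel (\<omega> v))"

definition tree_space :: "(nat \<Rightarrow> nat) \<Rightarrow> (nat \<Rightarrow> 'x measure) \<Rightarrow> nat \<Rightarrow> (nat list \<Rightarrow> 'x) measure" where
  "tree_space n X L = PiM (upto_nodes n L) (\<lambda>v. X (length v))"

definition joint_law :: "(nat \<Rightarrow> nat) \<Rightarrow> (nat \<Rightarrow> 'x measure) \<Rightarrow> 'x measure
     \<Rightarrow> (nat \<Rightarrow> 'x \<Rightarrow> 'x measure) \<Rightarrow> nat \<Rightarrow> 'w measure \<Rightarrow> ((nat list \<Rightarrow> 'x) \<Rightarrow> 'w measure)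
     \<Rightarrow> ((nat list \<Rightarrow> ('x \<times> 'x) \<times> bool) \<times> 'w) measure" where
  "joint_law n X D \<kappa> L MW K =
     supersample n X D \<kappa> L \<bind>
       (\<lambda>\<omega>. distr (K (sel_tree n L \<omega>)) (state_space n X L \<Otimes>\<^sub>M MW) (\<lambda>w. (\<omega>, w)))"

(* law of a depth-l node of the hierarchy, "Z ~ D" means level_law L *)
fun level_law :: "'x measure \<Rightarrow> (nat \<Rightarrow> 'x \<Rightarrow> 'x measure) \<Rightarrow> nat \<Rightarrow> 'x measure" where
  "level_law D \<kappa> 0 = D"
| "level_law D \<kappa> (Suc 0) = D"
| "level_law D \<kappa> (Suc (Suc k)) = level_law D \<kappa> (Suc k) \<bind> \<kappa> (Suc (Suc k))"

definition pop_risk :: "'x measure \<Rightarrow> (nat \<Rightarrow> 'x \<Rightarrow> 'x measure) \<Rightarrow> nat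
     \<Rightarrow> ('w \<Rightarrow> 'x \<Rightarrow> real) \<Rightarrow> 'w \<Rightarrow> real" where
  "pop_risk D \<kappa> L loss w = (\<integral>z. loss w z \<partial>level_law D \<kappa> L)"

definition emp_risk :: "(nat \<Rightarrow> nat) \<Rightarrow> nat \<Rightarrow> ('w \<Rightarrow> 'x \<Rightarrow> real) \<Rightarrow> 'w \<Rightarrow> (nat list \<Rightarrow> 'x) \<Rightarrow> real" where
  "emp_risk n L loss w t = (1 / real (Nprod n L)) * (\<Sum>v\<in>nodes n L. loss w (t v))"

definition gen :: "(nat \<Rightarrow> nat) \<Rightarrow> (nat \<Rightarrow> 'x measure) \<Rightarrow> 'x measure
     \<Rightarrow> (nat \<Rightarrow> 'x \<Rightarrow> 'x measure) \<Rightarrow> nat \<Rightarrow> 'w measure \<Rightarrow> ((nat list \<Rightarrow> 'x) \<Rightarrow> 'w measure)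
     \<Rightarrow> ('w \<Rightarrow> 'x \<Rightarrow> real) \<Rightarrow> real" where
  "gen n X D \<kappa> L MW K loss =
     (\<integral>p. pop_risk D \<kappa> L loss (snd p) - emp_risk n L loss (snd p) (sel_tree n L (fst p))
        \<partial>joint_law n X D \<kappa> L MW K)"

definition couplings :: "'w measure \<Rightarrow> 'w measure \<Rightarrow> 'w measure \<Rightarrow> ('w \<times> 'w) measure set" where
  "couplings MW P Q = {\<pi>. \<pi> \<in> space (prob_algebra (MW \<Otimes>\<^sub>M MW)) \<and>
                        distr \<pi> MW fst = P \<and> distr \<pi> MW snd = Q}"

definition wasserstein1 :: "'w::metric_space measure \<Rightarrow> 'w measure \<Rightarrow> 'w measure \<Rightarrow> ennreal" where
  "wasserstein1 MW P Q = (INF \<pi>\<in>couplings MW P Q. \<integral>\<^sup>+ p. ennreal (dist (fst p) (snd p)) \<partial>\<pi>)"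

definition is_cond_law :: "'j measure \<Rightarrow> 'a measure \<Rightarrow> 'b measure \<Rightarrow> ('j \<Rightarrow> 'a) \<Rightarrow> ('j \<Rightarrow> 'b)
     \<Rightarrow> ('a \<Rightarrow> 'b measure) \<Rightarrow> bool" where
  "is_cond_law J MA MB A B Q \<longleftrightarrow>
     Q \<in> MA \<rightarrow>\<^sub>M prob_algebra MB \<and>
     distr J (MA \<Otimes>\<^sub>M MB) (\<lambda>j. (A j, B j)) =
       distr J MA A \<bind> (\<lambda>a. distr (Q a) (MA \<Otimes>\<^sub>M MB) (\<lambda>b. (a, b)))"

end

(* Replacing the training leaf below a node by a fresh one, level by level along its root path, reduces
   the generalization gap to one-node comparisons.  In the supersample the ghost at a node is a fresh draw
   from the parent given the selected tree, hence given the hypothesis; so the increment at one level is the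
   expected difference of the loss at the ghost and at the selected node.  If the hypothesis is drawn from its
   law given the unordered pair this difference vanishes by symmetry of the coin, and passing to the law given
   the pair and the coin costs at most lambda times the Wasserstein distance, once for each of the two terms.

   No integrability is assumed, so the telescoping applies to nonnegative or bounded losses only.  For an
   integrable loss the hypothesis is cut off logarithmically in an envelope of the loss, which costs a factor
   1 + e in the Lipschitz constant, and e tends to 0.  For a non-integrable loss the population risk is the junk
   value 0; then the gap is not integrable unless the right-hand side is infinite, so it is 0 as well. *)

theory Submission
  imports Defs
begin

subsection \<open>Lower integrals and the Wasserstein distance\<close>

text \<open>Expectations are compared in \<open>ennreal\<close>, where Tonelli needs no
  integrability; a signed loss enters only when it is bounded, after adding a constant. Two
  obstacles shape the rest. Integrability of the gap gives none for its two terms, because a part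
  depending on the hypothesis alone cancels between them; truncating the loss at a constant level
  then has no evident dominating function. A factor depending on the hypothesis alone keeps its
  product with the gap below the absolute gap, and clamping at a level that moves with the envelope
  leaves only tails of integrable functions. The logarithm lets the slope of this factor decay like
  the inverse of the envelope, so the product rule costs little. For a non-integrable loss, the
  leaves of the training sum might cancel one another. Leaves grown below a common node are i.i.d.
  given that node; resampling one bounds truncated differences by truncated sums, uniformly in the
  truncation, and the tail of a test point is recovered level by level. The weight
  \<open>1 / N_l\<close> counts paths: a node of depth \<open>l\<close> lies above
  \<open>N_L / N_l\<close> leaves.\<close>

lemma ennreal_mult_div_cancel:
  fixes c x :: ennreal
  assumes "c \<noteq> 0" "c \<noteq> \<top>"
  shows "c * x / c = x" "c * (x / c) = x"
proof -
  show "c * x / c = x"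
    using assms by (subst mult.commute) (rule ennreal_mult_divide_eq)
  then show "c * (x / c) = x"
    by (simp add: ennreal_times_divide)
qed

text \<open>Without measurability of \<open>f\<close> only simple functions are at hand: dividing
  one that lies below \<open>c * f\<close> by \<open>c\<close> gives one below
  \<open>f\<close>.\<close>

lemma nn_integral_cmult_le:
  fixes c :: ennreal
  assumes "c \<noteq> \<top>"
  shows "(\<integral>\<^sup>+x. c * f x \<partial>M) \<le> c * integral\<^sup>N M f"
proof (cases "c = 0")
  case False
  have "integral\<^sup>S M g \<le> c * integral\<^sup>N M f"
    if g: "simple_function M g" "g \<le> (\<lambda>x. c * f x)" for g
  proof -
    have sf: "simple_function M (\<lambda>x. g x / c)"
      using simple_function_compose[OF g(1), of "\<lambda>x. x / c"] by (simp add: comp_def)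
    have g_eq: "c * (g x / c) = g x" for x
      using False assms by (simp add: ennreal_mult_div_cancel)
    have le: "g x / c \<le> f x" for x
    proof -
      have "g x / c \<le> (c * f x) / c"
        using g(2) by (intro divide_right_mono_ennreal) (auto simp: le_fun_def)
      also have "\<dots> = f x"
        using False assms by (simp add: ennreal_mult_div_cancel)
      finally show ?thesis .
    qed
    have "integral\<^sup>S M g = (\<integral>\<^sup>+x. c * (g x / c) \<partial>M)"
      using g by (simp add: g_eq nn_integral_eq_simple_integral)
    also have "\<dots> = c * (\<integral>\<^sup>+x. g x / c \<partial>M)"
      using sf by (intro nn_integral_cmult borel_measurable_simple_function)
    also have "\<dots> \<le> c * integral\<^sup>N M f"
      by (intro mult_left_mono nn_integral_mono le) simp
    finally show ?thesis .
  qed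
  then show ?thesis
    unfolding nn_integral_def[of M "\<lambda>x. c * f x"] by (intro SUP_least) auto
qed simp

text \<open>For non-measurable \<open>h\<close> the integral is a lower integral, which is not subadditive in general.\<close>

lemma nn_integral_le_add_cmult:
  fixes f g h :: "'a \<Rightarrow> ennreal"
  assumes [measurable]: "f \<in> borel_measurable M" "g \<in> borel_measurable M"
    and le: "\<And>x. x \<in> space M \<Longrightarrow> f x \<le> g x + c * h x" and c: "c \<noteq> \<top>"
  shows "integral\<^sup>N M f \<le> integral\<^sup>N M g + c * integral\<^sup>N M h"
proof -
  \<comment> \<open>A difference of measurable functions is measurable, so additivity is never
    applied to \<open>h\<close>. The value 0 is set by hand because \<open>\<top> - \<top>\<close>
    is \<open>\<top>\<close> in \<open>ennreal\<close>.\<close>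
  let ?d = "\<lambda>x. if g x = \<top> then 0 else f x - g x"
  have "integral\<^sup>N M f \<le> (\<integral>\<^sup>+x. g x + ?d x \<partial>M)"
    by (intro nn_integral_mono) (auto simp: add_diff_self_ennreal)
  also have "\<dots> = integral\<^sup>N M g + (\<integral>\<^sup>+x. ?d x \<partial>M)"
    by (intro nn_integral_add) measurable
  also have "(\<integral>\<^sup>+x. ?d x \<partial>M) \<le> (\<integral>\<^sup>+x. c * h x \<partial>M)"
    using le by (intro nn_integral_mono) (simp add: ennreal_minus_le_iff)
  also have "\<dots> \<le> c * integral\<^sup>N M h"
    by (rule nn_integral_cmult_le[OF c])
  finally show ?thesis by (simp add: add_left_mono)
qed

text \<open>The bound is solved for \<open>d i\<close> before passing to the infimum. For
  \<open>c = 0\<close> a member of \<open>A\<close> is needed to obtain \<open>x \<le> y\<close> at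
  all, since \<open>0 * \<top>\<close> is 0.\<close>

lemma le_add_mult_INF_ennreal:
  fixes x y :: ennreal
  assumes "c \<noteq> \<top>" "A \<noteq> {}" "\<And>i. i \<in> A \<Longrightarrow> x \<le> y + c * d i"
  shows "x \<le> y + c * (INF i\<in>A. d i)"
proof (cases "c = 0")
  case True
  then show ?thesis using assms by auto
next
  case False
  have "(x - y) / c \<le> d i" if "i \<in> A" "y \<noteq> \<top>" for i
  proof -
    have "(x - y) / c \<le> (c * d i) / c"
      using assms(3)[OF that(1)] that(2)
      by (intro divide_right_mono_ennreal) (simp add: ennreal_minus_le_iff)
    then show ?thesis
      using False assms by (simp add: ennreal_mult_div_cancel)
  qed
  then have "(x - y) / c \<le> (INF i\<in>A. d i)" if "y \<noteq> \<top>"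
    using that by (intro INF_greatest)
  then have "c * ((x - y) / c) \<le> c * (INF i\<in>A. d i)" if "y \<noteq> \<top>"
    using that by (intro mult_left_mono) auto
  then show ?thesis
    using False assms by (cases "y = \<top>") (auto simp: ennreal_mult_div_cancel ennreal_minus_le_iff)
qed

text \<open>The product measure is a coupling. Nonemptiness matters for Lipschitz constant 0, where
  an infinite infimum would be multiplied by 0.\<close>

lemma couplings_nonempty:
  assumes "P \<in> space (prob_algebra M)" "Q \<in> space (prob_algebra M)"
  shows "couplings M P Q \<noteq> {}"
proof -
  have sets: "sets P = sets M" "sets Q = sets M" and p: "prob_space P" "prob_space Q"
    using assms by (auto simp: space_prob_algebra)
  interpret P: prob_space P by fact
  interpret Q: prob_space Q by fact
  have "distr (P \<Otimes>\<^sub>M Q) M fst = distr (P \<Otimes>\<^sub>M Q) P fst"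
       "distr (P \<Otimes>\<^sub>M Q) M snd = distr (P \<Otimes>\<^sub>M Q) Q snd"
    by (simp_all add: sets cong: distr_cong)
  moreover have "distr (P \<Otimes>\<^sub>M Q) P fst = P"
    by (rule Q.distr_pair_fst)
  moreover have "distr (P \<Otimes>\<^sub>M Q) Q snd = Q"
  proof (rule measure_eqI)
    fix A assume "A \<in> sets (distr (P \<Otimes>\<^sub>M Q) Q snd)"
    then have A: "A \<in> sets Q" by simp
    have "emeasure (distr (P \<Otimes>\<^sub>M Q) Q snd) A = emeasure (P \<Otimes>\<^sub>M Q) (space P \<times> A)"
      using A sets.sets_into_space[OF A]
      by (auto simp: emeasure_distr space_pair_measure intro!: arg_cong2[where f=emeasure])
    also have "\<dots> = emeasure Q A"
      using A by (simp add: Q.emeasure_pair_measure_Times P.emeasure_space_1)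
    finally show "emeasure (distr (P \<Otimes>\<^sub>M Q) Q snd) A = emeasure Q A" .
  qed simp
  moreover have "P \<Otimes>\<^sub>M Q \<in> space (prob_algebra (M \<Otimes>\<^sub>M M))"
    using prob_space_pair[OF p] sets by (simp add: space_prob_algebra cong: sets_pair_measure_cong)
  ultimately have "P \<Otimes>\<^sub>M Q \<in> couplings M P Q"
    by (auto simp: couplings_def)
  then show ?thesis by auto
qed

text \<open>The metric need not be measurable with respect to \<open>M\<close>, so the transport cost is a lower integral.\<close>

lemma nn_integral_le_wasserstein1:
  fixes g :: "'w::metric_space \<Rightarrow> ennreal"
  assumes P: "P \<in> space (prob_algebra M)" and Q: "Q \<in> space (prob_algebra M)"
    and g[measurable]: "g \<in> borel_measurable M"
    and lip: "\<And>w w'. w \<in> space M \<Longrightarrow> w' \<in> space M \<Longrightarrow> g w \<le> g w' + ennreal (c * dist w w')"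
    and c: "0 \<le> c"
  shows "integral\<^sup>N P g \<le> integral\<^sup>N Q g + ennreal c * wasserstein1 M P Q" (is ?A)
    and "integral\<^sup>N Q g \<le> integral\<^sup>N P g + ennreal c * wasserstein1 M P Q" (is ?B)
proof -
  have bound: "integral\<^sup>N P g \<le> integral\<^sup>N Q g + ennreal c * (\<integral>\<^sup>+ p. ennreal (dist (fst p) (snd p)) \<partial>\<pi>) \<and>
      integral\<^sup>N Q g \<le> integral\<^sup>N P g + ennreal c * (\<integral>\<^sup>+ p. ennreal (dist (fst p) (snd p)) \<partial>\<pi>)"
    if \<pi>: "\<pi> \<in> couplings M P Q" for \<pi>
  proof -
    have sets[measurable_cong]: "sets \<pi> = sets (M \<Otimes>\<^sub>M M)" and P: "P = distr \<pi> M fst" and Q: "Q = distr \<pi> M snd"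
      using \<pi> by (auto simp: couplings_def space_prob_algebra)
    have sp: "space \<pi> = space M \<times> space M"
      using sets_eq_imp_space_eq[OF sets] by (simp add: space_pair_measure)
    have *: "(\<integral>\<^sup>+p. g (a p) \<partial>\<pi>) \<le> (\<integral>\<^sup>+p. g (b p) \<partial>\<pi>) + ennreal c * (\<integral>\<^sup>+ p. ennreal (dist (fst p) (snd p)) \<partial>\<pi>)"
      if [measurable]: "a \<in> \<pi> \<rightarrow>\<^sub>M M" "b \<in> \<pi> \<rightarrow>\<^sub>M M" and ab: "\<And>p. dist (a p) (b p) = dist (fst p) (snd p)"
      for a b
    proof (rule nn_integral_le_add_cmult)
      fix p assume "p \<in> space \<pi>"
      then have "a p \<in> space M" "b p \<in> space M"
        by (auto intro!: measurable_space[OF that(1)] measurable_space[OF that(2)])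
      from lip[OF this] show "g (a p) \<le> g (b p) + ennreal c * ennreal (dist (fst p) (snd p))"
        using c by (simp add: ab ennreal_mult)
    qed measurable
    have "integral\<^sup>N P g = (\<integral>\<^sup>+p. g (fst p) \<partial>\<pi>)" "integral\<^sup>N Q g = (\<integral>\<^sup>+p. g (snd p) \<partial>\<pi>)"
      unfolding P Q by (auto intro!: nn_integral_distr)
    with *[of fst snd] *[of snd fst] show ?thesis
      by (simp add: dist_commute)
  qed
  note ne = couplings_nonempty[OF P Q]
  show ?A unfolding wasserstein1_def by (rule le_add_mult_INF_ennreal[OF _ ne]) (use bound in auto)
  show ?B unfolding wasserstein1_def by (rule le_add_mult_INF_ennreal[OF _ ne]) (use bound in auto)
qed

subsection \<open>Finite products of probability measures\<close>

text \<open>Results in the locale \<open>product_prob_space\<close> ask for a probability measure at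
  every index, whereas here only the indices in \<open>I\<close> carry one; Dirac measures fill the
  rest.\<close>

lemma product_prob_space_extend:
  assumes "\<And>i. i \<in> I \<Longrightarrow> prob_space (M i)"
  obtains M' where "product_prob_space M'" "\<And>i. i \<in> I \<Longrightarrow> M' i = M i"
proof
  let ?M' = "\<lambda>i. if i \<in> I then M i else return (count_space UNIV) undefined"
  have "prob_space (?M' i)" for i
    using assms by (auto intro: prob_space_return)
  then show "product_prob_space ?M'"
    unfolding product_prob_space_def product_sigma_finite_def product_prob_space_axioms_def
    using prob_space_imp_sigma_finite by blast
qed auto

lemma emeasure_PiM_prob:
  assumes "finite I" "\<And>i. i \<in> I \<Longrightarrow> prob_space (M i)" "\<And>i. i \<in> I \<Longrightarrow> A i \<in> sets (M i)"
  shows "emeasure (PiM I M) (Pi\<^sub>E I A) = (\<Prod>i\<in>I. emeasure (M i) (A i))"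
proof -
  obtain M' where M': "product_prob_space M'" "\<And>i. i \<in> I \<Longrightarrow> M' i = M i"
    using product_prob_space_extend[of I M] assms(2) by blast
  interpret product_prob_space M' by fact
  have "PiM I M = PiM I M'" using M' by (intro PiM_cong) auto
  then show ?thesis using assms M' by (simp add: emeasure_PiM)
qed

lemma PiM_prob_eqI:
  assumes "finite I" "\<And>i. i \<in> I \<Longrightarrow> prob_space (M i)" "sets P = sets (PiM I M)"
    and "\<And>A. (\<And>i. i \<in> I \<Longrightarrow> A i \<in> sets (M i)) \<Longrightarrow> emeasure P (Pi\<^sub>E I A) = (\<Prod>i\<in>I. emeasure (M i) (A i))"
  shows "P = PiM I M"
proof -
  obtain M' where M': "product_prob_space M'" "\<And>i. i \<in> I \<Longrightarrow> M' i = M i"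
    using product_prob_space_extend[of I M] assms(2) by blast
  interpret product_prob_space M' by fact
  have eq: "PiM I M = PiM I M'" using M' by (intro PiM_cong) auto
  show ?thesis unfolding eq
    by (rule PiM_eqI) (use assms M' eq in auto)
qed

lemma nn_integral_PiM_insert:
  assumes "finite I" "i \<notin> I" "\<And>j. j \<in> insert i I \<Longrightarrow> prob_space (M j)"
    and [measurable]: "f \<in> borel_measurable (PiM (insert i I) M)"
  shows "integral\<^sup>N (PiM (insert i I) M) f = (\<integral>\<^sup>+x. \<integral>\<^sup>+y. f (x(i := y)) \<partial>M i \<partial>PiM I M)"
proof -
  obtain M' where M': "product_prob_space M'" "\<And>j. j \<in> insert i I \<Longrightarrow> M' j = M j"
    using product_prob_space_extend[of "insert i I" M] assms(3) by blast
  interpret product_prob_space M' by fact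
  have eq: "PiM (insert i I) M = PiM (insert i I) M'" "PiM I M = PiM I M'"
    using M' by (auto intro!: PiM_cong)
  show ?thesis
    using product_nn_integral_insert[OF assms(1,2), of f] assms(4) M' by (simp add: eq)
qed

lemma nn_integral_PiM_prod:
  assumes "finite I" "\<And>i. i \<in> I \<Longrightarrow> prob_space (M i)" "\<And>i. i \<in> I \<Longrightarrow> f i \<in> borel_measurable (M i)"
  shows "(\<integral>\<^sup>+x. (\<Prod>i\<in>I. f i (x i)) \<partial>PiM I M) = (\<Prod>i\<in>I. integral\<^sup>N (M i) (f i))"
proof -
  obtain M' where M': "product_prob_space M'" "\<And>i. i \<in> I \<Longrightarrow> M' i = M i"
    using product_prob_space_extend[of I M] assms(2) by blast
  interpret product_prob_space M' by fact
  have eq: "PiM I M = PiM I M'" using M' by (intro PiM_cong) auto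
  show ?thesis using product_nn_integral_prod[of I f] assms M' by (simp add: eq)
qed

text \<open>Rectangles form an intersection-stable generator, and the mass of a rectangle is a
  finite product of measurable functions.\<close>

lemma measurable_PiM_kernel:
  assumes fin: "finite I" and K: "\<And>i. i \<in> I \<Longrightarrow> K i \<in> M \<rightarrow>\<^sub>M prob_algebra (N i)"
  shows "(\<lambda>x. PiM I (\<lambda>i. K i x)) \<in> M \<rightarrow>\<^sub>M prob_algebra (PiM I N)"
proof -
  have KD: "prob_space (K i x)" "sets (K i x) = sets (N i)" if "i \<in> I" "x \<in> space M" for i x
    using measurable_space[OF K[OF that(1)] that(2)] by (auto simp: space_prob_algebra)
  show ?thesis
  proof (rule measurable_prob_algebra_generated[where G="{Pi\<^sub>E I A |A. \<forall>i\<in>I. A i \<in> sets (N i)}"])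
    show "sets (PiM I N) = sigma_sets (\<Pi>\<^sub>E i\<in>I. space (N i)) {Pi\<^sub>E I A |A. \<forall>i\<in>I. A i \<in> sets (N i)}"
      using fin by (auto simp: sets_PiM prod_algebra_eq_finite Pi_iff intro!: arg_cong2[where f=sigma_sets])
    show "Int_stable {Pi\<^sub>E I A |A. \<forall>i\<in>I. A i \<in> sets (N i)}"
      by (rule Int_stable_PiE)
    show "{Pi\<^sub>E I A |A. \<forall>i\<in>I. A i \<in> sets (N i)} \<subseteq> Pow (\<Pi>\<^sub>E i\<in>I. space (N i))"
      by (auto simp: PiE_iff dest: sets.sets_into_space)
    show "prob_space (PiM I (\<lambda>i. K i x))" if "x \<in> space M" for x
      using KD that by (intro prob_space_PiM) auto
    show "sets (PiM I (\<lambda>i. K i x)) = sets (PiM I N)" if "x \<in> space M" for x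
      using KD that by (intro sets_PiM_cong) auto
    fix A assume "A \<in> {Pi\<^sub>E I A |A. \<forall>i\<in>I. A i \<in> sets (N i)}"
    then obtain B where A: "A = Pi\<^sub>E I B" and B: "\<And>i. i \<in> I \<Longrightarrow> B i \<in> sets (N i)" by auto
    have "(\<lambda>x. \<Prod>i\<in>I. emeasure (K i x) (B i)) \<in> borel_measurable M"
      using B measurable_compose[OF measurable_prob_algebraD[OF K] measurable_emeasure_subprob_algebra]
      by (intro borel_measurable_prod_ennreal) auto
    then show "(\<lambda>x. emeasure (PiM I (\<lambda>i. K i x)) A) \<in> borel_measurable M"
      unfolding A by (rule measurable_cong[THEN iffD2, rotated])
        (use KD B fin in \<open>auto intro!: emeasure_PiM_prob\<close>)
  qed
qed

text \<open>Checked on rectangles, where the integral of a product of one-coordinate functions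
  factorizes.\<close>

lemma bind_PiM:
  assumes fin: "finite I" and M: "\<And>i. i \<in> I \<Longrightarrow> M i \<in> space (prob_algebra (N i))"
    and K[measurable]: "\<And>i. i \<in> I \<Longrightarrow> K i \<in> N i \<rightarrow>\<^sub>M prob_algebra (R i)"
  shows "PiM I M \<bind> (\<lambda>x. PiM I (\<lambda>i. K i (x i))) = PiM I (\<lambda>i. M i \<bind> K i)"
proof (rule PiM_prob_eqI[OF fin])
  have MD: "prob_space (M i)" "sets (M i) = sets (N i)" if "i \<in> I" for i
    using M[OF that] by (auto simp: space_prob_algebra)
  have PM: "PiM I M \<in> space (prob_algebra (PiM I N))"
    using MD by (auto simp: space_prob_algebra intro!: prob_space_PiM sets_PiM_cong)
  have Kx: "(\<lambda>x. PiM I (\<lambda>i. K i (x i))) \<in> PiM I N \<rightarrow>\<^sub>M prob_algebra (PiM I R)"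
    by (rule measurable_PiM_kernel[OF fin]) measurable
  have sb: "sets (M i \<bind> K i) = sets (R i)" if "i \<in> I" for i
    using sets_bind'[OF M[OF that] K[OF that]] .
  show "prob_space (M i \<bind> K i)" if "i \<in> I" for i
    using prob_space_bind'[OF M[OF that] K[OF that]] .
  show "sets (PiM I M \<bind> (\<lambda>x. PiM I (\<lambda>i. K i (x i)))) = sets (PiM I (\<lambda>i. M i \<bind> K i))"
    using sets_bind'[OF PM Kx] sb by (simp cong: sets_PiM_cong)
  fix A assume "\<And>i. i \<in> I \<Longrightarrow> A i \<in> sets (M i \<bind> K i)"
  then have A: "\<And>i. i \<in> I \<Longrightarrow> A i \<in> sets (R i)" using sb by auto
  have sp: "space (M i) = space (N i)" if "i \<in> I" for i
    using sets_eq_imp_space_eq[OF MD(2)[OF that]] .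
  have "emeasure (PiM I M \<bind> (\<lambda>x. PiM I (\<lambda>i. K i (x i)))) (Pi\<^sub>E I A) =
      (\<integral>\<^sup>+x. emeasure (PiM I (\<lambda>i. K i (x i))) (Pi\<^sub>E I A) \<partial>PiM I M)"
    by (rule emeasure_bind_prob_algebra[OF PM Kx]) (use fin A in measurable)
  also have "\<dots> = (\<integral>\<^sup>+x. (\<Prod>i\<in>I. emeasure (K i (x i)) (A i)) \<partial>PiM I M)"
  proof (intro nn_integral_cong emeasure_PiM_prob fin)
    fix x i assume "x \<in> space (PiM I M)" "i \<in> I"
    then have "x i \<in> space (N i)" using sp by (auto simp: space_PiM)
    from measurable_space[OF K[OF \<open>i \<in> I\<close>] this]
    show "prob_space (K i (x i))" "A i \<in> sets (K i (x i))"
      using A \<open>i \<in> I\<close> by (auto simp: space_prob_algebra)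
  qed
  also have "\<dots> = (\<Prod>i\<in>I. \<integral>\<^sup>+y. emeasure (K i y) (A i) \<partial>M i)"
  proof (rule nn_integral_PiM_prod[OF fin MD(1)])
    fix i assume i: "i \<in> I"
    have "(\<lambda>y. emeasure (K i y) (A i)) \<in> borel_measurable (N i)"
      using measurable_compose[OF measurable_prob_algebraD[OF K[OF i]] measurable_emeasure_subprob_algebra[OF A[OF i]]] .
    then show "(\<lambda>y. emeasure (K i y) (A i)) \<in> borel_measurable (M i)"
      using MD(2)[OF i] by (simp cong: measurable_cong_sets)
  qed
  also have "\<dots> = (\<Prod>i\<in>I. emeasure (M i \<bind> K i) (A i))"
    using emeasure_bind_prob_algebra[OF M K A] by (intro prod.cong) auto
  finally show "emeasure (PiM I M \<bind> (\<lambda>x. PiM I (\<lambda>i. K i (x i)))) (Pi\<^sub>E I A) =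
      (\<Prod>i\<in>I. emeasure (M i \<bind> K i) (A i))" .
qed

lemma PiM_return:
  assumes fin: "finite I" and x: "x \<in> space (PiM I M)"
  shows "PiM I (\<lambda>i. return (M i) (x i)) = return (PiM I M) x"
proof (rule PiM_prob_eqI[OF fin, symmetric])
  show "prob_space (return (M i) (x i))" if "i \<in> I" for i
    using x that by (intro prob_space_return) (auto simp: space_PiM)
  show "sets (return (PiM I M) x) = sets (PiM I (\<lambda>i. return (M i) (x i)))"
    by (simp cong: sets_PiM_cong)
  fix A assume A: "\<And>i. i \<in> I \<Longrightarrow> A i \<in> sets (return (M i) (x i))"
  have "x \<in> Pi\<^sub>E I A \<longleftrightarrow> (\<forall>i\<in>I. x i \<in> A i)"
    using x by (auto simp: space_PiM PiE_iff)
  then show "emeasure (return (PiM I M) x) (Pi\<^sub>E I A) = (\<Prod>i\<in>I. emeasure (return (M i) (x i)) (A i))"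
    using A fin by (auto simp: indicator_def sets_PiM_I_finite)
qed

text \<open>Split off coordinate \<open>i\<close>: its first value is overwritten at once, so
  integrating over it contributes only the mass 1.\<close>

lemma nn_integral_PiM_resample:
  assumes fin: "finite I" and i: "i \<in> I" and p: "\<And>j. j \<in> I \<Longrightarrow> prob_space (M j)"
    and f[measurable]: "f \<in> borel_measurable (PiM I M)"
  shows "(\<integral>\<^sup>+x. \<integral>\<^sup>+y. f (x(i := y)) \<partial>M i \<partial>PiM I M) = integral\<^sup>N (PiM I M) f"
proof -
  define J where "J = I - {i}"
  have J: "I = insert i J" "finite J" "i \<notin> J" using fin i by (auto simp: J_def)
  interpret prob_space "M i" using p i by auto
  have "(\<integral>\<^sup>+x. \<integral>\<^sup>+y. f (x(i := y)) \<partial>M i \<partial>PiM I M) =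
        (\<integral>\<^sup>+x. \<integral>\<^sup>+z. \<integral>\<^sup>+y. f ((x(i := z))(i := y)) \<partial>M i \<partial>M i \<partial>PiM J M)"
    unfolding J(1)
  proof (rule nn_integral_PiM_insert)
    have [measurable]: "f \<in> borel_measurable (PiM (insert i J) M)"
      using f J(1) by simp
    show "(\<lambda>x. \<integral>\<^sup>+y. f (x(i := y)) \<partial>M i) \<in> borel_measurable (PiM (insert i J) M)"
    proof (rule borel_measurable_nn_integral)
      have "(\<lambda>(x, y). x(i := y)) \<in> PiM (insert i J) M \<Otimes>\<^sub>M M i \<rightarrow>\<^sub>M PiM (insert i J) M"
        unfolding split_beta
        by (rule measurable_fun_upd[where J="insert i J"]) auto
      from measurable_compose[OF this, of f borel]
      show "(\<lambda>(x, y). f (x(i := y))) \<in> borel_measurable (PiM (insert i J) M \<Otimes>\<^sub>M M i)"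
        by (simp add: split_beta')
    qed
  qed (use J p in auto)
  also have "\<dots> = (\<integral>\<^sup>+x. \<integral>\<^sup>+y. f (x(i := y)) \<partial>M i \<partial>PiM J M)"
    by (simp add: emeasure_space_1)
  also have "\<dots> = integral\<^sup>N (PiM I M) f"
    unfolding J(1) by (rule nn_integral_PiM_insert[symmetric]) (use J p f in auto)
  finally show ?thesis .
qed

subsection \<open>The index tree\<close>

lemma nodes_0: "nodes n 0 = {[]}"
  by (auto simp: nodes_def)

lemma length_nodes: "v \<in> nodes n l \<Longrightarrow> length v = l"
  by (simp add: nodes_def)

lemma snoc_in_nodes_iff: "p @ [k] \<in> nodes n (Suc l) \<longleftrightarrow> p \<in> nodes n l \<and> k < n (Suc l)"
  by (auto simp: nodes_def nth_append less_Suc_eq)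

lemma nodes_Suc: "nodes n (Suc l) = (\<lambda>(p, k). p @ [k]) ` (nodes n l \<times> {..<n (Suc l)})"
proof (intro set_eqI iffI)
  fix v assume v: "v \<in> nodes n (Suc l)"
  then have "v = butlast v @ [last v]"
    by (metis append_butlast_last_id length_nodes length_0_conv nat.distinct(1))
  with v show "v \<in> (\<lambda>(p, k). p @ [k]) ` (nodes n l \<times> {..<n (Suc l)})"
    by (metis (mono_tags, lifting) SigmaI case_prod_conv image_eqI lessThan_iff snoc_in_nodes_iff)
qed (auto simp: snoc_in_nodes_iff)

lemma butlast_nodes: "v \<in> nodes n (Suc l) \<Longrightarrow> butlast v \<in> nodes n l"
  by (auto simp: nodes_Suc)

lemma finite_nodes [simp]: "finite (nodes n l)"
  by (induction l) (simp_all add: nodes_0 nodes_Suc)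

lemma take_nodes: "v \<in> nodes n m \<Longrightarrow> l \<le> m \<Longrightarrow> take l v \<in> nodes n l"
  by (auto simp: nodes_def)

lemma sum_nodes_Suc: "(\<Sum>v\<in>nodes n (Suc l). g v) = (\<Sum>p\<in>nodes n l. \<Sum>k<n (Suc l). g (p @ [k]))"
proof -
  have "inj_on (\<lambda>(p, k). p @ [k]) (nodes n l \<times> {..<n (Suc l)})"
    by (auto simp: inj_on_def)
  then show ?thesis
    by (simp add: nodes_Suc sum.reindex sum.cartesian_product case_prod_unfold comp_def)
qed

lemma Nprod_Suc: "Nprod n (Suc l) = Nprod n l * n (Suc l)"
  by (simp add: Nprod_def)

lemma card_nodes: "card (nodes n l) = Nprod n l"
proof (induction l)
  case (Suc l)
  have "card (nodes n (Suc l)) = (\<Sum>v\<in>nodes n (Suc l). 1)" by simp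
  also have "\<dots> = card (nodes n l) * n (Suc l)" by (subst sum_nodes_Suc) simp
  finally show ?case by (simp add: Suc Nprod_Suc)
qed (simp add: nodes_0 Nprod_def)

lemma upto_nodes_iff: "v \<in> upto_nodes n l \<longleftrightarrow> 1 \<le> length v \<and> length v \<le> l \<and> v \<in> nodes n (length v)"
  by (auto simp: upto_nodes_def nodes_def)

lemma upto_nodes_0 [simp]: "upto_nodes n 0 = {}"
  by (auto simp: upto_nodes_def)

lemma upto_nodes_Suc: "upto_nodes n (Suc l) = upto_nodes n l \<union> nodes n (Suc l)"
  by (auto simp: upto_nodes_def atLeastAtMostSuc_conv)

lemma nodes_subset_upto: "1 \<le> l \<Longrightarrow> l \<le> m \<Longrightarrow> nodes n l \<subseteq> upto_nodes n m"
  by (auto simp: upto_nodes_def)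

lemma finite_upto_nodes [simp]: "finite (upto_nodes n l)"
  by (simp add: upto_nodes_def)

lemma measurable_merge_level:
  "(\<lambda>(\<omega>, \<eta>). merge_level n (Suc l) \<omega> \<eta>) \<in>
     PiM (upto_nodes n l) N \<Otimes>\<^sub>M PiM (nodes n (Suc l)) N \<rightarrow>\<^sub>M PiM (upto_nodes n (Suc l)) N"
proof (rule measurable_PiM_single')
  fix v assume v: "v \<in> upto_nodes n (Suc l)"
  show "(\<lambda>p. (case p of (\<omega>, \<eta>) \<Rightarrow> merge_level n (Suc l) \<omega> \<eta>) v) \<in>
      PiM (upto_nodes n l) N \<Otimes>\<^sub>M PiM (nodes n (Suc l)) N \<rightarrow>\<^sub>M N v"
    using v unfolding merge_level_def split_beta upto_nodes_Suc
    by (cases "v \<in> nodes n (Suc l)") auto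
next
  show "(\<lambda>p v. (case p of (\<omega>, \<eta>) \<Rightarrow> merge_level n (Suc l) \<omega> \<eta>) v) \<in>
      space (PiM (upto_nodes n l) N \<Otimes>\<^sub>M PiM (nodes n (Suc l)) N) \<rightarrow> (\<Pi>\<^sub>E i\<in>upto_nodes n (Suc l). space (N i))"
    by (auto simp: space_pair_measure space_PiM merge_level_def upto_nodes_Suc PiE_iff extensional_def)
qed

subsection \<open>A single supersample node\<close>

text \<open>The node law as a function of the parent measure alone; \<open>node_law\<close> reads
  that measure off the whole state.\<close>

definition node_pair :: "'x measure \<Rightarrow> (('x \<times> 'x) \<times> bool) measure" where
  "node_pair P = (P \<Otimes>\<^sub>M P) \<Otimes>\<^sub>M coin"

lemma sets_coin [simp, measurable_cong]: "sets coin = sets (count_space UNIV)"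
  by (simp add: coin_def)

lemma prob_space_coin: "prob_space coin"
  by (simp add: coin_def prob_space_measure_pmf)

lemma coin_in_prob_algebra: "coin \<in> space (prob_algebra (count_space UNIV))"
  by (simp add: space_prob_algebra prob_space_coin)

lemma nn_integral_coin: "(\<integral>\<^sup>+b. f b \<partial>coin) = (f True + f False) / 2"
proof -
  have "(\<integral>\<^sup>+b. f b \<partial>coin) = f True * ennreal (1/2) + f False * ennreal (1/2)"
    unfolding coin_def by (subst nn_integral_bernoulli_pmf) auto
  also have "ennreal (1/2) = 1 / 2"
    by (simp add: divide_ennreal[symmetric] divide_ennreal_def)
  finally show ?thesis
    by (simp add: add_divide_distrib_ennreal ennreal_times_divide)
qed

lemma measurable_sel [measurable]: "sel \<in> (M \<Otimes>\<^sub>M M) \<Otimes>\<^sub>M count_space UNIV \<rightarrow>\<^sub>M M"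
  unfolding sel_def by measurable

lemma measurable_ghost [measurable]: "ghost \<in> (M \<Otimes>\<^sub>M M) \<Otimes>\<^sub>M count_space UNIV \<rightarrow>\<^sub>M M"
  unfolding ghost_def by measurable

lemma node_pair_in_prob_algebra:
  assumes "P \<in> space (prob_algebra M)"
  shows "node_pair P \<in> space (prob_algebra ((M \<Otimes>\<^sub>M M) \<Otimes>\<^sub>M count_space UNIV))"
  using assms unfolding node_pair_def space_prob_algebra
  by (auto intro!: sets_pair_measure_cong prob_space_pair prob_space_coin)

lemma nn_integral_node_pair:
  assumes P: "P \<in> space (prob_algebra M)"
    and f[measurable]: "f \<in> borel_measurable ((M \<Otimes>\<^sub>M M) \<Otimes>\<^sub>M count_space UNIV)"
  shows "integral\<^sup>N (node_pair P) f = (\<integral>\<^sup>+x. \<integral>\<^sup>+y. (f ((x, y), True) + f ((x, y), False)) / 2 \<partial>P \<partial>P)"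
proof -
  have [measurable_cong]: "sets P = sets M" and "prob_space P"
    using P by (auto simp: space_prob_algebra)
  interpret P: prob_space P by fact
  interpret C: prob_space coin by (rule prob_space_coin)
  have "integral\<^sup>N (node_pair P) f = (\<integral>\<^sup>+p. \<integral>\<^sup>+b. f (p, b) \<partial>coin \<partial>(P \<Otimes>\<^sub>M P))"
    unfolding node_pair_def by (rule C.nn_integral_fst[symmetric]) measurable
  also have "\<dots> = (\<integral>\<^sup>+p. (f (p, True) + f (p, False)) / 2 \<partial>(P \<Otimes>\<^sub>M P))"
    by (simp add: nn_integral_coin)
  also have "\<dots> = (\<integral>\<^sup>+x. \<integral>\<^sup>+y. (f ((x, y), True) + f ((x, y), False)) / 2 \<partial>P \<partial>P)"
    by (rule P.nn_integral_fst[symmetric]) measurable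
  finally show ?thesis .
qed

text \<open>The fair coin merely exchanges two independent draws from one law, so selected and ghost
  entry are again two independent draws: averaging over the coin symmetrizes \<open>G\<close>, and
  Tonelli identifies the two halves.\<close>

lemma nn_integral_node_pair_sel_ghost:
  assumes P: "P \<in> space (prob_algebra M)"
    and G[measurable]: "G \<in> borel_measurable (M \<Otimes>\<^sub>M M)"
  shows "(\<integral>\<^sup>+a. G (sel a, ghost a) \<partial>node_pair P) = (\<integral>\<^sup>+x. \<integral>\<^sup>+y. G (x, y) \<partial>P \<partial>P)"
proof -
  have [measurable_cong]: "sets P = sets M" and "prob_space P"
    using P by (auto simp: space_prob_algebra)
  interpret P: prob_space P by fact
  interpret PP: pair_sigma_finite P P ..
  have "(\<integral>\<^sup>+a. G (sel a, ghost a) \<partial>node_pair P) = (\<integral>\<^sup>+x. \<integral>\<^sup>+y. (G (x, y) + G (y, x)) / 2 \<partial>P \<partial>P)"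
    by (subst nn_integral_node_pair[OF P]) (simp_all add: sel_def ghost_def)
  also have "\<dots> = ((\<integral>\<^sup>+x. \<integral>\<^sup>+y. G (x, y) \<partial>P \<partial>P) + (\<integral>\<^sup>+x. \<integral>\<^sup>+y. G (y, x) \<partial>P \<partial>P)) / 2"
  proof -
    have "(\<integral>\<^sup>+y. (G (x, y) + G (y, x)) / 2 \<partial>P) = ((\<integral>\<^sup>+y. G (x, y) \<partial>P) + (\<integral>\<^sup>+y. G (y, x) \<partial>P)) / 2"
      if [measurable]: "x \<in> space M" for x
      by (subst nn_integral_divide, measurable) (subst nn_integral_add, auto)
    then have "(\<integral>\<^sup>+x. \<integral>\<^sup>+y. (G (x, y) + G (y, x)) / 2 \<partial>P \<partial>P) =
        (\<integral>\<^sup>+x. ((\<integral>\<^sup>+y. G (x, y) \<partial>P) + (\<integral>\<^sup>+y. G (y, x) \<partial>P)) / 2 \<partial>P)"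
      using sets_eq_imp_space_eq[OF \<open>sets P = sets M\<close>] by (intro nn_integral_cong) auto
    also have "\<dots> = ((\<integral>\<^sup>+x. \<integral>\<^sup>+y. G (x, y) \<partial>P \<partial>P) + (\<integral>\<^sup>+x. \<integral>\<^sup>+y. G (y, x) \<partial>P \<partial>P)) / 2"
      by (subst nn_integral_divide, measurable) (subst nn_integral_add, auto)
    finally show ?thesis .
  qed
  also have "(\<integral>\<^sup>+x. \<integral>\<^sup>+y. G (y, x) \<partial>P \<partial>P) = (\<integral>\<^sup>+x. \<integral>\<^sup>+y. G (x, y) \<partial>P \<partial>P)"
    using PP.Fubini'[of "\<lambda>x y. G (x, y)"] by simp
  also have "((\<integral>\<^sup>+x. \<integral>\<^sup>+y. G (x, y) \<partial>P \<partial>P) + (\<integral>\<^sup>+x. \<integral>\<^sup>+y. G (x, y) \<partial>P \<partial>P)) / 2 =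
      (\<integral>\<^sup>+x. \<integral>\<^sup>+y. G (x, y) \<partial>P \<partial>P)"
    using ennreal_mult_div_cancel(1)[of 2] by (simp add: mult_2[symmetric])
  finally show ?thesis .
qed

lemma distr_node_pair_sel:
  assumes P: "P \<in> space (prob_algebra M)"
  shows "distr (node_pair P) M sel = P"
proof (rule measure_eqI)
  have sP[measurable_cong]: "sets P = sets M" and "prob_space P"
    using P by (auto simp: space_prob_algebra)
  interpret P: prob_space P by fact
  have [measurable_cong]: "sets (node_pair P) = sets ((M \<Otimes>\<^sub>M M) \<Otimes>\<^sub>M count_space UNIV)"
    using node_pair_in_prob_algebra[OF P] by (simp add: space_prob_algebra)
  show "sets (distr (node_pair P) M sel) = sets P" by (simp add: sP)
  fix A assume "A \<in> sets (distr (node_pair P) M sel)"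
  then have [measurable]: "A \<in> sets M" by simp
  have "emeasure (distr (node_pair P) M sel) A = (\<integral>\<^sup>+a. indicator A a \<partial>distr (node_pair P) M sel)"
    by simp
  also have "\<dots> = (\<integral>\<^sup>+a. indicator A (sel a) \<partial>node_pair P)"
    by (rule nn_integral_distr) measurable
  also have "\<dots> = emeasure P A"
    using nn_integral_node_pair_sel_ghost[OF P, of "\<lambda>p. indicator A (fst p)"]
    by (simp add: P.emeasure_space_1 sP)
  finally show "emeasure (distr (node_pair P) M sel) A = emeasure P A" .
qed

lemma nn_integral_node_pair_flip:
  assumes P: "P \<in> space (prob_algebra M)"
    and f[measurable]: "f \<in> borel_measurable ((M \<Otimes>\<^sub>M M) \<Otimes>\<^sub>M count_space UNIV)"
  shows "(\<integral>\<^sup>+a. f (fst a, \<not> snd a) \<partial>node_pair P) = integral\<^sup>N (node_pair P) f"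
  by (subst (1 2) nn_integral_node_pair[OF P]) (simp_all add: add.commute)

text \<open>Nodes of one level are independent given their parents, so only node \<open>u\<close>
  matters, and there the ghost is independent of the selected entry.\<close>

lemma nn_integral_PiM_node_pair_ghost:
  assumes fin: "finite I" and u: "u \<in> I"
    and P: "\<And>i. i \<in> I \<Longrightarrow> P i \<in> space (prob_algebra (N i))"
    and G[measurable]: "G \<in> borel_measurable (PiM I N \<Otimes>\<^sub>M N u)"
  shows "(\<integral>\<^sup>+\<eta>. G (\<lambda>i\<in>I. sel (\<eta> i), ghost (\<eta> u)) \<partial>PiM I (\<lambda>i. node_pair (P i))) =
    (\<integral>\<^sup>+\<eta>. \<integral>\<^sup>+y. G (\<lambda>i\<in>I. sel (\<eta> i), y) \<partial>P u \<partial>PiM I (\<lambda>i. node_pair (P i)))"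
proof -
  define J where "J = I - {u}"
  have I: "I = insert u J" and J: "finite J" "u \<notin> J" using fin u by (auto simp: J_def)
  have sP[measurable_cong]: "sets (P u) = sets (N u)" using P[OF u] by (auto simp: space_prob_algebra)
  interpret Pu: prob_space "P u" using P[OF u] by (auto simp: space_prob_algebra)
  have np: "node_pair (P i) \<in> space (prob_algebra ((N i \<Otimes>\<^sub>M N i) \<Otimes>\<^sub>M count_space UNIV))" if "i \<in> I" for i
    using node_pair_in_prob_algebra[OF P[OF that]] .
  then have pr: "prob_space (node_pair (P i))"
    and st: "sets (node_pair (P i)) = sets ((N i \<Otimes>\<^sub>M N i) \<Otimes>\<^sub>M count_space UNIV)" if "i \<in> I" for i
    using that by (auto simp: space_prob_algebra)
  have [measurable_cong]: "sets (PiM I (\<lambda>i. node_pair (P i))) = sets (PiM I (\<lambda>i. (N i \<Otimes>\<^sub>M N i) \<Otimes>\<^sub>M count_space UNIV))"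
    "sets (PiM J (\<lambda>i. node_pair (P i))) = sets (PiM J (\<lambda>i. (N i \<Otimes>\<^sub>M N i) \<Otimes>\<^sub>M count_space UNIV))"
    using st I by (auto intro!: sets_PiM_cong)
  have comp[measurable]: "(\<lambda>\<eta>. \<eta> i) \<in> PiM I (\<lambda>i. node_pair (P i)) \<rightarrow>\<^sub>M ((N i \<Otimes>\<^sub>M N i) \<Otimes>\<^sub>M count_space UNIV)" if "i \<in> I" for i
    using measurable_component_singleton[OF that, of "\<lambda>i. node_pair (P i)"] st[OF that] by (simp cong: measurable_cong_sets)
  have sl[measurable]: "(\<lambda>\<eta>. \<lambda>i\<in>I. sel (\<eta> i)) \<in> PiM I (\<lambda>i. node_pair (P i)) \<rightarrow>\<^sub>M PiM I N"
    using measurable_compose[OF comp measurable_sel] by (intro measurable_restrict) auto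
  note [measurable] = u
  have m1: "(\<lambda>\<eta>. G (\<lambda>i\<in>I. sel (\<eta> i), ghost (\<eta> u))) \<in> borel_measurable (PiM I (\<lambda>i. node_pair (P i)))"
    by measurable
  have m2: "(\<lambda>\<eta>. \<integral>\<^sup>+y. G (\<lambda>i\<in>I. sel (\<eta> i), y) \<partial>P u) \<in> borel_measurable (PiM I (\<lambda>i. node_pair (P i)))"
    by measurable
  have upd: "(\<lambda>i\<in>I. sel ((x(u := a)) i)) = (\<lambda>i\<in>J. sel (x i))(u := sel a)" for x a
    using J by (auto simp: I fun_eq_iff)
  have eq: "(\<integral>\<^sup>+a. G ((\<lambda>i\<in>J. sel (x i))(u := sel a), ghost a) \<partial>node_pair (P u)) =
      (\<integral>\<^sup>+a. \<integral>\<^sup>+y. G ((\<lambda>i\<in>J. sel (x i))(u := sel a), y) \<partial>P u \<partial>node_pair (P u))"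
    if x: "x \<in> space (PiM J (\<lambda>i. node_pair (P i)))" for x
  proof -
    have "x i \<in> space ((N i \<Otimes>\<^sub>M N i) \<Otimes>\<^sub>M count_space UNIV)" if "i \<in> J" for i
      using x that sets_eq_imp_space_eq[OF st[of i]] by (auto simp: space_PiM I)
    then have x': "(\<lambda>i\<in>J. sel (x i)) \<in> space (PiM J N)"
      by (auto simp: space_PiM intro: measurable_space[OF measurable_sel])
    have [measurable]: "(\<lambda>p. (\<lambda>i\<in>J. sel (x i))(u := fst p)) \<in> N u \<Otimes>\<^sub>M N u \<rightarrow>\<^sub>M PiM I N"
      unfolding I by (rule measurable_fun_upd[where J=J]) (use x' in auto)
    have m: "(\<lambda>p. G ((\<lambda>i\<in>J. sel (x i))(u := fst p), snd p)) \<in> borel_measurable (N u \<Otimes>\<^sub>M N u)"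
      by measurable
    have m': "(\<lambda>p. \<integral>\<^sup>+y. G ((\<lambda>i\<in>J. sel (x i))(u := fst p), y) \<partial>P u) \<in> borel_measurable (N u \<Otimes>\<^sub>M N u)"
      by measurable
    \<comment> \<open>The second application concerns the function already averaged over
      \<open>y\<close>; it ignores the ghost, whose draw integrates to 1.\<close>
    show ?thesis
      using nn_integral_node_pair_sel_ghost[OF P[OF u] m] nn_integral_node_pair_sel_ghost[OF P[OF u] m']
      by (simp add: Pu.emeasure_space_1)
  qed
  have "(\<integral>\<^sup>+\<eta>. G (\<lambda>i\<in>I. sel (\<eta> i), ghost (\<eta> u)) \<partial>PiM I (\<lambda>i. node_pair (P i))) =
     (\<integral>\<^sup>+x. \<integral>\<^sup>+a. G (\<lambda>i\<in>I. sel ((x(u := a)) i), ghost ((x(u := a)) u)) \<partial>node_pair (P u) \<partial>PiM J (\<lambda>i. node_pair (P i)))"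
    using nn_integral_PiM_insert[OF J, of "\<lambda>i. node_pair (P i)"] m1 pr unfolding I by blast
  also have "\<dots> = (\<integral>\<^sup>+x. \<integral>\<^sup>+a. \<integral>\<^sup>+y. G (\<lambda>i\<in>I. sel ((x(u := a)) i), y) \<partial>P u \<partial>node_pair (P u) \<partial>PiM J (\<lambda>i. node_pair (P i)))"
    unfolding upd fun_upd_same by (intro nn_integral_cong eq)
  also have "\<dots> = (\<integral>\<^sup>+\<eta>. \<integral>\<^sup>+y. G (\<lambda>i\<in>I. sel (\<eta> i), y) \<partial>P u \<partial>PiM I (\<lambda>i. node_pair (P i)))"
    using nn_integral_PiM_insert[OF J, of "\<lambda>i. node_pair (P i)"] m2 pr unfolding I by (rule_tac sym) blast
  finally show ?thesis .
qed

subsection \<open>The law of the supersample\<close>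

lemma Xn_eq: "length v = l \<Longrightarrow> Xn X v = (X l \<Otimes>\<^sub>M X l) \<Otimes>\<^sub>M count_space UNIV"
  by (simp add: Xn_def Xp_def)

lemma measurable_sel_Xn: "sel \<in> Xn X v \<rightarrow>\<^sub>M X (length v)"
  by (simp add: Xn_eq)

lemma measurable_ghost_Xn: "ghost \<in> Xn X v \<rightarrow>\<^sub>M X (length v)"
  by (simp add: Xn_eq)

lemma measurable_sel_component: "v \<in> I \<Longrightarrow> (\<lambda>\<omega>. sel (\<omega> v)) \<in> PiM I (Xn X) \<rightarrow>\<^sub>M X (length v)"
  by (rule measurable_compose[OF measurable_component_singleton[of v I "Xn X"] measurable_sel_Xn])

lemma measurable_sel_tree [measurable]: "sel_tree n l \<in> state_space n X l \<rightarrow>\<^sub>M tree_space n X l"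
  unfolding sel_tree_def[abs_def] state_space_def tree_space_def
  by (intro measurable_restrict measurable_sel_component)

lemma merge_level_apply:
  "v \<in> nodes n l \<Longrightarrow> merge_level n l \<omega> \<eta> v = \<eta> v"
  "v \<notin> nodes n l \<Longrightarrow> merge_level n l \<omega> \<eta> v = \<omega> v"
  by (simp_all add: merge_level_def)

lemma sel_tree_merge_level:
  "sel_tree n (Suc l) (merge_level n (Suc l) \<omega> \<eta>) =
    merge_level n (Suc l) (sel_tree n l \<omega>) (\<lambda>v\<in>nodes n (Suc l). sel (\<eta> v))"
  by (auto simp: sel_tree_def merge_level_def upto_nodes_Suc fun_eq_iff)

section \<open>The supersample as a Markov chain over the levels\<close>

locale hierarchy =
  fixes L :: nat and n :: "nat \<Rightarrow> nat" and X :: "nat \<Rightarrow> 'x measure" and D :: "'x measure"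
    and \<kappa> :: "nat \<Rightarrow> 'x \<Rightarrow> 'x measure"
  assumes L: "L \<ge> 1"
    and branching: "\<And>k. k \<in> {1..L} \<Longrightarrow> n k \<ge> 1"
    and D: "D \<in> space (prob_algebra (X 1))"
    and \<kappa>: "\<And>l. l \<in> {2..L} \<Longrightarrow> \<kappa> l \<in> X (l - 1) \<rightarrow>\<^sub>M prob_algebra (X l)"
begin

abbreviation "ss \<equiv> supersample n X D \<kappa>"
abbreviation "S \<equiv> state_space n X"
abbreviation "T \<equiv> tree_space n X"

definition par :: "(nat list \<Rightarrow> 'x) \<Rightarrow> nat list \<Rightarrow> 'x measure" where
  "par t v = (if length v \<le> 1 then D else \<kappa> (length v) (t (butlast v)))"

text \<open>The next level depends on the past only through the selected tree, because ghosts have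
  no descendants. This is what allows deeper levels to be integrated out.\<close>

definition lev :: "nat \<Rightarrow> (nat list \<Rightarrow> 'x) \<Rightarrow> (nat list \<Rightarrow> ('x \<times> 'x) \<times> bool) measure" where
  "lev l t = PiM (nodes n (Suc l)) (\<lambda>v. node_pair (par t v))"

lemma measurable_tree_component: "1 \<le> l \<Longrightarrow> l \<le> m \<Longrightarrow> v \<in> nodes n l \<Longrightarrow> (\<lambda>t. t v) \<in> T m \<rightarrow>\<^sub>M X l"
  using measurable_component_singleton[of v "upto_nodes n m" "\<lambda>v. X (length v)"] nodes_subset_upto[of l m n]
  by (auto simp: tree_space_def length_nodes)

lemma measurable_par_le:
  assumes "Suc l \<le> L" "l \<le> m" "v \<in> nodes n (Suc l)"
  shows "(\<lambda>t. par t v) \<in> T m \<rightarrow>\<^sub>M prob_algebra (X (Suc l))"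
proof (cases "l = 0")
  case True
  then show ?thesis using D length_nodes[OF assms(3)] by (simp add: par_def)
next
  case False
  have "(\<lambda>t. \<kappa> (Suc l) (t (butlast v))) \<in> T m \<rightarrow>\<^sub>M prob_algebra (X (Suc l))"
    using \<kappa>[of "Suc l"] False assms butlast_nodes[OF assms(3)]
    by (intro measurable_compose[OF measurable_tree_component, of l]) auto
  then show ?thesis using False length_nodes[OF assms(3)] by (simp add: par_def)
qed

lemma par_in_prob_algebra:
  "Suc l \<le> L \<Longrightarrow> l \<le> m \<Longrightarrow> v \<in> nodes n (Suc l) \<Longrightarrow> t \<in> space (T m) \<Longrightarrow> par t v \<in> space (prob_algebra (X (Suc l)))"
  using measurable_space[OF measurable_par_le] .

lemma measurable_lev:
  assumes "Suc l \<le> L"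
  shows "lev l \<in> T l \<rightarrow>\<^sub>M prob_algebra (PiM (nodes n (Suc l)) (Xn X))"
proof -
  have "(\<lambda>t. node_pair (par t v)) \<in> T l \<rightarrow>\<^sub>M prob_algebra (Xn X v)" if v: "v \<in> nodes n (Suc l)" for v
    unfolding Xn_eq[OF length_nodes[OF v]] node_pair_def
    using measurable_par_le[OF assms order_refl v] coin_in_prob_algebra by measurable
  then show ?thesis
    unfolding lev_def[abs_def] by (intro measurable_PiM_kernel) auto
qed

lemma node_law_eq:
  assumes "v \<in> nodes n (Suc l)"
  shows "node_law D \<kappa> \<omega> v = node_pair (par (sel_tree n l \<omega>) v)"
proof -
  have "butlast v \<in> upto_nodes n l" if "l \<ge> 1"
    using butlast_nodes[OF assms] nodes_subset_upto[of l l n] that by auto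
  then show ?thesis
    using length_nodes[OF assms] by (auto simp: node_law_def node_pair_def par_def sel_tree_def Let_def)
qed

lemma PiM_node_law_eq: "PiM (nodes n (Suc l)) (node_law D \<kappa> \<omega>) = lev l (sel_tree n l \<omega>)"
  unfolding lev_def by (intro PiM_cong) (auto simp: node_law_eq)

lemma measurable_merge_S:
  "(\<lambda>(\<omega>, \<eta>). merge_level n (Suc l) \<omega> \<eta>) \<in> S l \<Otimes>\<^sub>M PiM (nodes n (Suc l)) (Xn X) \<rightarrow>\<^sub>M S (Suc l)"
  unfolding state_space_def by (rule measurable_merge_level)

lemma measurable_merge_T:
  "(\<lambda>(t, s). merge_level n (Suc l) t s) \<in>
     T l \<Otimes>\<^sub>M PiM (nodes n (Suc l)) (\<lambda>v. X (length v)) \<rightarrow>\<^sub>M T (Suc l)"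
  unfolding tree_space_def by (rule measurable_merge_level)

lemma measurable_sel_level:
  "(\<lambda>\<eta>. \<lambda>v\<in>I. sel (\<eta> v)) \<in> PiM I (Xn X) \<rightarrow>\<^sub>M PiM I (\<lambda>v. X (length v))"
  by (intro measurable_restrict measurable_sel_component)

lemma measurable_step:
  assumes "Suc l \<le> L"
  shows "(\<lambda>\<omega>. distr (lev l (sel_tree n l \<omega>)) (S (Suc l)) (merge_level n (Suc l) \<omega>)) \<in> S l \<rightarrow>\<^sub>M prob_algebra (S (Suc l))"
  by (rule measurable_distr_prob_space2[OF measurable_compose[OF measurable_sel_tree measurable_lev[OF assms]] measurable_merge_S])

lemma ss_Suc: "ss (Suc l) = ss l \<bind> (\<lambda>\<omega>. distr (lev l (sel_tree n l \<omega>)) (S (Suc l)) (merge_level n (Suc l) \<omega>))"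
  by (simp add: PiM_node_law_eq)

declare supersample.simps(2) [simp del]

lemma ss_in_prob_algebra: "l \<le> L \<Longrightarrow> ss l \<in> space (prob_algebra (S l))"
proof (induction l)
  case 0
  show ?case by (auto simp: space_prob_algebra state_space_def space_PiM intro!: prob_space_return)
next
  case (Suc l)
  then show ?case
    using prob_space_bind'[OF _ measurable_step] sets_bind'[OF _ measurable_step]
    by (auto simp: ss_Suc space_prob_algebra)
qed

lemma sets_ss [measurable_cong]: "l \<le> L \<Longrightarrow> sets (ss l) = sets (S l)"
  using ss_in_prob_algebra[of l] by (simp add: space_prob_algebra)

lemma space_ss: "l \<le> L \<Longrightarrow> space (ss l) = space (S l)"
  using sets_eq_imp_space_eq[OF sets_ss] .

lemma prob_space_ss: "l \<le> L \<Longrightarrow> prob_space (ss l)"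
  using ss_in_prob_algebra[of l] by (simp add: space_prob_algebra)

lemma lev_in_prob_algebra:
  "Suc l \<le> L \<Longrightarrow> t \<in> space (T l) \<Longrightarrow> lev l t \<in> space (prob_algebra (PiM (nodes n (Suc l)) (Xn X)))"
  using measurable_space[OF measurable_lev] .

lemma sets_lev: "Suc l \<le> L \<Longrightarrow> t \<in> space (T l) \<Longrightarrow> sets (lev l t) = sets (PiM (nodes n (Suc l)) (Xn X))"
  using lev_in_prob_algebra by (simp add: space_prob_algebra)

lemma sel_tree_in_space: "\<omega> \<in> space (S l) \<Longrightarrow> sel_tree n l \<omega> \<in> space (T l)"
  using measurable_space[OF measurable_sel_tree] .

lemma nn_integral_ss_Suc:
  assumes l: "Suc l \<le> L" and H[measurable]: "H \<in> borel_measurable (S (Suc l))"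
  shows "integral\<^sup>N (ss (Suc l)) H =
    (\<integral>\<^sup>+\<omega>. \<integral>\<^sup>+\<eta>. H (merge_level n (Suc l) \<omega> \<eta>) \<partial>lev l (sel_tree n l \<omega>) \<partial>ss l)"
proof -
  have "integral\<^sup>N (ss (Suc l)) H =
    (\<integral>\<^sup>+\<omega>. \<integral>\<^sup>+x. H x \<partial>distr (lev l (sel_tree n l \<omega>)) (S (Suc l)) (merge_level n (Suc l) \<omega>) \<partial>ss l)"
    unfolding ss_Suc using measurable_prob_algebraD[OF measurable_step[OF l]] l
    by (intro nn_integral_bind[OF H]) (simp cong: measurable_cong_sets add: sets_ss)
  also have "\<dots> = (\<integral>\<^sup>+\<omega>. \<integral>\<^sup>+\<eta>. H (merge_level n (Suc l) \<omega> \<eta>) \<partial>lev l (sel_tree n l \<omega>) \<partial>ss l)"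
  proof (intro nn_integral_cong nn_integral_distr)
    fix \<omega> assume "\<omega> \<in> space (ss l)"
    then have \<omega>: "\<omega> \<in> space (S l)" using l by (simp add: space_ss)
    have "merge_level n (Suc l) \<omega> \<in> PiM (nodes n (Suc l)) (Xn X) \<rightarrow>\<^sub>M S (Suc l)"
      using measurable_Pair2[OF measurable_merge_S \<omega>] by simp
    then show "merge_level n (Suc l) \<omega> \<in> lev l (sel_tree n l \<omega>) \<rightarrow>\<^sub>M S (Suc l)"
      using sets_lev[OF l sel_tree_in_space[OF \<omega>]] by (simp cong: measurable_cong_sets)
    show "H \<in> borel_measurable (distr (lev l (sel_tree n l \<omega>)) (S (Suc l)) (merge_level n (Suc l) \<omega>))"
      by simp
  qed
  finally show ?thesis .
qed

text \<open>The parent of a node of depth at most \<open>Suc m\<close> has depth at most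
  \<open>m\<close>, out of reach of the new level.\<close>

lemma par_merge_level:
  assumes "length u \<le> Suc m"
  shows "par (merge_level n (Suc m) t s) u = par t u"
  using assms by (auto simp: par_def merge_level_def dest: length_nodes)

text \<open>This is the conditional law of a ghost given the selected tree. At the level of
  \<open>u\<close> it is independence inside the level. A deeper level is generated from the
  selected tree alone, so integrating it out turns \<open>H\<close> into a function
  \<open>H'\<close> of the shallower tree and the ghost, to which the induction hypothesis
  applies.\<close>

lemma nn_integral_ghost:
  assumes "l \<ge> 1" "l \<le> m" "m \<le> L" and u: "u \<in> nodes n l"
    and H: "H \<in> borel_measurable (T m \<Otimes>\<^sub>M X l)"
  shows "(\<integral>\<^sup>+\<omega>. H (sel_tree n m \<omega>, ghost (\<omega> u)) \<partial>ss m) =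
    (\<integral>\<^sup>+\<omega>. \<integral>\<^sup>+y. H (sel_tree n m \<omega>, y) \<partial>par (sel_tree n m \<omega>) u \<partial>ss m)"
  using assms(2,1,3-)
proof (induction m arbitrary: H rule: dec_induct)
  case base
  then obtain k where l: "l = Suc k" by (cases l) auto
  note kL = \<open>l \<le> L\<close>[unfolded l]
  note [measurable] = base(4)[unfolded l] measurable_merge_S[of k] measurable_merge_T[of k] measurable_sel_level
  have u: "u \<in> nodes n (Suc k)" using base l by simp
  have u': "u \<in> upto_nodes n (Suc k)" using u by (simp add: upto_nodes_Suc)
  have lu: "length u = Suc k" using length_nodes[OF u] .
  have gu[measurable]: "(\<lambda>\<omega>. ghost (\<omega> u)) \<in> S (Suc k) \<rightarrow>\<^sub>M X (Suc k)"
    using measurable_compose[OF measurable_component_singleton[OF u', of "Xn X"] measurable_ghost_Xn] lu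
    by (simp add: state_space_def)
  have [measurable]: "(\<lambda>\<omega>. \<integral>\<^sup>+y. H (sel_tree n (Suc k) \<omega>, y) \<partial>par (sel_tree n (Suc k) \<omega>) u) \<in> borel_measurable (S (Suc k))"
    by (rule nn_integral_measurable_subprob_algebra2[where N="X (Suc k)"])
      (use measurable_compose[OF measurable_sel_tree measurable_prob_algebraD[OF measurable_par_le[OF kL _ u]], of "Suc k"] in auto)
  have m: "(\<lambda>\<omega>. H (sel_tree n (Suc k) \<omega>, ghost (\<omega> u))) \<in> borel_measurable (S (Suc k))"
    by measurable
  have "(\<integral>\<^sup>+\<omega>. H (sel_tree n (Suc k) \<omega>, ghost (\<omega> u)) \<partial>ss (Suc k)) =
     (\<integral>\<^sup>+\<omega>. \<integral>\<^sup>+\<eta>. H (merge_level n (Suc k) (sel_tree n k \<omega>) (\<lambda>v\<in>nodes n (Suc k). sel (\<eta> v)), ghost (\<eta> u)) \<partial>lev k (sel_tree n k \<omega>) \<partial>ss k)"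
    by (rule nn_integral_ss_Suc[OF kL m, unfolded sel_tree_merge_level merge_level_apply(1)[OF u]])
  also have "\<dots> = (\<integral>\<^sup>+\<omega>. \<integral>\<^sup>+\<eta>. \<integral>\<^sup>+y. H (merge_level n (Suc k) (sel_tree n k \<omega>) (\<lambda>v\<in>nodes n (Suc k). sel (\<eta> v)), y)
      \<partial>par (sel_tree n k \<omega>) u \<partial>lev k (sel_tree n k \<omega>) \<partial>ss k)"
  proof (rule nn_integral_cong)
    fix \<omega> assume "\<omega> \<in> space (ss k)"
    then have \<omega>: "\<omega> \<in> space (S k)" using kL by (simp add: space_ss)
    define t where "t = sel_tree n k \<omega>"
    have t[measurable]: "t \<in> space (T k)" unfolding t_def using \<omega> by (rule sel_tree_in_space)
    have [measurable]: "(\<lambda>s. merge_level n (Suc k) t s) \<in> PiM (nodes n (Suc k)) (\<lambda>v. X (length v)) \<rightarrow>\<^sub>M T (Suc k)"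
      using measurable_Pair2[OF measurable_merge_T t] by simp
    have "(\<lambda>(s, y). H (merge_level n (Suc k) t s, y)) \<in> borel_measurable (PiM (nodes n (Suc k)) (\<lambda>v. X (length v)) \<Otimes>\<^sub>M X (Suc k))"
      by measurable
    then have "(\<integral>\<^sup>+\<eta>. (case (\<lambda>v\<in>nodes n (Suc k). sel (\<eta> v), ghost (\<eta> u)) of (s, y) \<Rightarrow> H (merge_level n (Suc k) t s, y)) \<partial>lev k t) =
      (\<integral>\<^sup>+\<eta>. \<integral>\<^sup>+y. (case (\<lambda>v\<in>nodes n (Suc k). sel (\<eta> v), y) of (s, y) \<Rightarrow> H (merge_level n (Suc k) t s, y)) \<partial>par t u \<partial>lev k t)"
      unfolding lev_def
      using par_in_prob_algebra[OF kL order_refl _ t]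
      by (intro nn_integral_PiM_node_pair_ghost[where N="\<lambda>v. X (length v)"]) (auto simp: u lu length_nodes)
    then show "(\<integral>\<^sup>+\<eta>. H (merge_level n (Suc k) (sel_tree n k \<omega>) (\<lambda>v\<in>nodes n (Suc k). sel (\<eta> v)), ghost (\<eta> u)) \<partial>lev k (sel_tree n k \<omega>)) =
       (\<integral>\<^sup>+\<eta>. \<integral>\<^sup>+y. H (merge_level n (Suc k) (sel_tree n k \<omega>) (\<lambda>v\<in>nodes n (Suc k). sel (\<eta> v)), y)
      \<partial>par (sel_tree n k \<omega>) u \<partial>lev k (sel_tree n k \<omega>))"
      by (simp add: t_def)
  qed
  also have "\<dots> = (\<integral>\<^sup>+\<omega>. \<integral>\<^sup>+y. H (sel_tree n (Suc k) \<omega>, y) \<partial>par (sel_tree n (Suc k) \<omega>) u \<partial>ss (Suc k))"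
    by (subst nn_integral_ss_Suc[OF kL]) (auto simp: sel_tree_merge_level par_merge_level lu)
  finally show ?case by (simp add: l)
next
  case (step m)
  note mL = \<open>Suc m \<le> L\<close>
  note [measurable] = step.prems(4) measurable_merge_S[of m] measurable_merge_T[of m] measurable_sel_level
  obtain k where k: "l = Suc k" using step.prems by (cases l) auto
  have u: "u \<in> nodes n l" using step.prems by simp
  have lu: "length u = l" using length_nodes[OF u] .
  have u': "u \<in> upto_nodes n (Suc m)" "u \<notin> nodes n (Suc m)"
    using u step.prems step.hyps nodes_subset_upto[of l "Suc m" n] length_nodes[OF u] length_nodes[of u n "Suc m"] by auto
  have gu[measurable]: "(\<lambda>\<omega>. ghost (\<omega> u)) \<in> S (Suc m) \<rightarrow>\<^sub>M X l"
    using measurable_compose[OF measurable_component_singleton[OF u'(1), of "Xn X"] measurable_ghost_Xn] lu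
    by (simp add: state_space_def)
  have par_meas: "(\<lambda>\<omega>. par (sel_tree n j \<omega>) u) \<in> S j \<rightarrow>\<^sub>M subprob_algebra (X l)" if "l \<le> Suc j" for j
    using measurable_compose[OF measurable_sel_tree measurable_prob_algebraD[OF measurable_par_le[of k _ u]], of j] k step.prems step.hyps u that
    by simp
  have [measurable]: "(\<lambda>\<omega>. \<integral>\<^sup>+y. H (sel_tree n (Suc m) \<omega>, y) \<partial>par (sel_tree n (Suc m) \<omega>) u) \<in> borel_measurable (S (Suc m))"
    by (rule nn_integral_measurable_subprob_algebra2[where N="X l", OF _ par_meas]) (use \<open>l \<le> m\<close> in auto)
  define H' where "H' = (\<lambda>(t, y). \<integral>\<^sup>+\<eta>. H (merge_level n (Suc m) t (\<lambda>v\<in>nodes n (Suc m). sel (\<eta> v)), y) \<partial>lev m t)"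
  have H'[measurable]: "H' \<in> borel_measurable (T m \<Otimes>\<^sub>M X l)"
    unfolding H'_def split_beta
    by (rule nn_integral_measurable_subprob_algebra2[where N="PiM (nodes n (Suc m)) (Xn X)"])
      (use measurable_compose[OF measurable_fst measurable_prob_algebraD[OF measurable_lev[OF mL]]] in auto)
  have meas: "(\<lambda>\<omega>. H (sel_tree n (Suc m) \<omega>, ghost (\<omega> u))) \<in> borel_measurable (S (Suc m))"
    by measurable
  have "(\<integral>\<^sup>+\<omega>. H (sel_tree n (Suc m) \<omega>, ghost (\<omega> u)) \<partial>ss (Suc m)) = (\<integral>\<^sup>+\<omega>. H' (sel_tree n m \<omega>, ghost (\<omega> u)) \<partial>ss m)"
    unfolding nn_integral_ss_Suc[OF mL meas] sel_tree_merge_level merge_level_apply(2)[OF u'(2)] H'_def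
    by simp
  also have "\<dots> = (\<integral>\<^sup>+\<omega>. \<integral>\<^sup>+y. H' (sel_tree n m \<omega>, y) \<partial>par (sel_tree n m \<omega>) u \<partial>ss m)"
    using step.prems mL H' by (intro step.IH) auto
  also have "\<dots> = (\<integral>\<^sup>+\<omega>. \<integral>\<^sup>+\<eta>. \<integral>\<^sup>+y. H (merge_level n (Suc m) (sel_tree n m \<omega>) (\<lambda>v\<in>nodes n (Suc m). sel (\<eta> v)), y)
     \<partial>par (sel_tree n m \<omega>) u \<partial>lev m (sel_tree n m \<omega>) \<partial>ss m)"
  proof (rule nn_integral_cong)
    fix \<omega> assume "\<omega> \<in> space (ss m)"
    then have \<omega>: "\<omega> \<in> space (S m)" using mL by (simp add: space_ss)
    define t where "t = sel_tree n m \<omega>"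
    have t[measurable]: "t \<in> space (T m)" unfolding t_def using \<omega> by (rule sel_tree_in_space)
    have [measurable]: "(\<lambda>s. merge_level n (Suc m) t s) \<in> PiM (nodes n (Suc m)) (\<lambda>v. X (length v)) \<rightarrow>\<^sub>M T (Suc m)"
      using measurable_Pair2[OF measurable_merge_T t] by simp
    have p: "par t u \<in> space (prob_algebra (X l))"
      using par_in_prob_algebra[of k m u t] k step.prems step.hyps t by simp
    then have [measurable_cong]: "sets (par t u) = sets (X l)" by (simp add: space_prob_algebra)
    note [measurable_cong] = sets_lev[OF mL t]
    interpret P: prob_space "par t u" using p by (simp add: space_prob_algebra)
    interpret Q: prob_space "lev m t" using lev_in_prob_algebra[OF mL t] by (simp add: space_prob_algebra)
    interpret pair_sigma_finite "par t u" "lev m t" ..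
    have "(\<integral>\<^sup>+y. \<integral>\<^sup>+\<eta>. H (merge_level n (Suc m) t (\<lambda>v\<in>nodes n (Suc m). sel (\<eta> v)), y) \<partial>lev m t \<partial>par t u) =
      (\<integral>\<^sup>+\<eta>. \<integral>\<^sup>+y. H (merge_level n (Suc m) t (\<lambda>v\<in>nodes n (Suc m). sel (\<eta> v)), y) \<partial>par t u \<partial>lev m t)"
      by (rule Fubini'[symmetric]) measurable
    then show "(\<integral>\<^sup>+y. H' (sel_tree n m \<omega>, y) \<partial>par (sel_tree n m \<omega>) u) =
      (\<integral>\<^sup>+\<eta>. \<integral>\<^sup>+y. H (merge_level n (Suc m) (sel_tree n m \<omega>) (\<lambda>v\<in>nodes n (Suc m). sel (\<eta> v)), y)
     \<partial>par (sel_tree n m \<omega>) u \<partial>lev m (sel_tree n m \<omega>))"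
      by (simp add: t_def H'_def)
  qed
  also have "\<dots> = (\<integral>\<^sup>+\<omega>. \<integral>\<^sup>+y. H (sel_tree n (Suc m) \<omega>, y) \<partial>par (sel_tree n (Suc m) \<omega>) u \<partial>ss (Suc m))"
    using \<open>l \<le> m\<close> by (subst nn_integral_ss_Suc[OF mL]) (simp_all add: sel_tree_merge_level par_merge_level lu)
  finally show ?case .
qed

lemma measurable_node: "1 \<le> l \<Longrightarrow> l \<le> m \<Longrightarrow> u \<in> nodes n l \<Longrightarrow> (\<lambda>\<omega>. \<omega> u) \<in> S m \<rightarrow>\<^sub>M Xn X u"
  using measurable_component_singleton[of u "upto_nodes n m" "Xn X"] nodes_subset_upto[of l m n]
  by (auto simp: state_space_def)

text \<open>Restricted to functions of the content of \<open>u\<close>: flipping the coin in the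
  full state would change the parent of the levels below and need not preserve the joint law. The
  marginal at \<open>u\<close> does not see those levels, which integrate to 1.\<close>

lemma nn_integral_flip:
  assumes "l \<ge> 1" "l \<le> m" "m \<le> L" and u: "u \<in> nodes n l"
    and f: "f \<in> borel_measurable (Xn X u)"
  shows "(\<integral>\<^sup>+\<omega>. f (fst (\<omega> u), \<not> snd (\<omega> u)) \<partial>ss m) = (\<integral>\<^sup>+\<omega>. f (\<omega> u) \<partial>ss m)"
  using assms(2,1,3-)
proof (induction m rule: dec_induct)
  case base
  then obtain k where l: "l = Suc k" by (cases l) auto
  note kL = \<open>l \<le> L\<close>[unfolded l]
  have u: "u \<in> nodes n (Suc k)" using base l by simp
  have [measurable]: "f \<in> borel_measurable ((X (Suc k) \<Otimes>\<^sub>M X (Suc k)) \<Otimes>\<^sub>M count_space UNIV)"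
    using f by (simp add: Xn_eq[OF length_nodes[OF u]])
  have [measurable]: "(\<lambda>\<omega>. \<omega> u) \<in> S (Suc k) \<rightarrow>\<^sub>M (X (Suc k) \<Otimes>\<^sub>M X (Suc k)) \<Otimes>\<^sub>M count_space UNIV"
    using measurable_node[of "Suc k" "Suc k" u] u by (simp add: Xn_eq[OF length_nodes[OF u]])
  have *: "(\<integral>\<^sup>+\<eta>. g (\<eta> u) \<partial>lev k t) = (\<integral>\<^sup>+a. g a \<partial>node_pair (par t u))"
    if t: "t \<in> space (T k)" and g[measurable]: "g \<in> borel_measurable ((X (Suc k) \<Otimes>\<^sub>M X (Suc k)) \<Otimes>\<^sub>M count_space UNIV)" for g t
  proof -
    have np: "node_pair (par t v) \<in> space (prob_algebra ((X (Suc k) \<Otimes>\<^sub>M X (Suc k)) \<Otimes>\<^sub>M count_space UNIV))" if "v \<in> nodes n (Suc k)" for v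
      using node_pair_in_prob_algebra par_in_prob_algebra[OF kL order_refl that t] .
    then have "distr (lev k t) (node_pair (par t u)) (\<lambda>\<eta>. \<eta> u) = node_pair (par t u)"
      unfolding lev_def using u by (intro distr_PiM_component) (auto simp: space_prob_algebra)
    then have "(\<integral>\<^sup>+a. g a \<partial>node_pair (par t u)) = (\<integral>\<^sup>+a. g a \<partial>distr (lev k t) (node_pair (par t u)) (\<lambda>\<eta>. \<eta> u))"
      by simp
    also have "\<dots> = (\<integral>\<^sup>+\<eta>. g (\<eta> u) \<partial>lev k t)"
      using np[OF u] u unfolding lev_def
      by (intro nn_integral_distr measurable_component_singleton)
        (auto simp: space_prob_algebra cong: measurable_cong_sets)
    finally show ?thesis by simp
  qed
  have "(\<integral>\<^sup>+\<omega>. f (fst (\<omega> u), \<not> snd (\<omega> u)) \<partial>ss (Suc k)) =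
    (\<integral>\<^sup>+\<omega>. \<integral>\<^sup>+\<eta>. f (fst (\<eta> u), \<not> snd (\<eta> u)) \<partial>lev k (sel_tree n k \<omega>) \<partial>ss k)"
    using u by (subst nn_integral_ss_Suc[OF kL], measurable) (simp add: merge_level_apply)
  also have "\<dots> = (\<integral>\<^sup>+\<omega>. \<integral>\<^sup>+\<eta>. f (\<eta> u) \<partial>lev k (sel_tree n k \<omega>) \<partial>ss k)"
  proof (rule nn_integral_cong)
    fix \<omega> assume "\<omega> \<in> space (ss k)"
    then have t: "sel_tree n k \<omega> \<in> space (T k)" using kL by (simp add: space_ss sel_tree_in_space)
    show "(\<integral>\<^sup>+\<eta>. f (fst (\<eta> u), \<not> snd (\<eta> u)) \<partial>lev k (sel_tree n k \<omega>)) = (\<integral>\<^sup>+\<eta>. f (\<eta> u) \<partial>lev k (sel_tree n k \<omega>))"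
      using *[OF t, of f] *[OF t, of "\<lambda>a. f (fst a, \<not> snd a)"]
        nn_integral_node_pair_flip[OF par_in_prob_algebra[OF kL order_refl u t], of f]
      by simp
  qed
  also have "\<dots> = (\<integral>\<^sup>+\<omega>. f (\<omega> u) \<partial>ss (Suc k))"
    using u by (subst nn_integral_ss_Suc[OF kL], measurable) (simp add: merge_level_apply)
  finally show ?case by (simp add: l)
next
  case (step m)
  note mL = \<open>Suc m \<le> L\<close>
  have u: "u \<in> nodes n l" and l: "1 \<le> l" using step.prems by auto
  have u': "u \<notin> nodes n (Suc m)" using step.hyps length_nodes[OF u] length_nodes[of u n "Suc m"] by auto
  have [measurable]: "f \<in> borel_measurable ((X l \<Otimes>\<^sub>M X l) \<Otimes>\<^sub>M count_space UNIV)"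
    using f by (simp add: Xn_eq[OF length_nodes[OF u]])
  have [measurable]: "(\<lambda>\<omega>. \<omega> u) \<in> S (Suc m) \<rightarrow>\<^sub>M (X l \<Otimes>\<^sub>M X l) \<Otimes>\<^sub>M count_space UNIV"
    using measurable_node[of l "Suc m" u] u l step.hyps by (simp add: Xn_eq[OF length_nodes[OF u]])
  have proj: "(\<integral>\<^sup>+\<omega>. g (\<omega> u) \<partial>ss (Suc m)) = (\<integral>\<^sup>+\<omega>. g (\<omega> u) \<partial>ss m)"
    if [measurable]: "g \<in> borel_measurable ((X l \<Otimes>\<^sub>M X l) \<Otimes>\<^sub>M count_space UNIV)" for g :: "_ \<Rightarrow> ennreal"
  proof -
    have "(\<integral>\<^sup>+\<omega>. g (\<omega> u) \<partial>ss (Suc m)) = (\<integral>\<^sup>+\<omega>. \<integral>\<^sup>+\<eta>. g (\<omega> u) \<partial>lev m (sel_tree n m \<omega>) \<partial>ss m)"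
      using u' by (subst nn_integral_ss_Suc[OF mL], measurable) (simp add: merge_level_apply)
    also have "\<dots> = (\<integral>\<^sup>+\<omega>. g (\<omega> u) \<partial>ss m)"
    proof (rule nn_integral_cong)
      fix \<omega> assume "\<omega> \<in> space (ss m)"
      then have "sel_tree n m \<omega> \<in> space (T m)" using mL by (simp add: space_ss sel_tree_in_space)
      from lev_in_prob_algebra[OF mL this]
      interpret prob_space "lev m (sel_tree n m \<omega>)" by (simp add: space_prob_algebra)
      show "(\<integral>\<^sup>+\<eta>. g (\<omega> u) \<partial>lev m (sel_tree n m \<omega>)) = g (\<omega> u)" by (simp add: emeasure_space_1)
    qed
    finally show ?thesis .
  qed
  show ?case
    using proj[of f] proj[of "\<lambda>a. f (fst a, \<not> snd a)"] step by simp
qed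

end

context hierarchy
begin

subsection \<open>The law of a leaf below a node\<close>

text \<open>The recursion runs over the number of draws still to be made; with \<open>Suc d\<close>
  draws left, the next one is at depth \<open>L - d\<close>.\<close>

primrec leaf_steps :: "nat \<Rightarrow> 'x \<Rightarrow> 'x measure" where
  "leaf_steps 0 = return (X L)"
| "leaf_steps (Suc d) = (\<lambda>x. \<kappa> (L - d) x \<bind> leaf_steps d)"

definition leaf :: "nat \<Rightarrow> 'x \<Rightarrow> 'x measure" where
  "leaf l = leaf_steps (L - l)"

lemma leaf_L: "leaf L = return (X L)"
  by (simp add: leaf_def)

lemma leaf_step:
  assumes "l < L"
  shows "leaf l x = \<kappa> (Suc l) x \<bind> leaf (Suc l)"
proof -
  have "L - l = Suc (L - Suc l)" "L - (L - Suc l) = Suc l"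
    using assms by auto
  then show ?thesis
    unfolding leaf_def by (simp only: leaf_steps.simps)
qed

lemma measurable_\<kappa>: "1 \<le> l \<Longrightarrow> l < L \<Longrightarrow> \<kappa> (Suc l) \<in> X l \<rightarrow>\<^sub>M prob_algebra (X (Suc l))"
  using \<kappa>[of "Suc l"] by simp

lemma measurable_leaf:
  assumes "1 \<le> l" "l \<le> L"
  shows "leaf l \<in> X l \<rightarrow>\<^sub>M prob_algebra (X L)"
  using assms(2,1)
proof (induction l rule: inc_induct)
  case base
  then show ?case by (simp add: leaf_L)
next
  case (step l)
  have "leaf (Suc l) \<in> X (Suc l) \<rightarrow>\<^sub>M prob_algebra (X L)"
    using step.IH by simp
  from measurable_bind_prob_space[OF measurable_\<kappa>[OF step.prems \<open>l < L\<close>] this]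
  have "(\<lambda>x. \<kappa> (Suc l) x \<bind> leaf (Suc l)) \<in> X l \<rightarrow>\<^sub>M prob_algebra (X L)" .
  moreover have "leaf l = (\<lambda>x. \<kappa> (Suc l) x \<bind> leaf (Suc l))"
    by (intro ext leaf_step \<open>l < L\<close>)
  ultimately show ?case by simp
qed

lemma level_law_in_prob_algebra:
  assumes "1 \<le> l" "l \<le> L"
  shows "level_law D \<kappa> l \<in> space (prob_algebra (X l))"
  using assms
proof (induction l rule: dec_induct)
  case base
  then show ?case using D by simp
next
  case (step l)
  then obtain k where k: "l = Suc k" by (cases l) auto
  have "level_law D \<kappa> l \<in> space (prob_algebra (X l))" using step.IH step.prems by simp
  from prob_space_bind'[OF this measurable_\<kappa>] sets_bind'[OF this measurable_\<kappa>] show ?case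
    using step.hyps step.prems by (simp add: k space_prob_algebra)
qed

text \<open>Associativity of \<open>bind\<close>, by induction from \<open>l = L\<close> towards the
  root: stopping at depth \<open>l\<close> and growing the rest of the path afterwards changes
  nothing.\<close>

lemma level_law_bind_leaf:
  assumes "1 \<le> l" "l \<le> L"
  shows "level_law D \<kappa> l \<bind> leaf l = level_law D \<kappa> L"
  using assms(2,1)
proof (induction l rule: inc_induct)
  case base
  then show ?case
    using level_law_in_prob_algebra[of L] L by (simp add: leaf_L bind_return'' space_prob_algebra)
next
  case (step l)
  then obtain k where k: "l = Suc k" by (cases l) auto
  have ll: "sets (level_law D \<kappa> l) = sets (X l)"
    using level_law_in_prob_algebra[of l] step.prems step.hyps by (simp add: space_prob_algebra)
  have "level_law D \<kappa> l \<bind> leaf l = level_law D \<kappa> l \<bind> (\<lambda>x. \<kappa> (Suc l) x \<bind> leaf (Suc l))"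
    using step.hyps by (simp add: leaf_step cong: bind_cong)
  also have "\<dots> = (level_law D \<kappa> l \<bind> \<kappa> (Suc l)) \<bind> leaf (Suc l)"
    using measurable_\<kappa>[of l] measurable_leaf[of "Suc l"] step.hyps step.prems
    by (intro bind_assoc[symmetric, where N="X (Suc l)" and R="X L"])
      (auto intro: measurable_prob_algebraD simp: ll cong: measurable_cong_sets)
  also have "\<dots> = level_law D \<kappa> L"
    using step.IH by (simp add: k)
  finally show ?case .
qed

text \<open>The root has no entry in the tree, so depth 0 is set apart; its value is the law of the
  test point, which lets the telescoping start there.\<close>

definition leaf_law :: "nat \<Rightarrow> (nat list \<Rightarrow> 'x) \<Rightarrow> nat list \<Rightarrow> 'x measure" where
  "leaf_law l t v = (if l = 0 then level_law D \<kappa> L else leaf l (t v))"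

text \<open>Growing a leaf through a fresh child is growing it from the parent, which joins
  consecutive stages of the telescoping. For \<open>l = 0\<close> the child is drawn from
  \<open>D\<close>, the level law at depth 1.\<close>

lemma par_bind_leaf:
  assumes "Suc l \<le> L" "v \<in> nodes n (Suc l)"
  shows "par t v \<bind> leaf (Suc l) = leaf_law l t (butlast v)"
  using level_law_bind_leaf[of 1] length_nodes[OF assms(2)] assms(1) L
  by (auto simp: par_def leaf_law_def leaf_step)

lemma measurable_leaf_law:
  assumes "l \<le> m" "l \<le> L" "v \<in> nodes n l"
  shows "(\<lambda>t. leaf_law l t v) \<in> T m \<rightarrow>\<^sub>M prob_algebra (X L)"
proof (cases "l = 0")
  case True
  then show ?thesis using level_law_in_prob_algebra[of L] L by (simp add: leaf_law_def)
next
  case False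
  with assms have "1 \<le> l" by simp
  from measurable_compose[OF measurable_tree_component[OF this assms(1,3)] measurable_leaf[OF this assms(2)]]
  show ?thesis using False by (simp add: leaf_law_def)
qed

end

subsection \<open>The joint law and the one-node comparison\<close>

locale learning = hierarchy L n X D \<kappa>
  for L :: nat and n :: "nat \<Rightarrow> nat" and X :: "nat \<Rightarrow> 'x measure" and D :: "'x measure"
    and \<kappa> :: "nat \<Rightarrow> 'x \<Rightarrow> 'x measure" +
  fixes MW :: "'w::metric_space measure"
    and K :: "(nat list \<Rightarrow> 'x) \<Rightarrow> 'w measure"
    and Q1 :: "nat list \<Rightarrow> ('x \<times> 'x) \<times> bool \<Rightarrow> 'w measure"
    and Q2 :: "nat list \<Rightarrow> 'x \<times> 'x \<Rightarrow> 'w measure"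
  assumes K: "K \<in> tree_space n X L \<rightarrow>\<^sub>M prob_algebra MW"
    and Q1: "\<And>v. v \<in> upto_nodes n L \<Longrightarrow> is_cond_law (joint_law n X D \<kappa> L MW K) (Xn X v) MW
                (\<lambda>p. fst p v) snd (Q1 v)"
    and Q2: "\<And>v. v \<in> upto_nodes n L \<Longrightarrow> Q2 v \<in> Xp X v \<rightarrow>\<^sub>M prob_algebra MW"
begin

abbreviation "J \<equiv> joint_law n X D \<kappa> L MW K"

lemma measurable_K_sel [measurable]: "(\<lambda>\<omega>. K (sel_tree n L \<omega>)) \<in> S L \<rightarrow>\<^sub>M prob_algebra MW"
  using K by measurable

lemma K_sel_in_prob_algebra: "\<omega> \<in> space (S L) \<Longrightarrow> K (sel_tree n L \<omega>) \<in> space (prob_algebra MW)"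
  using measurable_space[OF measurable_K_sel] .

lemma measurable_J_kernel:
  "(\<lambda>\<omega>. distr (K (sel_tree n L \<omega>)) (S L \<Otimes>\<^sub>M MW) (\<lambda>w. (\<omega>, w))) \<in> S L \<rightarrow>\<^sub>M prob_algebra (S L \<Otimes>\<^sub>M MW)"
  by measurable

lemma J_in_prob_algebra: "J \<in> space (prob_algebra (S L \<Otimes>\<^sub>M MW))"
  using prob_space_bind'[OF ss_in_prob_algebra[OF order_refl] measurable_J_kernel]
    sets_bind'[OF ss_in_prob_algebra[OF order_refl] measurable_J_kernel]
  by (simp add: joint_law_def space_prob_algebra)

lemma sets_J [measurable_cong]: "sets J = sets (S L \<Otimes>\<^sub>M MW)"
  using J_in_prob_algebra by (simp add: space_prob_algebra)

lemma space_J: "space J = space (S L) \<times> space MW"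
  using sets_eq_imp_space_eq[OF sets_J] by (simp add: space_pair_measure)

sublocale J: prob_space J
  using J_in_prob_algebra by (simp add: space_prob_algebra)

lemma nn_integral_J:
  assumes F[measurable]: "F \<in> borel_measurable (S L \<Otimes>\<^sub>M MW)"
  shows "integral\<^sup>N J F = (\<integral>\<^sup>+\<omega>. \<integral>\<^sup>+w. F (\<omega>, w) \<partial>K (sel_tree n L \<omega>) \<partial>ss L)"
proof -
  have "integral\<^sup>N J F = (\<integral>\<^sup>+\<omega>. integral\<^sup>N (distr (K (sel_tree n L \<omega>)) (S L \<Otimes>\<^sub>M MW) (\<lambda>w. (\<omega>, w))) F \<partial>ss L)"
    unfolding joint_law_def using measurable_prob_algebraD[OF measurable_J_kernel]
    by (intro nn_integral_bind[OF F]) (simp cong: measurable_cong_sets add: sets_ss)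
  also have "\<dots> = (\<integral>\<^sup>+\<omega>. \<integral>\<^sup>+w. F (\<omega>, w) \<partial>K (sel_tree n L \<omega>) \<partial>ss L)"
  proof (intro nn_integral_cong nn_integral_distr)
    fix \<omega> assume "\<omega> \<in> space (ss L)"
    then have \<omega>[measurable]: "\<omega> \<in> space (S L)" by (simp add: space_ss)
    have [measurable_cong]: "sets (K (sel_tree n L \<omega>)) = sets MW"
      using K_sel_in_prob_algebra[OF \<omega>] by (simp add: space_prob_algebra)
    show "(\<lambda>w. (\<omega>, w)) \<in> K (sel_tree n L \<omega>) \<rightarrow>\<^sub>M S L \<Otimes>\<^sub>M MW" by measurable
    show "F \<in> borel_measurable (distr (K (sel_tree n L \<omega>)) (S L \<Otimes>\<^sub>M MW) (Pair \<omega>))" by measurable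
  qed
  finally show ?thesis .
qed

lemma nn_integral_J_fst:
  assumes [measurable]: "f \<in> borel_measurable (S L)"
  shows "(\<integral>\<^sup>+p. f (fst p) \<partial>J) = integral\<^sup>N (ss L) f"
proof -
  have "(\<integral>\<^sup>+p. f (fst p) \<partial>J) = (\<integral>\<^sup>+\<omega>. \<integral>\<^sup>+w. f \<omega> \<partial>K (sel_tree n L \<omega>) \<partial>ss L)"
    by (subst nn_integral_J) auto
  also have "\<dots> = integral\<^sup>N (ss L) f"
  proof (rule nn_integral_cong)
    fix \<omega> assume "\<omega> \<in> space (ss L)"
    then interpret prob_space "K (sel_tree n L \<omega>)"
      using K_sel_in_prob_algebra[of \<omega>] by (simp add: space_prob_algebra space_ss)
    show "(\<integral>\<^sup>+w. f \<omega> \<partial>K (sel_tree n L \<omega>)) = f \<omega>" by (simp add: emeasure_space_1)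
  qed
  finally show ?thesis .
qed

definition node_dist :: "nat list \<Rightarrow> (('x \<times> 'x) \<times> bool) measure" where
  "node_dist v = distr J (Xn X v) (\<lambda>p. fst p v)"

text \<open>The distance need not be measurable in \<open>a\<close>, so this is again a lower
  integral; \<open>swap_le\<close> meets it only as the last summand of
  \<open>nn_integral_le_add_cmult\<close>.\<close>

definition wcost :: "nat list \<Rightarrow> ennreal" where
  "wcost v = (\<integral>\<^sup>+ a. wasserstein1 MW (Q1 v a) (Q2 v (fst a)) \<partial>node_dist v)"

lemma sets_node_dist [measurable_cong]: "sets (node_dist v) = sets (Xn X v)"
  by (simp add: node_dist_def)

lemma space_node_dist: "space (node_dist v) = space (Xn X v)"
  by (simp add: node_dist_def)

lemma measurable_node_L: "v \<in> upto_nodes n L \<Longrightarrow> (\<lambda>\<omega>. \<omega> v) \<in> S L \<rightarrow>\<^sub>M Xn X v"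
  by (simp add: state_space_def measurable_component_singleton)

lemma nn_integral_node_dist:
  assumes v: "v \<in> upto_nodes n L" and [measurable]: "f \<in> borel_measurable (Xn X v)"
  shows "integral\<^sup>N (node_dist v) f = (\<integral>\<^sup>+\<omega>. f (\<omega> v) \<partial>ss L)"
proof -
  note [measurable] = measurable_node_L[OF v]
  have "integral\<^sup>N (node_dist v) f = (\<integral>\<^sup>+p. f (fst p v) \<partial>J)"
    unfolding node_dist_def
    using measurable_compose[OF measurable_fst measurable_node_L[OF v], of MW]
    by (intro nn_integral_distr) (simp_all cong: measurable_cong_sets add: sets_J)
  also have "\<dots> = (\<integral>\<^sup>+\<omega>. f (\<omega> v) \<partial>ss L)"
    by (rule nn_integral_J_fst) measurable
  finally show ?thesis .
qed

lemma nn_integral_node_dist_flip: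
  assumes v: "v \<in> upto_nodes n L" and f: "f \<in> borel_measurable (Xn X v)"
  shows "(\<integral>\<^sup>+a. f (fst a, \<not> snd a) \<partial>node_dist v) = integral\<^sup>N (node_dist v) f"
proof -
  have "v \<in> nodes n (length v)" "1 \<le> length v" "length v \<le> L"
    using v by (auto simp: upto_nodes_iff)
  moreover have "(\<lambda>a. f (fst a, \<not> snd a)) \<in> borel_measurable (Xn X v)"
    using f by (simp add: Xn_def)
  ultimately show ?thesis
    using nn_integral_flip[of "length v" L v f] f
    by (simp add: nn_integral_node_dist[OF v] nn_integral_node_dist[OF v, of "\<lambda>a. f (fst a, \<not> snd a)"])
qed

lemma measurable_Q1: "v \<in> upto_nodes n L \<Longrightarrow> Q1 v \<in> Xn X v \<rightarrow>\<^sub>M prob_algebra MW"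
  using Q1 by (simp add: is_cond_law_def)

lemma measurable_Q2': "v \<in> upto_nodes n L \<Longrightarrow> (\<lambda>a. Q2 v (fst a)) \<in> Xn X v \<rightarrow>\<^sub>M prob_algebra MW"
  using measurable_compose[OF measurable_fst Q2] by (simp add: Xn_def)

lemma nn_integral_J_Q1:
  assumes v: "v \<in> upto_nodes n L" and G[measurable]: "G \<in> borel_measurable (Xn X v \<Otimes>\<^sub>M MW)"
  shows "(\<integral>\<^sup>+p. G (fst p v, snd p) \<partial>J) = (\<integral>\<^sup>+a. \<integral>\<^sup>+w. G (a, w) \<partial>Q1 v a \<partial>node_dist v)"
proof -
  note [measurable] = measurable_node_L[OF v] measurable_Q1[OF v]
  have "(\<integral>\<^sup>+p. G (fst p v, snd p) \<partial>J) = integral\<^sup>N (distr J (Xn X v \<Otimes>\<^sub>M MW) (\<lambda>p. (fst p v, snd p))) G"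
    by (rule nn_integral_distr[symmetric]) measurable
  also have "distr J (Xn X v \<Otimes>\<^sub>M MW) (\<lambda>p. (fst p v, snd p)) =
      node_dist v \<bind> (\<lambda>a. distr (Q1 v a) (Xn X v \<Otimes>\<^sub>M MW) (\<lambda>w. (a, w)))"
    using Q1[OF v] by (simp add: is_cond_law_def node_dist_def)
  also have "integral\<^sup>N \<dots> G = (\<integral>\<^sup>+a. integral\<^sup>N (distr (Q1 v a) (Xn X v \<Otimes>\<^sub>M MW) (\<lambda>w. (a, w))) G \<partial>node_dist v)"
  proof (rule nn_integral_bind[OF G])
    have "(\<lambda>a. distr (Q1 v a) (Xn X v \<Otimes>\<^sub>M MW) (\<lambda>w. (a, w))) \<in> Xn X v \<rightarrow>\<^sub>M prob_algebra (Xn X v \<Otimes>\<^sub>M MW)"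
      by measurable
    from measurable_prob_algebraD[OF this]
    show "(\<lambda>a. distr (Q1 v a) (Xn X v \<Otimes>\<^sub>M MW) (\<lambda>w. (a, w))) \<in> node_dist v \<rightarrow>\<^sub>M subprob_algebra (Xn X v \<Otimes>\<^sub>M MW)"
      by (simp cong: measurable_cong_sets add: sets_node_dist)
  qed
  also have "\<dots> = (\<integral>\<^sup>+a. \<integral>\<^sup>+w. G (a, w) \<partial>Q1 v a \<partial>node_dist v)"
  proof (intro nn_integral_cong nn_integral_distr)
    fix a assume "a \<in> space (node_dist v)"
    then have a[measurable]: "a \<in> space (Xn X v)" by (simp add: space_node_dist)
    have [measurable_cong]: "sets (Q1 v a) = sets MW"
      using measurable_space[OF measurable_Q1[OF v] a] by (simp add: space_prob_algebra)
    show "(\<lambda>w. (a, w)) \<in> Q1 v a \<rightarrow>\<^sub>M Xn X v \<Otimes>\<^sub>M MW" by measurable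
    show "G \<in> borel_measurable (distr (Q1 v a) (Xn X v \<Otimes>\<^sub>M MW) (Pair a))" by measurable
  qed
  finally show ?thesis .
qed

text \<open>Replacing \<open>Q1\<close> by \<open>Q2\<close> makes the hypothesis blind to the coin, after which the two entries of the
  pair may be exchanged.\<close>

lemma swap_le:
  fixes \<phi> :: "'w \<Rightarrow> 'x \<Rightarrow> ennreal"
  assumes u: "u \<in> upto_nodes n L"
    and \<phi>: "(\<lambda>p. \<phi> (fst p) (snd p)) \<in> borel_measurable (MW \<Otimes>\<^sub>M X (length u))"
    and lip: "\<And>w w' x. w \<in> space MW \<Longrightarrow> w' \<in> space MW \<Longrightarrow> x \<in> space (X (length u)) \<Longrightarrow>
      \<phi> w x \<le> \<phi> w' x + ennreal (c * dist w w')"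
    and c: "0 \<le> c"
    and \<alpha>: "\<alpha> \<in> Xn X u \<rightarrow>\<^sub>M X (length u)"
    and \<beta>: "\<beta> \<in> Xn X u \<rightarrow>\<^sub>M X (length u)"
    and flip: "\<And>a. \<alpha> (fst a, \<not> snd a) = \<beta> a"
  shows "(\<integral>\<^sup>+p. \<phi> (snd p) (\<alpha> (fst p u)) \<partial>J) \<le> (\<integral>\<^sup>+p. \<phi> (snd p) (\<beta> (fst p u)) \<partial>J) + ennreal (2 * c) * wcost u"
proof -
  have m: "(\<lambda>p. \<phi> (snd p) (\<gamma> (fst p))) \<in> borel_measurable (Xn X u \<Otimes>\<^sub>M MW)"
    if "\<gamma> \<in> Xn X u \<rightarrow>\<^sub>M X (length u)" for \<gamma>
  proof -
    have "(\<lambda>p. (snd p, \<gamma> (fst p))) \<in> Xn X u \<Otimes>\<^sub>M MW \<rightarrow>\<^sub>M MW \<Otimes>\<^sub>M X (length u)"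
      using that by measurable
    from measurable_compose[OF this \<phi>] show ?thesis by simp
  qed
  have mQ: "(\<lambda>a. \<integral>\<^sup>+w. \<phi> w (\<gamma> a) \<partial>Q1 u a) \<in> borel_measurable (Xn X u)"
      "(\<lambda>a. \<integral>\<^sup>+w. \<phi> w (\<gamma> a) \<partial>Q2 u (fst a)) \<in> borel_measurable (Xn X u)"
    if "\<gamma> \<in> Xn X u \<rightarrow>\<^sub>M X (length u)" for \<gamma>
    using nn_integral_measurable_subprob_algebra2[of "\<lambda>a w. \<phi> w (\<gamma> a)", OF _ measurable_prob_algebraD[OF measurable_Q1[OF u]]]
      nn_integral_measurable_subprob_algebra2[of "\<lambda>a w. \<phi> w (\<gamma> a)", OF _ measurable_prob_algebraD[OF measurable_Q2'[OF u]]]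
      m[OF that] by (simp_all add: split_beta')
  have mQ': "(\<lambda>a. \<integral>\<^sup>+w. \<phi> w (\<gamma> a) \<partial>Q1 u a) \<in> borel_measurable (node_dist u)"
      "(\<lambda>a. \<integral>\<^sup>+w. \<phi> w (\<gamma> a) \<partial>Q2 u (fst a)) \<in> borel_measurable (node_dist u)"
    if "\<gamma> \<in> Xn X u \<rightarrow>\<^sub>M X (length u)" for \<gamma>
    using mQ[OF that] by (simp_all cong: measurable_cong_sets add: sets_node_dist)
  have W: "(\<integral>\<^sup>+w. \<phi> w (\<gamma> a) \<partial>Q1 u a) \<le> (\<integral>\<^sup>+w. \<phi> w (\<gamma> a) \<partial>Q2 u (fst a)) + ennreal c * wasserstein1 MW (Q1 u a) (Q2 u (fst a))"
      "(\<integral>\<^sup>+w. \<phi> w (\<gamma> a) \<partial>Q2 u (fst a)) \<le> (\<integral>\<^sup>+w. \<phi> w (\<gamma> a) \<partial>Q1 u a) + ennreal c * wasserstein1 MW (Q1 u a) (Q2 u (fst a))"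
    if \<gamma>: "\<gamma> \<in> Xn X u \<rightarrow>\<^sub>M X (length u)" and a: "a \<in> space (node_dist u)" for \<gamma> a
  proof -
    have a: "a \<in> space (Xn X u)" using a by (simp add: space_node_dist)
    have x: "\<gamma> a \<in> space (X (length u))" using measurable_space[OF \<gamma> a] .
    have "(\<lambda>w. (w, \<gamma> a)) \<in> MW \<rightarrow>\<^sub>M MW \<Otimes>\<^sub>M X (length u)"
      using x by measurable
    from measurable_compose[OF this \<phi>] have "(\<lambda>w. \<phi> w (\<gamma> a)) \<in> borel_measurable MW"
      by simp
    note nn_integral_le_wasserstein1[OF measurable_space[OF measurable_Q1[OF u] a]
        measurable_space[OF measurable_Q2'[OF u] a] this lip[OF _ _ x] c]
    then show "(\<integral>\<^sup>+w. \<phi> w (\<gamma> a) \<partial>Q1 u a) \<le> (\<integral>\<^sup>+w. \<phi> w (\<gamma> a) \<partial>Q2 u (fst a)) + ennreal c * wasserstein1 MW (Q1 u a) (Q2 u (fst a))"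
      "(\<integral>\<^sup>+w. \<phi> w (\<gamma> a) \<partial>Q2 u (fst a)) \<le> (\<integral>\<^sup>+w. \<phi> w (\<gamma> a) \<partial>Q1 u a) + ennreal c * wasserstein1 MW (Q1 u a) (Q2 u (fst a))"
      by auto
  qed
  define E1 where "E1 = (\<lambda>\<gamma>. \<integral>\<^sup>+a. \<integral>\<^sup>+w. \<phi> w (\<gamma> a) \<partial>Q1 u a \<partial>node_dist u)"
  define E2 where "E2 = (\<lambda>\<gamma>. \<integral>\<^sup>+a. \<integral>\<^sup>+w. \<phi> w (\<gamma> a) \<partial>Q2 u (fst a) \<partial>node_dist u)"
  have E1: "(\<integral>\<^sup>+p. \<phi> (snd p) (\<gamma> (fst p u)) \<partial>J) = E1 \<gamma>" if "\<gamma> \<in> Xn X u \<rightarrow>\<^sub>M X (length u)" for \<gamma>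
    using nn_integral_J_Q1[OF u m[OF that]] by (simp add: E1_def)
  have 1: "E1 \<alpha> \<le> E2 \<alpha> + ennreal c * wcost u"
    unfolding E1_def E2_def wcost_def
    by (rule nn_integral_le_add_cmult[OF mQ'[OF \<alpha>] W(1)[OF \<alpha>]]) auto
  \<comment> \<open>Flipping the coin preserves the law of the node and leaves \<open>fst a\<close>,
    hence \<open>Q2 u (fst a)\<close>, unchanged, so it turns \<open>\<alpha>\<close> into
    \<open>\<beta>\<close> at no cost.\<close>
  have 2: "E2 \<alpha> = E2 \<beta>"
    using nn_integral_node_dist_flip[OF u mQ(2)[OF \<alpha>]] unfolding flip E2_def fst_conv by (rule sym)
  have 3: "E2 \<beta> \<le> E1 \<beta> + ennreal c * wcost u"
    unfolding E1_def E2_def wcost_def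
    by (rule nn_integral_le_add_cmult[OF mQ'(2,1)[OF \<beta>] W(2)[OF \<beta>]]) auto
  have "E1 \<alpha> \<le> (E1 \<beta> + ennreal c * wcost u) + ennreal c * wcost u"
    using order_trans[OF 1[unfolded 2] add_right_mono[OF 3]] .
  also have "\<dots> = E1 \<beta> + ennreal (2 * c) * wcost u"
  proof -
    have "ennreal (2 * c) = ennreal c + ennreal c"
      using ennreal_plus[OF c c] by (simp only: mult_2)
    then show ?thesis by (simp only: distrib_right add.assoc)
  qed
  finally show ?thesis
    unfolding E1[OF \<alpha>] E1[OF \<beta>] .
qed

text \<open>\<open>K\<close> sees the selected tree only. Averaging over the hypothesis first leaves
  a function \<open>H\<close> of the tree and the ghost; once the ghost is replaced by a fresh draw,
  Tonelli restores the order of integration.\<close>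

lemma nn_integral_J_ghost:
  fixes \<phi> :: "'w \<Rightarrow> 'x \<Rightarrow> ennreal"
  assumes l: "1 \<le> l" "l \<le> L" and u: "u \<in> nodes n l"
    and \<phi>[measurable]: "(\<lambda>p. \<phi> (fst p) (snd p)) \<in> borel_measurable (MW \<Otimes>\<^sub>M X l)"
  shows "(\<integral>\<^sup>+p. \<phi> (snd p) (ghost (fst p u)) \<partial>J) =
    (\<integral>\<^sup>+p. \<integral>\<^sup>+y. \<phi> (snd p) y \<partial>par (sel_tree n L (fst p)) u \<partial>J)"
proof -
  obtain k where k: "l = Suc k" using l by (cases l) auto
  have [measurable]: "(\<lambda>\<omega>. \<omega> u) \<in> S L \<rightarrow>\<^sub>M (X l \<Otimes>\<^sub>M X l) \<Otimes>\<^sub>M count_space UNIV"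
    using measurable_node[OF l u] by (simp add: Xn_eq[OF length_nodes[OF u]])
  note [measurable] = measurable_prob_algebraD[OF K]
  have \<phi>'[measurable (raw)]: "(\<lambda>p. \<phi> (f p) (g p)) \<in> borel_measurable N"
    if "f \<in> N \<rightarrow>\<^sub>M MW" "g \<in> N \<rightarrow>\<^sub>M X l" for f g and N :: "'z measure"
    using measurable_compose[OF measurable_Pair[OF that] \<phi>] by simp
  have parT: "(\<lambda>t. par t u) \<in> T L \<rightarrow>\<^sub>M subprob_algebra (X l)"
    using measurable_prob_algebraD[OF measurable_par_le[of k L u]] k l u by simp
  have parS[measurable]: "(\<lambda>\<omega>. par (sel_tree n L \<omega>) u) \<in> S L \<rightarrow>\<^sub>M subprob_algebra (X l)"
    using measurable_compose[OF measurable_sel_tree parT] .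
  define H where "H = (\<lambda>(t, y). \<integral>\<^sup>+w. \<phi> w y \<partial>K t)"
  have H[measurable]: "H \<in> borel_measurable (T L \<Otimes>\<^sub>M X l)"
    unfolding H_def split_beta by (rule nn_integral_measurable_subprob_algebra2[where N=MW]) measurable
  have "(\<integral>\<^sup>+p. \<phi> (snd p) (ghost (fst p u)) \<partial>J) = (\<integral>\<^sup>+\<omega>. H (sel_tree n L \<omega>, ghost (\<omega> u)) \<partial>ss L)"
    unfolding H_def by (subst nn_integral_J) auto
  also have "\<dots> = (\<integral>\<^sup>+\<omega>. \<integral>\<^sup>+y. H (sel_tree n L \<omega>, y) \<partial>par (sel_tree n L \<omega>) u \<partial>ss L)"
    using l u by (intro nn_integral_ghost[OF _ _ _ u H]) auto
  also have "\<dots> = (\<integral>\<^sup>+\<omega>. \<integral>\<^sup>+w. \<integral>\<^sup>+y. \<phi> w y \<partial>par (sel_tree n L \<omega>) u \<partial>K (sel_tree n L \<omega>) \<partial>ss L)"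
  proof (rule nn_integral_cong)
    fix \<omega> assume "\<omega> \<in> space (ss L)"
    then have \<omega>: "\<omega> \<in> space (S L)" by (simp add: space_ss)
    have p: "par (sel_tree n L \<omega>) u \<in> space (prob_algebra (X l))"
      using par_in_prob_algebra[of k L u] k l u sel_tree_in_space[OF \<omega>] by simp
    then have st: "sets (par (sel_tree n L \<omega>) u) = sets (X l)"
      "sets (K (sel_tree n L \<omega>)) = sets MW"
      using K_sel_in_prob_algebra[OF \<omega>] by (auto simp: space_prob_algebra)
    interpret P: prob_space "par (sel_tree n L \<omega>) u" using p by (simp add: space_prob_algebra)
    interpret K: prob_space "K (sel_tree n L \<omega>)" using K_sel_in_prob_algebra[OF \<omega>] by (simp add: space_prob_algebra)
    interpret pair_sigma_finite "par (sel_tree n L \<omega>) u" "K (sel_tree n L \<omega>)" ..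
    show "(\<integral>\<^sup>+y. H (sel_tree n L \<omega>, y) \<partial>par (sel_tree n L \<omega>) u) =
        (\<integral>\<^sup>+w. \<integral>\<^sup>+y. \<phi> w y \<partial>par (sel_tree n L \<omega>) u \<partial>K (sel_tree n L \<omega>))"
      unfolding H_def split_conv
    proof (rule Fubini'[symmetric])
      have "(\<lambda>p. \<phi> (snd p) (fst p)) \<in> borel_measurable (X l \<Otimes>\<^sub>M MW)"
        using measurable_compose[OF measurable_Pair[OF measurable_snd measurable_fst] \<phi>] by simp
      then show "(\<lambda>(y, w). \<phi> w y) \<in> borel_measurable (par (sel_tree n L \<omega>) u \<Otimes>\<^sub>M K (sel_tree n L \<omega>))"
        unfolding split_beta' measurable_cong_sets[OF sets_pair_measure_cong[OF st] refl] .
    qed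
  qed
  also have "\<dots> = (\<integral>\<^sup>+p. \<integral>\<^sup>+y. \<phi> (snd p) y \<partial>par (sel_tree n L (fst p)) u \<partial>J)"
  proof (subst nn_integral_J)
    show "(\<lambda>p. \<integral>\<^sup>+y. \<phi> (snd p) y \<partial>par (sel_tree n L (fst p)) u) \<in> borel_measurable (S L \<Otimes>\<^sub>M MW)"
      by (rule nn_integral_measurable_subprob_algebra2[where N="X l"]) measurable
  qed simp
  finally show ?thesis .
qed

subsection \<open>Replacing a training leaf by a fresh leaf\<close>

text \<open>A hybrid of test point and training leaf: the selected path towards \<open>v\<close> is
  kept down to depth \<open>l\<close> and continued by draws that the hypothesis has not seen. Depth
  0 gives the test point, depth \<open>L\<close> the training leaf.\<close>

definition fresh_leaf :: "nat \<Rightarrow> nat list \<Rightarrow> ('w \<Rightarrow> 'x \<Rightarrow> ennreal) \<Rightarrow> ennreal" where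
  "fresh_leaf l v \<phi> = (\<integral>\<^sup>+p. \<integral>\<^sup>+z. \<phi> (snd p) z \<partial>leaf_law l (sel_tree n L (fst p)) (take l v) \<partial>J)"

lemma fresh_leaf_0: "fresh_leaf 0 v \<phi> = (\<integral>\<^sup>+p. \<integral>\<^sup>+z. \<phi> (snd p) z \<partial>level_law D \<kappa> L \<partial>J)"
  by (simp add: fresh_leaf_def leaf_law_def)

lemma measurable_section:
  assumes "(\<lambda>p. \<phi> (fst p) (snd p)) \<in> borel_measurable (M \<Otimes>\<^sub>M N)" "w \<in> space M"
  shows "\<phi> w \<in> borel_measurable N"
  using measurable_compose[OF measurable_Pair1'[OF assms(2)] assms(1)] by simp

lemma fresh_leaf_L:
  assumes v: "v \<in> nodes n L" and \<phi>: "(\<lambda>p. \<phi> (fst p) (snd p)) \<in> borel_measurable (MW \<Otimes>\<^sub>M X L)"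
  shows "fresh_leaf L v \<phi> = (\<integral>\<^sup>+p. \<phi> (snd p) (sel (fst p v)) \<partial>J)"
  unfolding fresh_leaf_def
proof (rule nn_integral_cong)
  fix p assume "p \<in> space J"
  then have p: "fst p \<in> space (S L)" "snd p \<in> space MW" by (auto simp: space_J)
  have vL: "v \<in> upto_nodes n L" using v L nodes_subset_upto[of L L n] by auto
  have lv: "length v = L" using length_nodes[OF v] .
  have "sel (fst p v) \<in> space (X L)"
    using measurable_space[OF measurable_sel_Xn measurable_space[OF measurable_node_L[OF vL] p(1)]] lv by simp
  then show "(\<integral>\<^sup>+z. \<phi> (snd p) z \<partial>leaf_law L (sel_tree n L (fst p)) (take L v)) = \<phi> (snd p) (sel (fst p v))"
    using L vL lv measurable_section[OF \<phi> p(2)]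
    by (simp add: leaf_law_def leaf_L sel_tree_def nn_integral_return)
qed

text \<open>Consecutive hybrids differ in whether the path runs through the selected entry of
  \<open>u\<close> or through its ghost, a fresh child of the same parent. Averaging over the rest
  of the path gives \<open>\<psi>\<close>, which keeps the Lipschitz bound because the leaf kernel
  has mass 1; then \<open>swap_le\<close> applies.\<close>

lemma fresh_leaf_step:
  fixes \<phi> :: "'w \<Rightarrow> 'x \<Rightarrow> ennreal"
  assumes l: "Suc l \<le> L" and v: "v \<in> nodes n L"
    and \<phi>: "(\<lambda>p. \<phi> (fst p) (snd p)) \<in> borel_measurable (MW \<Otimes>\<^sub>M X L)"
    and lip: "\<And>w w' x. w \<in> space MW \<Longrightarrow> w' \<in> space MW \<Longrightarrow> x \<in> space (X L) \<Longrightarrow>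
      \<phi> w x \<le> \<phi> w' x + ennreal (c * dist w w')"
    and c: "0 \<le> c"
  shows "fresh_leaf l v \<phi> \<le> fresh_leaf (Suc l) v \<phi> + ennreal (2 * c) * wcost (take (Suc l) v)" (is ?A)
    and "fresh_leaf (Suc l) v \<phi> \<le> fresh_leaf l v \<phi> + ennreal (2 * c) * wcost (take (Suc l) v)" (is ?B)
proof -
  define u where "u = take (Suc l) v"
  have u: "u \<in> nodes n (Suc l)" unfolding u_def using take_nodes[OF v l] .
  have lu: "length u = Suc l" using length_nodes[OF u] .
  have bu: "butlast u = take l v" using l length_nodes[OF v] by (simp add: u_def butlast_take)
  have uL: "u \<in> upto_nodes n L" using u l nodes_subset_upto[of "Suc l" L n] by auto
  define \<psi> where "\<psi> w x = (\<integral>\<^sup>+z. \<phi> w z \<partial>leaf (Suc l) x)" for w x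
  have leafm: "leaf (Suc l) \<in> X (Suc l) \<rightarrow>\<^sub>M prob_algebra (X L)"
    using measurable_leaf[of "Suc l"] l by simp
  have \<psi>: "(\<lambda>p. \<psi> (fst p) (snd p)) \<in> borel_measurable (MW \<Otimes>\<^sub>M X (Suc l))"
    unfolding \<psi>_def
  proof (rule nn_integral_measurable_subprob_algebra2)
    show "(\<lambda>p. leaf (Suc l) (snd p)) \<in> MW \<Otimes>\<^sub>M X (Suc l) \<rightarrow>\<^sub>M subprob_algebra (X L)"
      using measurable_compose[OF measurable_snd measurable_prob_algebraD[OF leafm]] .
    have "(\<lambda>q. (fst (fst q), snd q)) \<in> (MW \<Otimes>\<^sub>M X (Suc l)) \<Otimes>\<^sub>M X L \<rightarrow>\<^sub>M MW \<Otimes>\<^sub>M X L"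
      by measurable
    from measurable_compose[OF this \<phi>]
    show "(\<lambda>(p, z). \<phi> (fst p) z) \<in> borel_measurable ((MW \<Otimes>\<^sub>M X (Suc l)) \<Otimes>\<^sub>M X L)"
      by (simp add: split_beta')
  qed
  have \<psi>_lip: "\<psi> w x \<le> \<psi> w' x + ennreal (c * dist w w')"
    if "w \<in> space MW" "w' \<in> space MW" "x \<in> space (X (length u))" for w w' x
  proof -
    have lx: "leaf (Suc l) x \<in> space (prob_algebra (X L))"
      using measurable_space[OF leafm] that lu by simp
    then interpret prob_space "leaf (Suc l) x" by (simp add: space_prob_algebra)
    have st: "sets (leaf (Suc l) x) = sets (X L)" using lx by (simp add: space_prob_algebra)
    have "\<psi> w x \<le> (\<integral>\<^sup>+z. \<phi> w' z + ennreal (c * dist w w') \<partial>leaf (Suc l) x)"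
      unfolding \<psi>_def using lip[OF that(1,2)] sets_eq_imp_space_eq[OF st] by (intro nn_integral_mono) auto
    also have "\<dots> = \<psi> w' x + ennreal (c * dist w w')"
      unfolding \<psi>_def using measurable_section[OF \<phi> that(2)] st
      by (subst nn_integral_add) (auto simp: emeasure_space_1 cong: measurable_cong_sets)
    finally show ?thesis .
  qed
  have sel: "(\<integral>\<^sup>+p. \<psi> (snd p) (sel (fst p u)) \<partial>J) = fresh_leaf (Suc l) v \<phi>"
    unfolding fresh_leaf_def \<psi>_def u_def[symmetric] leaf_law_def using uL by (simp add: sel_tree_def)
  have "(\<integral>\<^sup>+p. \<psi> (snd p) (ghost (fst p u)) \<partial>J) =
    (\<integral>\<^sup>+p. \<integral>\<^sup>+y. \<psi> (snd p) y \<partial>par (sel_tree n L (fst p)) u \<partial>J)"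
    by (rule nn_integral_J_ghost[OF _ l u \<psi>]) simp
  also have "\<dots> = fresh_leaf l v \<phi>"
    unfolding fresh_leaf_def bu[symmetric]
  proof (rule nn_integral_cong)
    fix p assume "p \<in> space J"
    then have p: "fst p \<in> space (S L)" "snd p \<in> space MW" by (auto simp: space_J)
    define t where "t = sel_tree n L (fst p)"
    have t: "t \<in> space (T L)" unfolding t_def using p(1) by (rule sel_tree_in_space)
    have "par t u \<in> space (prob_algebra (X (Suc l)))"
      using par_in_prob_algebra[OF l _ u t] l by simp
    then have st: "sets (par t u) = sets (X (Suc l))" by (simp add: space_prob_algebra)
    have "(\<integral>\<^sup>+z. \<phi> (snd p) z \<partial>leaf_law l t (butlast u)) = (\<integral>\<^sup>+z. \<phi> (snd p) z \<partial>(par t u \<bind> leaf (Suc l)))"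
      by (simp add: par_bind_leaf[OF l u])
    also have "\<dots> = (\<integral>\<^sup>+y. \<psi> (snd p) y \<partial>par t u)"
      unfolding \<psi>_def using measurable_prob_algebraD[OF leafm] st
      by (intro nn_integral_bind[OF measurable_section[OF \<phi> p(2)]]) (simp cong: measurable_cong_sets)
    finally show "(\<integral>\<^sup>+y. \<psi> (snd p) y \<partial>par (sel_tree n L (fst p)) u) =
       (\<integral>\<^sup>+z. \<phi> (snd p) z \<partial>leaf_law l (sel_tree n L (fst p)) (butlast u))"
      by (simp add: t_def)
  qed
  finally have ghost: "(\<integral>\<^sup>+p. \<psi> (snd p) (ghost (fst p u)) \<partial>J) = fresh_leaf l v \<phi>" .
  have \<psi>': "(\<lambda>p. \<psi> (fst p) (snd p)) \<in> borel_measurable (MW \<Otimes>\<^sub>M X (length u))"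
    using \<psi> lu by simp
  have "(\<integral>\<^sup>+p. \<psi> (snd p) (ghost (fst p u)) \<partial>J) \<le> (\<integral>\<^sup>+p. \<psi> (snd p) (sel (fst p u)) \<partial>J) + ennreal (2 * c) * wcost u"
    by (rule swap_le[OF uL \<psi>' \<psi>_lip c measurable_ghost_Xn measurable_sel_Xn]) (auto simp: sel_def ghost_def)
  then show ?A unfolding sel ghost unfolding u_def .
  have "(\<integral>\<^sup>+p. \<psi> (snd p) (sel (fst p u)) \<partial>J) \<le> (\<integral>\<^sup>+p. \<psi> (snd p) (ghost (fst p u)) \<partial>J) + ennreal (2 * c) * wcost u"
    by (rule swap_le[OF uL \<psi>' \<psi>_lip c measurable_sel_Xn measurable_ghost_Xn]) (auto simp: sel_def ghost_def)
  then show ?B unfolding sel ghost unfolding u_def .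
qed

text \<open>Both directions are used: the first bounds the gap, the second carries integrability
  from a test point to a training leaf, on which the hypothesis depends.\<close>

lemma fresh_leaf_transfer:
  fixes \<phi> :: "'w \<Rightarrow> 'x \<Rightarrow> ennreal"
  assumes v: "v \<in> nodes n L"
    and \<phi>: "(\<lambda>p. \<phi> (fst p) (snd p)) \<in> borel_measurable (MW \<Otimes>\<^sub>M X L)"
    and lip: "\<And>w w' x. w \<in> space MW \<Longrightarrow> w' \<in> space MW \<Longrightarrow> x \<in> space (X L) \<Longrightarrow>
      \<phi> w x \<le> \<phi> w' x + ennreal (c * dist w w')"
    and c: "0 \<le> c"
  shows "(\<integral>\<^sup>+p. \<integral>\<^sup>+z. \<phi> (snd p) z \<partial>level_law D \<kappa> L \<partial>J) \<le>
      (\<integral>\<^sup>+p. \<phi> (snd p) (sel (fst p v)) \<partial>J) + ennreal (2 * c) * (\<Sum>l\<in>{1..L}. wcost (take l v))" (is ?A)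
    and "(\<integral>\<^sup>+p. \<phi> (snd p) (sel (fst p v)) \<partial>J) \<le>
      (\<integral>\<^sup>+p. \<integral>\<^sup>+z. \<phi> (snd p) z \<partial>level_law D \<kappa> L \<partial>J) + ennreal (2 * c) * (\<Sum>l\<in>{1..L}. wcost (take l v))" (is ?B)
proof -
  have step:
    "fresh_leaf l v \<phi> \<le> fresh_leaf (Suc l) v \<phi> + ennreal (2 * c) * wcost (take (Suc l) v)"
    "fresh_leaf (Suc l) v \<phi> \<le> fresh_leaf l v \<phi> + ennreal (2 * c) * wcost (take (Suc l) v)"
    if "Suc l \<le> L" for l
    using fresh_leaf_step[OF that v \<phi> lip c] by auto
  have "fresh_leaf 0 v \<phi> \<le> fresh_leaf m v \<phi> + ennreal (2 * c) * (\<Sum>l\<in>{1..m}. wcost (take l v)) \<and>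
    fresh_leaf m v \<phi> \<le> fresh_leaf 0 v \<phi> + ennreal (2 * c) * (\<Sum>l\<in>{1..m}. wcost (take l v))" if "m \<le> L" for m
    using that
  proof (induction m)
    case (Suc m)
    let ?S = "ennreal (2 * c) * (\<Sum>l\<in>{1..m}. wcost (take l v))"
    let ?d = "ennreal (2 * c) * wcost (take (Suc m) v)"
    have eq: "ennreal (2 * c) * (\<Sum>l\<in>{1..Suc m}. wcost (take l v)) = ?d + ?S"
      by (simp add: distrib_left add.commute)
    have "fresh_leaf 0 v \<phi> \<le> (fresh_leaf (Suc m) v \<phi> + ?d) + ?S"
      using Suc order_trans[OF _ add_right_mono[OF step(1)[OF Suc.prems]]] by auto
    moreover have "fresh_leaf (Suc m) v \<phi> \<le> (fresh_leaf 0 v \<phi> + ?S) + ?d"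
      using Suc order_trans[OF step(2)[OF Suc.prems] add_right_mono] by auto
    ultimately show ?case
      unfolding eq by (simp only: add.assoc add.commute[of ?S ?d] simp_thms)
  qed simp
  from this[OF order_refl] show ?A ?B
    by (simp_all add: fresh_leaf_0 fresh_leaf_L[OF v \<phi>])
qed

end

subsection \<open>Truncated absolute values of sums of independent variables\<close>

text \<open>Subadditive like the absolute value, but with finite mean under every probability
  measure, so that a small multiple of this mean can be absorbed into the left side of an
  inequality.\<close>

definition trunc :: "real \<Rightarrow> real \<Rightarrow> ennreal" where
  "trunc m x = ennreal (min \<bar>x\<bar> m)"

lemma trunc_0 [simp]: "0 \<le> m \<Longrightarrow> trunc m 0 = 0"
  by (simp add: trunc_def)

lemma trunc_minus: "trunc m (- x) = trunc m x"
  by (simp add: trunc_def)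

lemma trunc_add: "0 \<le> m \<Longrightarrow> trunc m (x + y) \<le> trunc m x + trunc m y"
proof -
  assume "0 \<le> m"
  then have "min \<bar>x + y\<bar> m \<le> min \<bar>x\<bar> m + min \<bar>y\<bar> m" by auto
  then show ?thesis
    using \<open>0 \<le> m\<close> unfolding trunc_def by (simp add: ennreal_plus[symmetric] ennreal_leI del: ennreal_plus)
qed

lemma trunc_diff: "0 \<le> m \<Longrightarrow> trunc m (x - y) \<le> trunc m x + trunc m y"
  using trunc_add[of m x "- y"] by (simp add: trunc_minus)

lemma trunc_sum: "0 \<le> m \<Longrightarrow> trunc m (\<Sum>i\<in>I. f i) \<le> (\<Sum>i\<in>I. trunc m (f i))"
proof (induction I rule: infinite_finite_induct)
  case (insert i I)
  then show ?case
    using order_trans[OF trunc_add add_left_mono] by auto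
qed auto

lemma trunc_mono: "\<bar>x\<bar> \<le> \<bar>y\<bar> \<Longrightarrow> trunc m x \<le> trunc m y"
  unfolding trunc_def by (intro ennreal_leI) auto

lemma measurable_trunc [measurable (raw)]:
  "f \<in> borel_measurable M \<Longrightarrow> (\<lambda>x. trunc m (f x)) \<in> borel_measurable M"
  unfolding trunc_def by measurable

lemma nn_integral_PiM_component:
  assumes "\<And>i. i \<in> I \<Longrightarrow> prob_space (M i)" "i \<in> I" and [measurable]: "f \<in> borel_measurable (M i)"
  shows "(\<integral>\<^sup>+x. f (x i) \<partial>PiM I M) = integral\<^sup>N (M i) f"
proof -
  have "integral\<^sup>N (M i) f = (\<integral>\<^sup>+x. f x \<partial>distr (PiM I M) (M i) (\<lambda>\<omega>. \<omega> i))"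
    using distr_PiM_component[of I M i] assms(1,2) by simp
  also have "\<dots> = (\<integral>\<^sup>+x. f (x i) \<partial>PiM I M)"
    using assms(2) by (intro nn_integral_distr) auto
  finally show ?thesis ..
qed

text \<open>Resampling coordinate \<open>i\<close> changes the sum by a difference of two independent copies.\<close>

lemma nn_integral_trunc_symmetrized_le:
  fixes f :: "'a \<Rightarrow> real"
  assumes fin: "finite I" and i: "i \<in> I" and M: "\<And>i. i \<in> I \<Longrightarrow> M i \<in> space (prob_algebra N)"
    and f[measurable]: "f \<in> borel_measurable N" and m: "0 \<le> m"
  shows "(\<integral>\<^sup>+a. \<integral>\<^sup>+b. trunc m (f a - f b) \<partial>M i \<partial>M i) \<le>
    2 * (\<integral>\<^sup>+y. trunc m (\<Sum>i\<in>I. f (y i)) \<partial>PiM I M)"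
proof -
  have pr: "prob_space (M j)" and st: "sets (M j) = sets N" if "j \<in> I" for j
    using M[OF that] by (auto simp: space_prob_algebra)
  note [measurable_cong] = st[OF i]
  interpret Mi: prob_space "M i" by (rule pr[OF i])
  have fj: "(\<lambda>y. f (y j)) \<in> borel_measurable (PiM I M)" if "j \<in> I" for j
    using measurable_compose[OF measurable_component_singleton[OF that, of M], of f borel] st[OF that]
    by (simp cong: measurable_cong_sets)
  define s where "s y = (\<Sum>i\<in>I. f (y i))" for y
  have s[measurable]: "s \<in> borel_measurable (PiM I M)"
    unfolding s_def[abs_def] by (intro borel_measurable_sum fj)
  have "I = insert i I" using i by auto
  then have "(\<lambda>p. (fst p)(i := snd p)) \<in> PiM I M \<Otimes>\<^sub>M M i \<rightarrow>\<^sub>M PiM I M"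
    by (intro measurable_fun_upd[where J=I]) auto
  from measurable_compose[OF this s]
  have s'[measurable]: "(\<lambda>p. s ((fst p)(i := snd p))) \<in> borel_measurable (PiM I M \<Otimes>\<^sub>M M i)" .
  have diff: "f (y i) - f b = s y - s (y(i := b))" for y b
    unfolding s_def using fin i by (simp add: sum.remove[of I i])
  have "(\<integral>\<^sup>+a. \<integral>\<^sup>+b. trunc m (f a - f b) \<partial>M i \<partial>M i) = (\<integral>\<^sup>+y. \<integral>\<^sup>+b. trunc m (f (y i) - f b) \<partial>M i \<partial>PiM I M)"
    by (rule nn_integral_PiM_component[OF pr i, symmetric]) measurable
  also have "\<dots> \<le> (\<integral>\<^sup>+y. \<integral>\<^sup>+b. trunc m (s y) + trunc m (s (y(i := b))) \<partial>M i \<partial>PiM I M)"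
    unfolding diff by (intro nn_integral_mono trunc_diff m)
  also have "\<dots> = (\<integral>\<^sup>+y. trunc m (s y) + (\<integral>\<^sup>+b. trunc m (s (y(i := b))) \<partial>M i) \<partial>PiM I M)"
  proof (rule nn_integral_cong)
    fix y assume y: "y \<in> space (PiM I M)"
    have "(\<lambda>b. s (y(i := b))) \<in> borel_measurable (M i)"
      using measurable_compose[OF measurable_Pair1'[OF y] s'] by simp
    then show "(\<integral>\<^sup>+b. trunc m (s y) + trunc m (s (y(i := b))) \<partial>M i) = trunc m (s y) + (\<integral>\<^sup>+b. trunc m (s (y(i := b))) \<partial>M i)"
      by (subst nn_integral_add) (auto simp: Mi.emeasure_space_1)
  qed
  also have "\<dots> = (\<integral>\<^sup>+y. trunc m (s y) \<partial>PiM I M) + (\<integral>\<^sup>+y. \<integral>\<^sup>+b. trunc m (s (y(i := b))) \<partial>M i \<partial>PiM I M)"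
  proof (rule nn_integral_add)
    show "(\<lambda>y. \<integral>\<^sup>+b. trunc m (s (y(i := b))) \<partial>M i) \<in> borel_measurable (PiM I M)"
      by (rule Mi.borel_measurable_nn_integral) (use s' in \<open>simp add: split_beta'\<close>)
  qed measurable
  also have "\<dots> = 2 * (\<integral>\<^sup>+y. trunc m (s y) \<partial>PiM I M)"
    by (subst nn_integral_PiM_resample[OF fin i pr]) (auto simp only: mult_2 intro: measurable_trunc s)
  finally show ?thesis unfolding s_def .
qed

text \<open>Replacing all variables with the same index \<open>b i\<close> by one representative \<open>s (b i)\<close> changes
  the sum by symmetrized terms only.\<close>

lemma nn_integral_trunc_representatives_le:
  fixes f :: "'a \<Rightarrow> real"
  assumes fin: "finite I" "finite P" and b: "\<And>i. i \<in> I \<Longrightarrow> b i \<in> P"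
    and s: "\<And>p. p \<in> P \<Longrightarrow> s p \<in> I" "\<And>p. p \<in> P \<Longrightarrow> b (s p) = p"
    and k: "\<And>p. p \<in> P \<Longrightarrow> card {i\<in>I. b i = p} = k"
    and \<theta>: "\<And>p. p \<in> P \<Longrightarrow> \<theta> p \<in> space (prob_algebra N)"
    and f[measurable]: "f \<in> borel_measurable N" and m: "0 \<le> m"
  shows "(\<integral>\<^sup>+y. trunc m (real k * (\<Sum>p\<in>P. f (y p))) \<partial>PiM P \<theta>) \<le>
    ennreal (1 + 2 * real (card I)) * (\<integral>\<^sup>+y. trunc m (\<Sum>i\<in>I. f (y i)) \<partial>PiM I (\<lambda>i. \<theta> (b i)))"
proof -
  define M where "M i = \<theta> (b i)" for i
  have M: "M i \<in> space (prob_algebra N)" if "i \<in> I" for i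
    using \<theta> b that by (simp add: M_def)
  then have pr: "prob_space (M j)" and st: "sets (M j) = sets N" if "j \<in> I" for j
    using that by (auto simp: space_prob_algebra)
  have fi[measurable]: "(\<lambda>y. f (y j)) \<in> borel_measurable (PiM I M)" if "j \<in> I" for j
    using measurable_compose[OF measurable_component_singleton[OF that, of M], of f borel] st[OF that]
    by (simp cong: measurable_cong_sets)
  have fp[measurable]: "(\<lambda>y. f (y p)) \<in> borel_measurable (PiM P \<theta>)" if "p \<in> P" for p
    using measurable_compose[OF measurable_component_singleton[OF that, of \<theta>], of f borel] \<theta>[OF that]
    by (simp cong: measurable_cong_sets add: space_prob_algebra)
  have sum_meas: "(\<lambda>y. \<Sum>i\<in>I. f (y i)) \<in> borel_measurable (PiM I M)"
    by (intro borel_measurable_sum fi)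
  let ?E = "\<integral>\<^sup>+y. trunc m (\<Sum>i\<in>I. f (y i)) \<partial>PiM I M"
  \<comment> \<open>Distinct indices have distinct representatives, so the chosen coordinates are
    independent with laws \<open>\<theta> p\<close>.\<close>
  have "inj_on s P" using s(2) by (metis inj_onI)
  moreover have "PiM P (\<lambda>p. M (s p)) = PiM P \<theta>"
    using s(2) by (intro PiM_cong) (auto simp: M_def)
  ultimately have distr: "distr (PiM I M) (PiM P \<theta>) (\<lambda>y. \<lambda>p\<in>P. y (s p)) = PiM P \<theta>"
    using distr_PiM_reindex[of I M s P] pr s(1) by auto
  have sl: "(\<lambda>y. \<lambda>p\<in>P. y (s p)) \<in> PiM I M \<rightarrow>\<^sub>M PiM P \<theta>"
  proof (rule measurable_restrict)
    fix p assume p: "p \<in> P"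
    show "(\<lambda>y. y (s p)) \<in> PiM I M \<rightarrow>\<^sub>M \<theta> p"
      using measurable_component_singleton[OF s(1)[OF p], of M] s(2)[OF p] by (simp add: M_def)
  qed
  have "(\<integral>\<^sup>+y. trunc m (real k * (\<Sum>p\<in>P. f (y p))) \<partial>PiM P \<theta>) =
      (\<integral>\<^sup>+y. trunc m (real k * (\<Sum>p\<in>P. f (y p))) \<partial>distr (PiM I M) (PiM P \<theta>) (\<lambda>y. \<lambda>p\<in>P. y (s p)))"
    by (simp add: distr)
  also have "\<dots> = (\<integral>\<^sup>+y. trunc m (real k * (\<Sum>p\<in>P. f ((\<lambda>p\<in>P. y (s p)) p))) \<partial>PiM I M)"
    using fp by (intro nn_integral_distr[OF sl]) (simp add: measurable_trunc)
  also have "\<dots> = (\<integral>\<^sup>+y. trunc m (real k * (\<Sum>p\<in>P. f (y (s p)))) \<partial>PiM I M)"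
    by simp
  also have "\<dots> \<le> (\<integral>\<^sup>+y. trunc m (\<Sum>i\<in>I. f (y i)) + (\<Sum>i\<in>I. trunc m (f (y (s (b i))) - f (y i))) \<partial>PiM I M)"
  proof (rule nn_integral_mono)
    fix y
    have "(\<Sum>i\<in>I. f (y (s (b i)))) = (\<Sum>p\<in>P. \<Sum>i\<in>{i\<in>I. b i = p}. f (y (s (b i))))"
      using b by (intro sum.group[symmetric] fin) auto
    also have "\<dots> = (\<Sum>p\<in>P. real k * f (y (s p)))"
      using k by (intro sum.cong) auto
    finally have "real k * (\<Sum>p\<in>P. f (y (s p))) = (\<Sum>i\<in>I. f (y i)) + (\<Sum>i\<in>I. f (y (s (b i))) - f (y i))"
      by (simp add: sum_distrib_left sum_subtractf)
    then show "trunc m (real k * (\<Sum>p\<in>P. f (y (s p)))) \<le>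
        trunc m (\<Sum>i\<in>I. f (y i)) + (\<Sum>i\<in>I. trunc m (f (y (s (b i))) - f (y i)))"
      using order_trans[OF trunc_add[OF m] add_left_mono[OF trunc_sum[OF m]]] by simp
  qed
  also have "\<dots> = ?E + (\<Sum>i\<in>I. \<integral>\<^sup>+y. trunc m (f (y (s (b i))) - f (y i)) \<partial>PiM I M)"
    using s(1) b sum_meas fi
    by (subst nn_integral_add) (auto simp: nn_integral_sum intro!: measurable_trunc borel_measurable_diff borel_measurable_sum)
  also have "\<dots> \<le> ?E + (\<Sum>i\<in>I. 2 * ?E)"
  proof (intro add_left_mono sum_mono)
    fix i assume i: "i \<in> I"
    define j where "j = s (b i)"
    have j: "j \<in> I" "M j = M i" using s b i by (auto simp: j_def M_def)
    show "(\<integral>\<^sup>+y. trunc m (f (y (s (b i))) - f (y i)) \<partial>PiM I M) \<le> 2 * ?E"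
    proof (cases "j = i")
      case True
      then show ?thesis using m by (simp add: j_def[symmetric])
    next
      case False
      define R where "R = I - {j}"
      have R: "I = insert j R" "finite R" "j \<notin> R" "i \<in> R" using fin j False i by (auto simp: R_def)
      note [measurable_cong] = st[OF i] st[OF j(1)]
      have "(\<integral>\<^sup>+y. trunc m (f (y j) - f (y i)) \<partial>PiM I M) =
          (\<integral>\<^sup>+x. \<integral>\<^sup>+a. trunc m (f ((x(j := a)) j) - f ((x(j := a)) i)) \<partial>M j \<partial>PiM R M)"
        using fi[OF i] fi[OF j(1)] pr R unfolding R(1)
        by (intro nn_integral_PiM_insert) (auto intro!: measurable_trunc borel_measurable_diff)
      also have "\<dots> = (\<integral>\<^sup>+x. \<integral>\<^sup>+a. trunc m (f (x i) - f a) \<partial>M i \<partial>PiM R M)"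
        using False j(2) trunc_minus[of m "f _ - f _"] by simp
      also have "\<dots> = (\<integral>\<^sup>+b. \<integral>\<^sup>+a. trunc m (f b - f a) \<partial>M i \<partial>M i)"
      proof (rule nn_integral_PiM_component[OF _ R(4)])
        interpret Mi: prob_space "M i" by (rule pr[OF i])
        show "(\<lambda>b. \<integral>\<^sup>+a. trunc m (f b - f a) \<partial>M i) \<in> borel_measurable (M i)" by measurable
      qed (use pr R in auto)
      also have "\<dots> \<le> 2 * ?E"
        by (rule nn_integral_trunc_symmetrized_le[OF fin(1) i M f m])
      finally show ?thesis by (simp add: j_def)
    qed
  qed
  also have "\<dots> = ennreal (1 + 2 * real (card I)) * ?E"
  proof -
    \<comment> \<open>One copy for the sum itself and two for each of the \<open>card I\<close>
      symmetrized differences.\<close>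
    have "ennreal (1 + 2 * real (card I)) = 1 + of_nat (card I) * 2"
      by (simp add: ennreal_plus ennreal_mult ennreal_of_nat_eq_real_of_nat mult.commute)
    then show ?thesis by (simp add: distrib_right mult.assoc)
  qed
  finally show ?thesis unfolding M_def[abs_def] .
qed

context hierarchy
begin

subsection \<open>A lower bound for the truncated sum over the leaves\<close>

text \<open>A hybrid for the sum over all leaves: below each node of depth \<open>l\<close> one leaf
  is grown, independently given the tree, and \<open>c\<close> counts the leaves it stands for.
  Depth \<open>L\<close> with \<open>c = 1\<close> is a sum over the training leaves; depth 0 is a
  multiple of one test value.\<close>

definition leaf_sum :: "real \<Rightarrow> ('x \<Rightarrow> real) \<Rightarrow> nat \<Rightarrow> real \<Rightarrow> ennreal" where
  "leaf_sum m f l c = (\<integral>\<^sup>+\<omega>. \<integral>\<^sup>+y. trunc m (c * (\<Sum>v\<in>nodes n l. f (y v)))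
     \<partial>PiM (nodes n l) (leaf_law l (sel_tree n l \<omega>)) \<partial>ss l)"

lemma measurable_leaf_law_PiM:
  "l \<le> L \<Longrightarrow> (\<lambda>t. PiM (nodes n l) (leaf_law l t)) \<in> T l \<rightarrow>\<^sub>M prob_algebra (PiM (nodes n l) (\<lambda>_. X L))"
  by (intro measurable_PiM_kernel finite_nodes measurable_leaf_law) auto

lemma measurable_sum_component:
  "f \<in> borel_measurable N \<Longrightarrow> (\<lambda>y. \<Sum>v\<in>I. f (y v) :: real) \<in> borel_measurable (PiM I (\<lambda>_. N))"
  by (intro borel_measurable_sum measurable_compose[OF measurable_component_singleton])

text \<open>With the children integrated out, the leaves grown through them are independent given
  the tree above, and those with a common parent are identically distributed.\<close>

lemma bind_lev_leaf:
  assumes l: "Suc l \<le> L" and t: "t \<in> space (T l)"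
  shows "lev l t \<bind> (\<lambda>\<eta>. PiM (nodes n (Suc l)) (\<lambda>v. leaf (Suc l) (sel (\<eta> v)))) =
    PiM (nodes n (Suc l)) (\<lambda>v. leaf_law l t (butlast v))"
proof -
  have leafm: "leaf (Suc l) \<in> X (Suc l) \<rightarrow>\<^sub>M prob_algebra (X L)"
    using measurable_leaf[of "Suc l"] l by simp
  have par: "par t v \<in> space (prob_algebra (X (Suc l)))" if "v \<in> nodes n (Suc l)" for v
    using par_in_prob_algebra[OF l order_refl that t] .
  let ?N = "(X (Suc l) \<Otimes>\<^sub>M X (Suc l)) \<Otimes>\<^sub>M count_space (UNIV :: bool set)"
  have "lev l t \<bind> (\<lambda>\<eta>. PiM (nodes n (Suc l)) (\<lambda>v. leaf (Suc l) (sel (\<eta> v)))) =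
      PiM (nodes n (Suc l)) (\<lambda>v. node_pair (par t v) \<bind> (\<lambda>a. leaf (Suc l) (sel a)))"
    unfolding lev_def
    by (intro bind_PiM[where N="\<lambda>_. ?N" and R="\<lambda>_. X L"] finite_nodes node_pair_in_prob_algebra par
        measurable_compose[OF measurable_sel leafm])
  also have "\<dots> = PiM (nodes n (Suc l)) (\<lambda>v. leaf_law l t (butlast v))"
  proof (rule PiM_cong[OF refl])
    fix v assume v: "v \<in> nodes n (Suc l)"
    have np: "node_pair (par t v) \<in> space (prob_algebra ?N)"
      by (rule node_pair_in_prob_algebra[OF par[OF v]])
    then have "sets (node_pair (par t v)) = sets ?N" "space (node_pair (par t v)) \<noteq> {}"
      by (auto simp: space_prob_algebra prob_space.not_empty)
    then have "distr (node_pair (par t v)) (X (Suc l)) sel \<bind> leaf (Suc l) =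
        node_pair (par t v) \<bind> (\<lambda>a. leaf (Suc l) (sel a))"
      using measurable_prob_algebraD[OF leafm]
      by (intro bind_distr) (auto cong: measurable_cong_sets)
    then show "node_pair (par t v) \<bind> (\<lambda>a. leaf (Suc l) (sel a)) = leaf_law l t (butlast v)"
      by (simp add: distr_node_pair_sel[OF par[OF v]] par_bind_leaf[OF l v])
  qed
  finally show ?thesis .
qed

lemma leaf_sum_Suc:
  assumes l: "Suc l \<le> L" and f: "f \<in> borel_measurable (X L)"
  shows "leaf_sum m f (Suc l) c = (\<integral>\<^sup>+\<omega>. \<integral>\<^sup>+y. trunc m (c * (\<Sum>v\<in>nodes n (Suc l). f (y v)))
     \<partial>PiM (nodes n (Suc l)) (\<lambda>v. leaf_law l (sel_tree n l \<omega>) (butlast v)) \<partial>ss l)"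
proof -
  define G where "G y = trunc m (c * (\<Sum>v\<in>nodes n (Suc l). f (y v)))" for y
  have G: "G \<in> borel_measurable (PiM (nodes n (Suc l)) (\<lambda>_. X L))"
    unfolding G_def[abs_def] using measurable_sum_component[OF f] by measurable
  have meas: "(\<lambda>\<omega>. \<integral>\<^sup>+y. G y \<partial>PiM (nodes n (Suc l)) (leaf_law (Suc l) (sel_tree n (Suc l) \<omega>))) \<in> borel_measurable (S (Suc l))"
    using measurable_compose[OF measurable_compose[OF measurable_sel_tree measurable_prob_algebraD[OF measurable_leaf_law_PiM[OF l]]]
      nn_integral_measurable_subprob_algebra[OF G]] .
  have leafm: "leaf (Suc l) \<in> X (Suc l) \<rightarrow>\<^sub>M prob_algebra (X L)"
    using measurable_leaf[of "Suc l"] l by simp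
  have "leaf_sum m f (Suc l) c = (\<integral>\<^sup>+\<omega>. \<integral>\<^sup>+\<eta>. \<integral>\<^sup>+y. G y
      \<partial>PiM (nodes n (Suc l)) (leaf_law (Suc l) (sel_tree n (Suc l) (merge_level n (Suc l) \<omega> \<eta>))) \<partial>lev l (sel_tree n l \<omega>) \<partial>ss l)"
    unfolding leaf_sum_def G_def[symmetric] by (rule nn_integral_ss_Suc[OF l meas])
  also have "\<dots> = (\<integral>\<^sup>+\<omega>. \<integral>\<^sup>+\<eta>. \<integral>\<^sup>+y. G y
      \<partial>PiM (nodes n (Suc l)) (\<lambda>v. leaf (Suc l) (sel (\<eta> v))) \<partial>lev l (sel_tree n l \<omega>) \<partial>ss l)"
    unfolding sel_tree_merge_level
    by (intro nn_integral_cong arg_cong2[where f=nn_integral] PiM_cong refl)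
      (simp add: leaf_law_def merge_level_apply)
  also have "\<dots> = (\<integral>\<^sup>+\<omega>. \<integral>\<^sup>+y. G y \<partial>PiM (nodes n (Suc l)) (\<lambda>v. leaf_law l (sel_tree n l \<omega>) (butlast v)) \<partial>ss l)"
  proof (rule nn_integral_cong)
    fix \<omega> assume "\<omega> \<in> space (ss l)"
    then have t: "sel_tree n l \<omega> \<in> space (T l)" using l by (simp add: space_ss sel_tree_in_space)
    have "(\<lambda>\<eta>. PiM (nodes n (Suc l)) (\<lambda>v. leaf (Suc l) (sel (\<eta> v)))) \<in>
        PiM (nodes n (Suc l)) (Xn X) \<rightarrow>\<^sub>M prob_algebra (PiM (nodes n (Suc l)) (\<lambda>_. X L))"
    proof (intro measurable_PiM_kernel finite_nodes)
      fix v assume v: "v \<in> nodes n (Suc l)"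
      show "(\<lambda>\<eta>. leaf (Suc l) (sel (\<eta> v))) \<in> PiM (nodes n (Suc l)) (Xn X) \<rightarrow>\<^sub>M prob_algebra (X L)"
        using measurable_compose[OF measurable_sel_component[OF v, of X], of "leaf (Suc l)"] leafm length_nodes[OF v]
        by simp
    qed
    then have "(\<lambda>\<eta>. PiM (nodes n (Suc l)) (\<lambda>v. leaf (Suc l) (sel (\<eta> v)))) \<in>
        lev l (sel_tree n l \<omega>) \<rightarrow>\<^sub>M subprob_algebra (PiM (nodes n (Suc l)) (\<lambda>_. X L))"
      using sets_lev[OF l t] by (auto dest: measurable_prob_algebraD cong: measurable_cong_sets)
    from nn_integral_bind[OF G this] show "(\<integral>\<^sup>+\<eta>. \<integral>\<^sup>+y. G y
      \<partial>PiM (nodes n (Suc l)) (\<lambda>v. leaf (Suc l) (sel (\<eta> v))) \<partial>lev l (sel_tree n l \<omega>)) =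
      (\<integral>\<^sup>+y. G y \<partial>PiM (nodes n (Suc l)) (\<lambda>v. leaf_law l (sel_tree n l \<omega>) (butlast v)))"
      unfolding bind_lev_leaf[OF l t] ..
  qed
  finally show ?thesis unfolding G_def .
qed

text \<open>Leaves grown through siblings are i.i.d. given the tree above, so each group of siblings
  may be replaced by \<open>n (Suc l)\<close> copies of one leaf at the price of a constant
  factor.\<close>

lemma leaf_sum_step:
  assumes l: "Suc l \<le> L" and f: "f \<in> borel_measurable (X L)" and m: "0 \<le> m"
  shows "leaf_sum m f l (real (n (Suc l)) * c) \<le>
    ennreal (1 + 2 * real (Nprod n (Suc l))) * leaf_sum m f (Suc l) c"
proof -
  let ?C = "ennreal (1 + 2 * real (Nprod n (Suc l)))"
  define F where "F \<omega> = (\<integral>\<^sup>+y. trunc m (c * (\<Sum>v\<in>nodes n (Suc l). f (y v)))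
     \<partial>PiM (nodes n (Suc l)) (\<lambda>v. leaf_law l (sel_tree n l \<omega>) (butlast v)))" for \<omega>
  have "leaf_sum m f l (real (n (Suc l)) * c) \<le> (\<integral>\<^sup>+\<omega>. ?C * F \<omega> \<partial>ss l)"
    unfolding leaf_sum_def
  proof (rule nn_integral_mono)
    fix \<omega> assume "\<omega> \<in> space (ss l)"
    then have t: "sel_tree n l \<omega> \<in> space (T l)" using l by (simp add: space_ss sel_tree_in_space)
    have fib: "{v \<in> nodes n (Suc l). butlast v = p} = (\<lambda>k. p @ [k]) ` {..<n (Suc l)}" if "p \<in> nodes n l" for p
      using that by (auto simp: nodes_Suc)
    have card: "card {v \<in> nodes n (Suc l). butlast v = p} = n (Suc l)" if "p \<in> nodes n l" for p
      unfolding fib[OF that] by (subst card_image) (auto simp: inj_on_def)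
    have n1: "n (Suc l) \<ge> 1" using branching[of "Suc l"] l by simp
    have "(\<integral>\<^sup>+y. trunc m (real (n (Suc l)) * (\<Sum>p\<in>nodes n l. c * f (y p))) \<partial>PiM (nodes n l) (leaf_law l (sel_tree n l \<omega>))) \<le>
      ennreal (1 + 2 * real (card (nodes n (Suc l)))) * (\<integral>\<^sup>+y. trunc m (\<Sum>v\<in>nodes n (Suc l). c * f (y v))
        \<partial>PiM (nodes n (Suc l)) (\<lambda>v. leaf_law l (sel_tree n l \<omega>) (butlast v)))"
    \<comment> \<open>The first child stands for its siblings; it exists because branching factors
      are at least 1.\<close>
    proof (rule nn_integral_trunc_representatives_le[where s="\<lambda>p. p @ [0]" and N="X L"])
      show "leaf_law l (sel_tree n l \<omega>) p \<in> space (prob_algebra (X L))" if "p \<in> nodes n l" for p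
        using measurable_space[OF measurable_leaf_law[OF order_refl _ that] t] l by simp
      show "(\<lambda>x. c * f x) \<in> borel_measurable (X L)" using f by simp
    qed (use n1 m in \<open>auto simp: card butlast_nodes snoc_in_nodes_iff\<close>)
    then show "(\<integral>\<^sup>+y. trunc m (real (n (Suc l)) * c * (\<Sum>v\<in>nodes n l. f (y v))) \<partial>PiM (nodes n l) (leaf_law l (sel_tree n l \<omega>))) \<le> ?C * F \<omega>"
      by (simp add: F_def card_nodes sum_distrib_left[symmetric] mult.assoc)
  qed
  also have "\<dots> \<le> ?C * integral\<^sup>N (ss l) F"
    by (rule nn_integral_cmult_le) simp
  also have "integral\<^sup>N (ss l) F = leaf_sum m f (Suc l) c"
    unfolding leaf_sum_Suc[OF l f] F_def ..
  finally show ?thesis .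
qed

lemma leaf_sum_L:
  assumes f: "f \<in> borel_measurable (X L)"
  shows "leaf_sum m f L 1 = (\<integral>\<^sup>+\<omega>. trunc m (\<Sum>v\<in>nodes n L. f (sel (\<omega> v))) \<partial>ss L)"
  unfolding leaf_sum_def
proof (rule nn_integral_cong)
  fix \<omega> assume "\<omega> \<in> space (ss L)"
  then have \<omega>: "\<omega> \<in> space (S L)" by (simp add: space_ss)
  define y where "y = (\<lambda>v\<in>nodes n L. sel (\<omega> v))"
  have "sel (\<omega> v) \<in> space (X L)" if v: "v \<in> nodes n L" for v
    using measurable_space[OF measurable_sel_Xn measurable_space[OF measurable_node[OF L order_refl v] \<omega>]] length_nodes[OF v]
    by simp
  then have y: "y \<in> space (PiM (nodes n L) (\<lambda>_. X L))" by (auto simp: y_def space_PiM)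
  have "PiM (nodes n L) (leaf_law L (sel_tree n L \<omega>)) = PiM (nodes n L) (\<lambda>v. return (X L) (y v))"
    using L nodes_subset_upto[of L L n] by (intro PiM_cong) (auto simp: leaf_law_def leaf_L sel_tree_def y_def)
  also have "\<dots> = return (PiM (nodes n L) (\<lambda>_. X L)) y"
    by (rule PiM_return[OF finite_nodes y])
  finally have "(\<integral>\<^sup>+y. trunc m (1 * (\<Sum>v\<in>nodes n L. f (y v))) \<partial>PiM (nodes n L) (leaf_law L (sel_tree n L \<omega>))) =
      (\<integral>\<^sup>+y. trunc m (\<Sum>v\<in>nodes n L. f (y v)) \<partial>return (PiM (nodes n L) (\<lambda>_. X L)) y)"
    by simp
  also have "\<dots> = trunc m (\<Sum>v\<in>nodes n L. f (y v))"
    using y measurable_sum_component[OF f] by (intro nn_integral_return measurable_trunc)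
  also have "\<dots> = trunc m (\<Sum>v\<in>nodes n L. f (sel (\<omega> v)))"
    by (simp add: y_def)
  finally show "(\<integral>\<^sup>+y. trunc m (1 * (\<Sum>v\<in>nodes n L. f (y v))) \<partial>PiM (nodes n L) (leaf_law L (sel_tree n L \<omega>))) =
    trunc m (\<Sum>v\<in>nodes n L. f (sel (\<omega> v)))" .
qed

lemma leaf_sum_0:
  assumes f: "f \<in> borel_measurable (X L)"
  shows "leaf_sum m f 0 c = (\<integral>\<^sup>+z. trunc m (c * f z) \<partial>level_law D \<kappa> L)"
proof -
  have ll: "level_law D \<kappa> L \<in> space (prob_algebra (X L))"
    using level_law_in_prob_algebra[of L] L by simp
  then have "f \<in> borel_measurable (level_law D \<kappa> L)"
    using f by (simp add: space_prob_algebra cong: measurable_cong_sets)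
  then have "(\<integral>\<^sup>+y. trunc m (c * f (y [])) \<partial>PiM {[]} (\<lambda>_. level_law D \<kappa> L)) = (\<integral>\<^sup>+z. trunc m (c * f z) \<partial>level_law D \<kappa> L)"
    using ll by (intro nn_integral_PiM_component) (auto simp: space_prob_algebra intro!: measurable_trunc)
  moreover have "emeasure (ss 0) (space (ss 0)) = 1"
    using prob_space_ss[of 0] by (intro prob_space.emeasure_space_1) simp
  ultimately show ?thesis
    by (simp add: leaf_sum_def nodes_0 leaf_law_def[abs_def])
qed

lemma Nprod_pos: "l \<le> L \<Longrightarrow> Nprod n l \<ge> 1"
  unfolding Nprod_def using branching by (intro prod_ge_1) auto

text \<open>A heavy tail of one leaf cannot be hidden by cancellation among dependent leaves:
  \<open>leaf_sum_step\<close> is chained from depth 0 to depth \<open>L\<close>. The constant is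
  fixed before \<open>m\<close> and \<open>f\<close>, hence uniform in the truncation.\<close>

lemma trunc_leaf_le_trunc_sum:
  obtains C where "C \<ge> 0"
    "\<And>m f. 0 \<le> m \<Longrightarrow> f \<in> borel_measurable (X L) \<Longrightarrow>
      (\<integral>\<^sup>+z. trunc m (f z) \<partial>level_law D \<kappa> L) \<le>
      ennreal C * (\<integral>\<^sup>+\<omega>. trunc m (\<Sum>v\<in>nodes n L. f (sel (\<omega> v))) \<partial>ss L)"
proof -
  have "\<exists>C\<ge>0. \<forall>m f c. 0 \<le> m \<longrightarrow> f \<in> borel_measurable (X L) \<longrightarrow>
      leaf_sum m f 0 (real (Nprod n l) * c) \<le> ennreal C * leaf_sum m f l c" if "l \<le> L" for l
    using that
  proof (induction l)
    case 0
    then show ?case by (intro exI[of _ 1]) (simp add: Nprod_def)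
  next
    case (Suc l)
    then obtain C where C: "C \<ge> 0" "\<And>m f c. 0 \<le> m \<Longrightarrow> f \<in> borel_measurable (X L) \<Longrightarrow>
      leaf_sum m f 0 (real (Nprod n l) * c) \<le> ennreal C * leaf_sum m f l c" by auto
    have "leaf_sum m f 0 (real (Nprod n (Suc l)) * c) \<le>
        ennreal (C * (1 + 2 * real (Nprod n (Suc l)))) * leaf_sum m f (Suc l) c"
      if "0 \<le> m" "f \<in> borel_measurable (X L)" for m f c
    proof -
      have "leaf_sum m f 0 (real (Nprod n (Suc l)) * c) \<le> ennreal C * leaf_sum m f l (real (n (Suc l)) * c)"
        using C(2)[OF that, of "real (n (Suc l)) * c"] by (simp add: Nprod_Suc mult.assoc)
      also have "\<dots> \<le> ennreal C * (ennreal (1 + 2 * real (Nprod n (Suc l))) * leaf_sum m f (Suc l) c)"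
        by (intro mult_left_mono leaf_sum_step Suc.prems that) simp
      finally show ?thesis using C(1) by (simp add: ennreal_mult mult.assoc)
    qed
    with C(1) show ?case by (intro exI[of _ "C * (1 + 2 * real (Nprod n (Suc l)))"]) auto
  qed
  from this[OF order_refl] obtain C where C: "C \<ge> 0" "\<And>m f c. 0 \<le> m \<Longrightarrow> f \<in> borel_measurable (X L) \<Longrightarrow>
      leaf_sum m f 0 (real (Nprod n L) * c) \<le> ennreal C * leaf_sum m f L c" by auto
  show ?thesis
  proof (rule that[OF C(1)])
    fix m :: real and f :: "'x \<Rightarrow> real" assume m: "0 \<le> m" and f: "f \<in> borel_measurable (X L)"
    have N: "real (Nprod n L) \<ge> 1" using Nprod_pos[of L] by simp
    \<comment> \<open>At depth 0 the single leaf carries the factor \<open>Nprod n L\<close>, which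
      is at least 1 and may be inserted by monotonicity.\<close>
    have "(\<integral>\<^sup>+z. trunc m (f z) \<partial>level_law D \<kappa> L) \<le> (\<integral>\<^sup>+z. trunc m (real (Nprod n L) * 1 * f z) \<partial>level_law D \<kappa> L)"
    proof (intro nn_integral_mono trunc_mono)
      fix z
      have "1 * \<bar>f z\<bar> \<le> real (Nprod n L) * \<bar>f z\<bar>" by (rule mult_right_mono[OF N]) simp
      then show "\<bar>f z\<bar> \<le> \<bar>real (Nprod n L) * 1 * f z\<bar>" by (simp add: abs_mult)
    qed
    also have "\<dots> \<le> ennreal C * leaf_sum m f L 1"
      using C(2)[OF m f, of 1] unfolding leaf_sum_0[OF f] .
    finally show "(\<integral>\<^sup>+z. trunc m (f z) \<partial>level_law D \<kappa> L) \<le>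
      ennreal C * (\<integral>\<^sup>+\<omega>. trunc m (\<Sum>v\<in>nodes n L. f (sel (\<omega> v))) \<partial>ss L)"
      unfolding leaf_sum_L[OF f] .
  qed
qed

end

subsection \<open>A logarithmic cutoff\<close>

definition clamp :: "real \<Rightarrow> real \<Rightarrow> real" where
  "clamp b x = max (- b) (min b x)"

text \<open>For positive \<open>e\<close> it vanishes as soon as
  \<open>1 + e * r \<ge> exp (1 / e)\<close>, yet its slope decays like \<open>e / r\<close>; it
  tends to 1 as \<open>e\<close> tends to 0.\<close>

definition cutoff :: "real \<Rightarrow> real \<Rightarrow> real" where
  "cutoff e r = max 0 (1 - e * ln (1 + e * r))"

lemma clamp_le: "0 \<le> b \<Longrightarrow> \<bar>clamp b x\<bar> \<le> b"
  by (auto simp: clamp_def)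

lemma clamp_lipschitz: "\<bar>b - b'\<bar> \<le> d \<Longrightarrow> \<bar>x - x'\<bar> \<le> d \<Longrightarrow> \<bar>clamp b x - clamp b' x'\<bar> \<le> d"
  unfolding clamp_def by linarith

lemma clamp_dist: "0 \<le> b \<Longrightarrow> \<bar>x - clamp b x\<bar> = max 0 (\<bar>x\<bar> - b)"
  unfolding clamp_def by linarith

lemma cutoff_nonneg: "0 \<le> cutoff e r"
  by (simp add: cutoff_def)

lemma cutoff_le_1: "0 \<le> e \<Longrightarrow> 0 \<le> r \<Longrightarrow> cutoff e r \<le> 1"
  by (simp add: cutoff_def)

text \<open>Where the cutoff is positive, \<open>r + 1 / e = (1 + e * r) / e\<close> is still below
  \<open>exp (1 / e) / e\<close>. This makes the cut-off loss bounded.\<close>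

lemma cutoff_mult_le:
  assumes e: "0 < e" and r: "0 \<le> r"
  shows "cutoff e r * (r + 1 / e) \<le> exp (1 / e) / e"
proof (cases "1 + e * r \<le> exp (1 / e)")
  case True
  have "cutoff e r * (r + 1 / e) \<le> 1 * (r + 1 / e)"
    using e r cutoff_le_1[of e r] by (intro mult_right_mono) auto
  also have "\<dots> = (1 + e * r) / e" using e by (simp add: field_simps)
  also have "\<dots> \<le> exp (1 / e) / e" using True e by (intro divide_right_mono) auto
  finally show ?thesis .
next
  case False
  then have "1 / e \<le> ln (1 + e * r)"
    using e r by (subst ln_ge_iff) (auto intro: add_pos_nonneg)
  then have "e * (1 / e) \<le> e * ln (1 + e * r)"
    using e by (intro mult_left_mono) auto
  then show ?thesis using e by (simp add: cutoff_def)
qed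

text \<open>The derivative of the cutoff is at most \<open>e\<^sup>2 / (1 + e r)\<close>, which compensates the bound
  \<open>r + 1 / e\<close> on the clamped value up to a factor \<open>e\<close>.\<close>

lemma cutoff_clamp_lipschitz:
  assumes e: "0 < e" and r: "0 \<le> r" "0 \<le> r'" and d: "\<bar>r - r'\<bar> \<le> d" "\<bar>x - x'\<bar> \<le> d"
  shows "\<bar>cutoff e r * clamp (r + 1 / e) x - cutoff e r' * clamp (r' + 1 / e) x'\<bar> \<le> (1 + e) * d"
proof -
  \<comment> \<open>It suffices to treat \<open>r \<le> r'\<close>: the difference of the cutoffs is
    then paired with the value clamped at the smaller radius, which matches the slope bound taken at
    \<open>r\<close>.\<close>
  have main: "\<bar>cutoff e r * clamp (r + 1 / e) x - cutoff e r' * clamp (r' + 1 / e) x'\<bar> \<le> (1 + e) * d"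
    if r: "0 \<le> r" "r \<le> r'" and d: "\<bar>r - r'\<bar> \<le> d" "\<bar>x - x'\<bar> \<le> d" for r r' x x'
  proof -
    let ?u = "clamp (r + 1 / e) x" and ?u' = "clamp (r' + 1 / e) x'"
    have pos: "0 < 1 + e * r" "0 < 1 + e * r'" "e * r \<le> e * r'"
      using e r by (auto intro: add_pos_nonneg)
    have "ln (1 + e * r') - ln (1 + e * r) = ln ((1 + e * r') / (1 + e * r))"
      using pos by (simp add: ln_div)
    also have "\<dots> \<le> (1 + e * r') / (1 + e * r) - 1"
      using pos by (intro ln_le_minus_one) simp
    also have "\<dots> = e * (r' - r) / (1 + e * r)"
      using pos by (simp add: field_simps)
    finally have "e * (ln (1 + e * r') - ln (1 + e * r)) \<le> e * (e * (r' - r) / (1 + e * r))"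
      using e by (intro mult_left_mono) auto
    moreover have "ln (1 + e * r) \<le> ln (1 + e * r')"
      using pos by simp
    then have "e * ln (1 + e * r) \<le> e * ln (1 + e * r')"
      using e by simp
    ultimately have dc: "\<bar>cutoff e r - cutoff e r'\<bar> \<le> e * (e * (r' - r) / (1 + e * r))"
      unfolding cutoff_def by (simp add: right_diff_distrib)
    have "\<bar>cutoff e r * ?u - cutoff e r' * ?u'\<bar> = \<bar>(cutoff e r - cutoff e r') * ?u + cutoff e r' * (?u - ?u')\<bar>"
      by (simp add: algebra_simps)
    also have "\<dots> \<le> \<bar>cutoff e r - cutoff e r'\<bar> * \<bar>?u\<bar> + cutoff e r' * \<bar>?u - ?u'\<bar>"
      using cutoff_nonneg[of e r'] by (intro order_trans[OF abs_triangle_ineq]) (simp add: abs_mult)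
    also have "\<dots> \<le> (e * (e * (r' - r) / (1 + e * r))) * (r + 1 / e) + 1 * d"
      using dc clamp_le[of "r + 1 / e" x] clamp_lipschitz[of "r + 1 / e" "r' + 1 / e" d x x'] d r e
        cutoff_nonneg[of e r'] cutoff_le_1[of e r']
      by (intro add_mono mult_mono) auto
    also have "(e * (e * (r' - r) / (1 + e * r))) * (r + 1 / e) = e * (r' - r)"
    proof -
      have "r + 1 / e = (1 + e * r) / e" using e by (simp add: field_simps)
      moreover define q where "q = 1 + e * r"
      ultimately show ?thesis using pos e by simp
    qed
    also have "e * (r' - r) + 1 * d \<le> (1 + e) * d"
    proof -
      have "e * (r' - r) \<le> e * d" using d e by (intro mult_left_mono) auto
      then show ?thesis by (simp add: algebra_simps)
    qed
    finally show ?thesis .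
  qed
  show ?thesis
  proof (cases "r \<le> r'")
    case True
    then show ?thesis using main assms by blast
  next
    case False
    then show ?thesis
      using main[of r' r x' x] assms by (simp add: abs_minus_commute)
  qed
qed

lemma cutoff_tendsto_1:
  assumes "0 \<le> r"
  shows "(\<lambda>k. cutoff (1 / real (Suc k)) r) \<longlonglongrightarrow> 1"
proof -
  have e: "(\<lambda>k. 1 / real (Suc k)) \<longlonglongrightarrow> 0"
    using LIMSEQ_inverse_real_of_nat by (simp add: inverse_eq_divide)
  have "(\<lambda>k. max 0 (1 - 1 / real (Suc k) * ln (1 + 1 / real (Suc k) * r))) \<longlonglongrightarrow> max 0 (1 - 0 * ln (1 + 0 * r))"
    by (intro tendsto_intros e) simp
  then show ?thesis by (simp add: cutoff_def)
qed

subsection \<open>Averaging over the leaves\<close>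

text \<open>Every node of depth \<open>l\<close> has \<open>Nprod n m / Nprod n l\<close>
  descendants at depth \<open>m\<close>; this produces the weights of the final bound.\<close>

lemma (in hierarchy) sum_nodes_take:
  fixes g :: "nat list \<Rightarrow> ennreal"
  assumes "l \<le> m" "m \<le> L"
  shows "(\<Sum>v\<in>nodes n m. g (take l v)) = ennreal (real (Nprod n m) / real (Nprod n l)) * (\<Sum>u\<in>nodes n l. g u)"
  using assms
proof (induction m rule: dec_induct)
  case base
  then show ?case
    using Nprod_pos[of l] by (simp add: length_nodes cong: sum.cong)
next
  case (step m)
  have "(\<Sum>v\<in>nodes n (Suc m). g (take l v)) = (\<Sum>p\<in>nodes n m. of_nat (n (Suc m)) * g (take l p))"
    unfolding sum_nodes_Suc
  proof (rule sum.cong[OF refl])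
    fix p assume "p \<in> nodes n m"
    then have "length p = m" by (rule length_nodes)
    then show "(\<Sum>k<n (Suc m). g (take l (p @ [k]))) = of_nat (n (Suc m)) * g (take l p)"
      using step.hyps by simp
  qed
  also have "\<dots> = ennreal (real (n (Suc m))) * (ennreal (real (Nprod n m) / real (Nprod n l)) * (\<Sum>u\<in>nodes n l. g u))"
    using step.IH step.prems by (simp add: sum_distrib_left[symmetric] ennreal_of_nat_eq_real_of_nat)
  also have "\<dots> = ennreal (real (Nprod n (Suc m)) / real (Nprod n l)) * (\<Sum>u\<in>nodes n l. g u)"
    unfolding mult.assoc[symmetric] by (subst ennreal_mult[symmetric]) (auto simp: Nprod_Suc mult.commute)
  finally show ?case .
qed

context learning
begin

definition total_cost :: ennreal where
  "total_cost = (\<Sum>l\<in>{1..L}. ennreal (1 / real (Nprod n l)) * (\<Sum>v\<in>nodes n l. wcost v))"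

lemma sum_leaf_cost:
  "(\<Sum>v\<in>nodes n L. \<Sum>l\<in>{1..L}. wcost (take l v)) = ennreal (real (Nprod n L)) * total_cost"
proof -
  have "(\<Sum>v\<in>nodes n L. \<Sum>l\<in>{1..L}. wcost (take l v)) = (\<Sum>l\<in>{1..L}. \<Sum>v\<in>nodes n L. wcost (take l v))"
    by (rule sum.swap)
  also have "\<dots> = (\<Sum>l\<in>{1..L}. ennreal (real (Nprod n L)) * (ennreal (1 / real (Nprod n l)) * (\<Sum>v\<in>nodes n l. wcost v)))"
  proof (rule sum.cong[OF refl])
    fix l assume "l \<in> {1..L}"
    then have "(\<Sum>v\<in>nodes n L. wcost (take l v)) = ennreal (real (Nprod n L) * (1 / real (Nprod n l))) * (\<Sum>u\<in>nodes n l. wcost u)"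
      using sum_nodes_take[of l L wcost] by simp
    then show "(\<Sum>v\<in>nodes n L. wcost (take l v)) =
        ennreal (real (Nprod n L)) * (ennreal (1 / real (Nprod n l)) * (\<Sum>v\<in>nodes n l. wcost v))"
      by (subst (asm) ennreal_mult) (auto simp: mult.assoc)
  qed
  also have "\<dots> = ennreal (real (Nprod n L)) * total_cost"
    by (simp add: total_cost_def sum_distrib_left)
  finally show ?thesis .
qed

lemma leaf_cost_finite:
  assumes fin: "ennreal c * total_cost < \<top>" and v: "v \<in> nodes n L"
  shows "ennreal c * (\<Sum>l\<in>{1..L}. wcost (take l v)) < \<top>"
proof -
  have "ennreal c * (\<Sum>l\<in>{1..L}. wcost (take l v)) \<le> ennreal c * (\<Sum>v\<in>nodes n L. \<Sum>l\<in>{1..L}. wcost (take l v))"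
    using v by (intro mult_left_mono member_le_sum) auto
  also have "\<dots> = ennreal (real (Nprod n L)) * (ennreal c * total_cost)"
    unfolding sum_leaf_cost by (rule mult.left_commute)
  also have "\<dots> < \<top>"
    using fin by (simp add: ennreal_mult_less_top)
  finally show ?thesis .
qed

lemma leaf_cost_finite_mult:
  assumes fin: "ennreal c * total_cost < \<top>" and v: "v \<in> nodes n L" and "0 \<le> a" "0 \<le> c"
  shows "ennreal (a * c) * (\<Sum>l\<in>{1..L}. wcost (take l v)) < \<top>"
  using leaf_cost_finite[OF fin v] assms(3,4)
  by (simp add: ennreal_mult mult.assoc ennreal_mult_less_top[of "ennreal a"])

lemma measurable_J_leaf:
  assumes "v \<in> nodes n L"
  shows "(\<lambda>p. sel (fst p v)) \<in> J \<rightarrow>\<^sub>M X L"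
proof -
  have "(\<lambda>\<omega>. sel (\<omega> v)) \<in> S L \<rightarrow>\<^sub>M X L"
    using measurable_compose[OF measurable_node[OF L order_refl assms] measurable_sel_Xn] length_nodes[OF assms] by simp
  from measurable_compose[OF measurable_fst this] show ?thesis
    by (simp cong: measurable_cong_sets add: sets_J)
qed

lemma measurable_J_snd [measurable]: "snd \<in> J \<rightarrow>\<^sub>M MW"
  by (simp cong: measurable_cong_sets add: sets_J)

lemma leaf_in_space: "v \<in> nodes n L \<Longrightarrow> p \<in> space J \<Longrightarrow> sel (fst p v) \<in> space (X L)"
  using measurable_space[OF measurable_J_leaf] .

lemma sel_tree_leaf: "v \<in> nodes n L \<Longrightarrow> sel_tree n L \<omega> v = sel (\<omega> v)"
  using nodes_subset_upto[of L L n] L by (auto simp: sel_tree_def)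

abbreviation "DL \<equiv> level_law D \<kappa> L"

lemma sets_DL [measurable_cong]: "sets DL = sets (X L)"
  using level_law_in_prob_algebra[of L] L by (simp add: space_prob_algebra)

lemma space_DL: "space DL = space (X L)"
  using sets_eq_imp_space_eq[OF sets_DL] .

sublocale DL: prob_space DL
  using level_law_in_prob_algebra[of L] L by (simp add: space_prob_algebra)

text \<open>A function that ignores the hypothesis is Lipschitz with constant 0, so the transfer
  holds with no error in either direction, even for infinite cost since
  \<open>0 * \<top> = 0\<close>.\<close>

lemma nn_integral_leaf:
  fixes f :: "'x \<Rightarrow> ennreal"
  assumes v: "v \<in> nodes n L" and f[measurable]: "f \<in> borel_measurable (X L)"
  shows "(\<integral>\<^sup>+p. f (sel (fst p v)) \<partial>J) = integral\<^sup>N DL f"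
proof -
  have "(\<lambda>p. (\<lambda>w z. f z) (fst p) (snd p)) \<in> borel_measurable (MW \<Otimes>\<^sub>M X L)" by measurable
  from fresh_leaf_transfer[OF v this, of 0] show ?thesis
    by (intro antisym) (simp_all add: J.emeasure_space_1)
qed

end

text \<open>The cost may be assumed finite because the bound is trivial otherwise; \<open>w0\<close>
  is an arbitrary reference hypothesis.\<close>

locale lipschitz_learning = learning L n X D \<kappa> MW K Q1 Q2
  for L :: nat and n :: "nat \<Rightarrow> nat" and X :: "nat \<Rightarrow> 'x measure" and D :: "'x measure"
    and \<kappa> :: "nat \<Rightarrow> 'x \<Rightarrow> 'x measure" and MW :: "'w::metric_space measure"
    and K :: "(nat list \<Rightarrow> 'x) \<Rightarrow> 'w measure"
    and Q1 :: "nat list \<Rightarrow> ('x \<times> 'x) \<times> bool \<Rightarrow> 'w measure"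
    and Q2 :: "nat list \<Rightarrow> 'x \<times> 'x \<Rightarrow> 'w measure" +
  fixes loss :: "'w \<Rightarrow> 'x \<Rightarrow> real" and lam :: real and w0 :: 'w
  assumes loss_meas: "(\<lambda>p. loss (fst p) (snd p)) \<in> borel_measurable (MW \<Otimes>\<^sub>M X L)"
    and lam: "0 \<le> lam"
    and lip: "\<And>w w' z. w \<in> space MW \<Longrightarrow> w' \<in> space MW \<Longrightarrow> z \<in> space (X L) \<Longrightarrow>
                \<bar>loss w z - loss w' z\<bar> \<le> lam * dist w w'"
    and finite_cost: "ennreal (2 * lam) * total_cost < \<top>"
    and w0: "w0 \<in> space MW"
begin

lemma measurable_loss [measurable (raw)]:
  "f \<in> N \<rightarrow>\<^sub>M MW \<Longrightarrow> g \<in> N \<rightarrow>\<^sub>M X L \<Longrightarrow> (\<lambda>p. loss (f p) (g p)) \<in> borel_measurable N"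
  using measurable_compose[OF measurable_Pair loss_meas] by simp

subsection \<open>A measurable envelope of the loss\<close>

definition dev :: "'w \<Rightarrow> 'x \<Rightarrow> real" where
  "dev w z = \<bar>loss w z - loss w0 z\<bar>"

text \<open>The essential supremum over a fresh leaf replaces the distance to \<open>w0\<close>, which need not be
  measurable.\<close>

definition env :: "'w \<Rightarrow> real" where
  "env w = Inf {c. 0 \<le> c \<and> (AE z in DL. dev w z \<le> c)}"

lemma measurable_dev [measurable (raw)]:
  assumes [measurable]: "f \<in> N \<rightarrow>\<^sub>M MW" "g \<in> N \<rightarrow>\<^sub>M X L"
  shows "(\<lambda>p. dev (f p) (g p)) \<in> borel_measurable N"
proof -
  note w0[measurable]
  show ?thesis unfolding dev_def by measurable
qed

lemma dev_lipschitz: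
  "w \<in> space MW \<Longrightarrow> w' \<in> space MW \<Longrightarrow> z \<in> space (X L) \<Longrightarrow> dev w z \<le> dev w' z + lam * dist w w'"
  using lip[of w w' z] unfolding dev_def by linarith

lemma dev_le_dist: "w \<in> space MW \<Longrightarrow> AE z in DL. dev w z \<le> lam * dist w w0"
  using lip[of w w0] w0 by (intro AE_I2) (auto simp: dev_def space_DL)

lemma env_le: "0 \<le> c \<Longrightarrow> AE z in DL. dev w z \<le> c \<Longrightarrow> env w \<le> c"
  unfolding env_def by (rule cInf_lower) (auto intro!: bdd_belowI[of _ 0])

lemma env_set_nonempty: "w \<in> space MW \<Longrightarrow> {c. 0 \<le> c \<and> (AE z in DL. dev w z \<le> c)} \<noteq> {}"
  using dev_le_dist[of w] lam by (auto intro!: exI[of _ "lam * dist w w0"])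

lemma env_nonneg: "w \<in> space MW \<Longrightarrow> 0 \<le> env w"
  unfolding env_def using env_set_nonempty by (intro cInf_greatest) auto

text \<open>The infimum is attained: the exceptional sets for the bounds
  \<open>env w + 1 / real (Suc k)\<close> are countably many null sets.\<close>

lemma AE_dev_le_env:
  assumes w: "w \<in> space MW"
  shows "AE z in DL. dev w z \<le> env w"
proof -
  have "AE z in DL. dev w z \<le> env w + 1 / real (Suc k)" for k
  proof -
    have "env w < env w + 1 / real (Suc k)" by simp
    then obtain c where c: "AE z in DL. dev w z \<le> c" "c < env w + 1 / real (Suc k)"
      using cInf_lessD[OF env_set_nonempty[OF w]] unfolding env_def by blast
    from c(1) show ?thesis
      by eventually_elim (use c(2) in auto)
  qed
  then have "AE z in DL. \<forall>k. dev w z \<le> env w + 1 / real (Suc k)"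
    by (simp add: AE_all_countable)
  then show ?thesis
  proof eventually_elim
    case (elim z)
    have "(\<lambda>k. env w + 1 / real (Suc k)) \<longlonglongrightarrow> env w + 0"
      using LIMSEQ_inverse_real_of_nat by (intro tendsto_intros) (simp add: inverse_eq_divide)
    then show ?case
      using LIMSEQ_le_const[of _ "env w" "dev w z"] elim by auto
  qed
qed

lemma env_lipschitz_le:
  assumes "w \<in> space MW" "w' \<in> space MW"
  shows "env w \<le> env w' + lam * dist w w'"
proof (rule env_le)
  show "0 \<le> env w' + lam * dist w w'"
    using env_nonneg[OF assms(2)] lam by simp
  have "AE z in DL. z \<in> space (X L)"
    by (intro AE_I2) (simp add: space_DL)
  with AE_dev_le_env[OF assms(2)] show "AE z in DL. dev w z \<le> env w' + lam * dist w w'"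
    by eventually_elim (use dev_lipschitz[OF assms] in force)
qed

lemma env_lipschitz:
  assumes "w \<in> space MW" "w' \<in> space MW"
  shows "\<bar>env w - env w'\<bar> \<le> lam * dist w w'"
  using env_lipschitz_le[OF assms] env_lipschitz_le[OF assms(2,1)] by (simp add: dist_commute abs_le_iff)

text \<open>For \<open>a \<ge> 0\<close> the sublevel set at \<open>a\<close> is the zero set of the
  integral of the positive part of \<open>dev w z - a\<close>, which is measurable in
  \<open>w\<close>.\<close>

lemma measurable_env [measurable]: "env \<in> borel_measurable MW"
  unfolding borel_measurable_iff_le
proof
  fix a :: real
  show "{w \<in> space MW. env w \<le> a} \<in> sets MW"
  proof (cases "0 \<le> a")
    case False
    then have "{w \<in> space MW. env w \<le> a} = {}" using env_nonneg by force
    then show ?thesis by (metis sets.empty_sets)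
  next
    case True
    have "env w \<le> a \<longleftrightarrow> (\<integral>\<^sup>+z. ennreal (dev w z - a) \<partial>DL) = 0" if w[measurable]: "w \<in> space MW" for w
    proof -
      have "env w \<le> a \<longleftrightarrow> (AE z in DL. dev w z \<le> a)"
        using env_le[OF True] AE_dev_le_env[OF w] by (auto elim: eventually_mono)
      also have "\<dots> \<longleftrightarrow> (AE z in DL. ennreal (dev w z - a) = 0)"
        by (simp add: ennreal_eq_0_iff)
      also have "\<dots> \<longleftrightarrow> (\<integral>\<^sup>+z. ennreal (dev w z - a) \<partial>DL) = 0"
        by (subst nn_integral_0_iff_AE) auto
      finally show ?thesis .
    qed
    then have "{w \<in> space MW. env w \<le> a} = {w \<in> space MW. (\<integral>\<^sup>+z. ennreal (dev w z - a) \<partial>DL) = 0}"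
      by auto
    also have "\<dots> \<in> sets MW" by measurable
    finally show ?thesis .
  qed
qed

text \<open>The overshoot \<open>exc\<close> vanishes for a fresh leaf, so transferring it to a training leaf shows that it is
  integrable there, although the training leaf depends on the hypothesis.\<close>

definition exc :: "'w \<Rightarrow> 'x \<Rightarrow> real" where
  "exc w z = max 0 (dev w z - env w)"

lemma measurable_exc [measurable (raw)]:
  assumes [measurable]: "f \<in> N \<rightarrow>\<^sub>M MW" "g \<in> N \<rightarrow>\<^sub>M X L"
  shows "(\<lambda>p. exc (f p) (g p)) \<in> borel_measurable N"
  unfolding exc_def by measurable

text \<open>The factor \<open>a\<close> measures the Lipschitz constant in units of
  \<open>lam\<close>; it will be 2 for the overshoot, \<open>1 + e\<close> for the cut-off loss and
  the number of leaves in the non-integrable case.\<close>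

lemma transfer_real:
  fixes \<phi> :: "'w \<Rightarrow> 'x \<Rightarrow> real"
  assumes v: "v \<in> nodes n L"
    and \<phi>: "(\<lambda>p. \<phi> (fst p) (snd p)) \<in> borel_measurable (MW \<Otimes>\<^sub>M X L)"
    and a: "0 \<le> a"
    and nn: "\<And>w z. w \<in> space MW \<Longrightarrow> z \<in> space (X L) \<Longrightarrow> 0 \<le> \<phi> w z"
    and \<phi>_lip: "\<And>w w' z. w \<in> space MW \<Longrightarrow> w' \<in> space MW \<Longrightarrow> z \<in> space (X L) \<Longrightarrow>
      \<phi> w z \<le> \<phi> w' z + a * (lam * dist w w')"
  shows "(\<integral>\<^sup>+p. \<integral>\<^sup>+z. ennreal (\<phi> (snd p) z) \<partial>DL \<partial>J) \<le>
      (\<integral>\<^sup>+p. ennreal (\<phi> (snd p) (sel (fst p v))) \<partial>J) + ennreal (a * (2 * lam)) * (\<Sum>l\<in>{1..L}. wcost (take l v))" (is ?A)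
    and "(\<integral>\<^sup>+p. ennreal (\<phi> (snd p) (sel (fst p v))) \<partial>J) \<le>
      (\<integral>\<^sup>+p. \<integral>\<^sup>+z. ennreal (\<phi> (snd p) z) \<partial>DL \<partial>J) + ennreal (a * (2 * lam)) * (\<Sum>l\<in>{1..L}. wcost (take l v))" (is ?B)
proof -
  have m: "(\<lambda>p. ennreal (\<phi> (fst p) (snd p))) \<in> borel_measurable (MW \<Otimes>\<^sub>M X L)"
    using \<phi> by measurable
  have e: "ennreal (\<phi> w z) \<le> ennreal (\<phi> w' z) + ennreal (a * lam * dist w w')"
    if "w \<in> space MW" "w' \<in> space MW" "z \<in> space (X L)" for w w' z
  proof -
    have "ennreal (\<phi> w z) \<le> ennreal (\<phi> w' z + a * lam * dist w w')"
      using \<phi>_lip[OF that] by (intro ennreal_leI) (simp add: mult.assoc)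
    also have "\<dots> = ennreal (\<phi> w' z) + ennreal (a * lam * dist w w')"
      using nn[OF that(2,3)] a lam by (intro ennreal_plus) auto
    finally show ?thesis .
  qed
  have "0 \<le> a * lam" using a lam by simp
  note t = fresh_leaf_transfer[OF v m e this]
  have eq: "2 * (a * lam) = a * (2 * lam)" by simp
  show ?A ?B using t unfolding eq by auto
qed

lemma exc_integrable:
  assumes v: "v \<in> nodes n L"
  shows "integrable J (\<lambda>p. exc (snd p) (sel (fst p v)))"
proof (rule integrableI_nonneg)
  note [measurable] = measurable_J_leaf[OF v]
  show "(\<lambda>p. exc (snd p) (sel (fst p v))) \<in> borel_measurable J" by measurable
  show "AE p in J. 0 \<le> exc (snd p) (sel (fst p v))" by (simp add: exc_def)
  have "(\<integral>\<^sup>+p. ennreal (exc (snd p) (sel (fst p v))) \<partial>J) \<le>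
      (\<integral>\<^sup>+p. \<integral>\<^sup>+z. ennreal (exc (snd p) z) \<partial>DL \<partial>J) + ennreal (2 * (2 * lam)) * (\<Sum>l\<in>{1..L}. wcost (take l v))"
  proof (rule transfer_real(2)[OF v])
    \<comment> \<open>One multiple of \<open>lam\<close> comes from \<open>dev\<close>, the other
      from \<open>env\<close>.\<close>
    show "exc w z \<le> exc w' z + 2 * (lam * dist w w')"
      if "w \<in> space MW" "w' \<in> space MW" "z \<in> space (X L)" for w w' z
      using dev_lipschitz[OF that] env_lipschitz_le[OF that(2,1)] lam unfolding exc_def
      by (simp add: dist_commute max_def)
  qed (auto simp: exc_def)
  also have "(\<integral>\<^sup>+p. \<integral>\<^sup>+z. ennreal (exc (snd p) z) \<partial>DL \<partial>J) = (\<integral>\<^sup>+p. 0 \<partial>J)"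
  proof (rule nn_integral_cong)
    fix p assume "p \<in> space J"
    then have w[measurable]: "snd p \<in> space MW" by (auto simp: space_J)
    have "AE z in DL. ennreal (exc (snd p) z) = 0"
      using AE_dev_le_env[OF w] by eventually_elim (simp add: exc_def)
    then show "(\<integral>\<^sup>+z. ennreal (exc (snd p) z) \<partial>DL) = 0"
      by (subst nn_integral_0_iff_AE) auto
  qed
  finally show "(\<integral>\<^sup>+p. ennreal (exc (snd p) (sel (fst p v))) \<partial>J) < \<infinity>"
    using leaf_cost_finite_mult[OF finite_cost v, of 2] lam by (auto intro: le_less_trans)
qed

lemma dev_le: "dev w z \<le> env w + exc w z"
  unfolding exc_def by simp

subsection \<open>The case of an integrable loss\<close>

definition risk_gap :: "('w \<Rightarrow> 'x \<Rightarrow> real) \<Rightarrow> (nat list \<Rightarrow> ('x \<times> 'x) \<times> bool) \<times> 'w \<Rightarrow> real" where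
  "risk_gap \<phi> p = (\<integral>z. \<phi> (snd p) z \<partial>DL) - (1 / real (Nprod n L)) * (\<Sum>v\<in>nodes n L. \<phi> (snd p) (sel (fst p v)))"

lemma gen_eq: "gen n X D \<kappa> L MW K loss = (\<integral>p. risk_gap loss p \<partial>J)"
  unfolding gen_def risk_gap_def pop_risk_def emp_risk_def by (simp add: sel_tree_leaf)

text \<open>Adding the bound \<open>b\<close> makes the loss nonnegative, as the transfer requires;
  it cancels again because all laws have mass 1. The inequalities for the single leaves are then
  averaged.\<close>

lemma integral_risk_gap_le:
  assumes \<phi>: "(\<lambda>p. \<phi> (fst p) (snd p)) \<in> borel_measurable (MW \<Otimes>\<^sub>M X L)"
    and a: "0 \<le> a"
    and bdd: "\<And>w z. w \<in> space MW \<Longrightarrow> z \<in> space (X L) \<Longrightarrow> \<bar>\<phi> w z\<bar> \<le> b"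
    and \<phi>_lip: "\<And>w w' z. w \<in> space MW \<Longrightarrow> w' \<in> space MW \<Longrightarrow> z \<in> space (X L) \<Longrightarrow>
      \<phi> w z \<le> \<phi> w' z + a * (lam * dist w w')"
  shows "integrable J (risk_gap \<phi>)"
    and "(\<integral>p. risk_gap \<phi> p \<partial>J) \<le> a * enn2real (ennreal (2 * lam) * total_cost)"
proof -
  let ?N = "real (Nprod n L)"
  have N: "?N \<ge> 1" using Nprod_pos[of L] by simp
  obtain w z where "w \<in> space MW" "z \<in> space (X L)"
    using w0 DL.not_empty space_DL by auto
  then have b: "0 \<le> b" using bdd[of w z] by simp
  have leaf_m: "(\<lambda>p. \<phi> (snd p) (sel (fst p v))) \<in> borel_measurable J" if "v \<in> nodes n L" for v
    using measurable_compose[OF measurable_Pair[OF measurable_J_snd measurable_J_leaf[OF that]] \<phi>] by simp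
  have pop_m: "(\<lambda>p. \<integral>z. \<phi> (snd p) z \<partial>DL) \<in> borel_measurable J"
  proof (rule DL.borel_measurable_lebesgue_integral)
    have "(\<lambda>q. (snd (fst q), snd q)) \<in> J \<Otimes>\<^sub>M DL \<rightarrow>\<^sub>M MW \<Otimes>\<^sub>M X L" by measurable
    from measurable_compose[OF this \<phi>] show "(\<lambda>(p, z). \<phi> (snd p) z) \<in> borel_measurable (J \<Otimes>\<^sub>M DL)"
      by (simp add: split_beta')
  qed
  have pJ: "snd p \<in> space MW" if "p \<in> space J" for p using that by (auto simp: space_J)
  have sec: "integrable DL (\<phi> w)" if w: "w \<in> space MW" for w
  proof (rule DL.integrable_const_bound[where B=b])
    show "\<phi> w \<in> borel_measurable DL"
      using measurable_section[OF \<phi> w] by (simp cong: measurable_cong_sets add: sets_DL)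
  qed (use bdd[OF w] space_DL in \<open>auto intro!: AE_I2\<close>)
  have pop_b: "\<bar>\<integral>z. \<phi> w z \<partial>DL\<bar> \<le> b" if w: "w \<in> space MW" for w
  proof -
    have "- b \<le> \<phi> w z" "\<phi> w z \<le> b" if "z \<in> space (X L)" for z
      using bdd[OF w that] by (simp_all add: abs_le_iff)
    then have "AE z in DL. - b \<le> \<phi> w z" "AE z in DL. \<phi> w z \<le> b"
      by (auto intro!: AE_I2 simp: space_DL)
    with DL.integral_le_const[OF sec[OF w], of b] DL.integral_ge_const[OF sec[OF w], of "- b"]
    show ?thesis by linarith
  qed
  have sh: "0 \<le> \<phi> w z + b" if "w \<in> space MW" "z \<in> space (X L)" for w z
    using bdd[OF that] by linarith
  have sh_pop: "0 \<le> (\<integral>z. \<phi> w z \<partial>DL) + b" if "w \<in> space MW" for w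
    using pop_b[OF that] by linarith
  have pop_i: "integrable J (\<lambda>p. \<integral>z. \<phi> (snd p) z \<partial>DL)"
    using pop_m pop_b pJ by (intro J.integrable_const_bound[where B=b]) (auto intro!: AE_I2)
  have leaf_i: "integrable J (\<lambda>p. \<phi> (snd p) (sel (fst p v)))" if "v \<in> nodes n L" for v
    using leaf_m[OF that] bdd pJ leaf_in_space[OF that]
    by (intro J.integrable_const_bound[where B=b]) (auto intro!: AE_I2)
  show "integrable J (risk_gap \<phi>)"
    unfolding risk_gap_def[abs_def] using pop_i leaf_i by auto
  have each: "(\<integral>p. (\<integral>z. \<phi> (snd p) z \<partial>DL) \<partial>J) \<le> (\<integral>p. \<phi> (snd p) (sel (fst p v)) \<partial>J) +
      a * enn2real (ennreal (2 * lam) * (\<Sum>l\<in>{1..L}. wcost (take l v)))" if v: "v \<in> nodes n L" for v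
  proof -
    let ?c = "ennreal (2 * lam) * (\<Sum>l\<in>{1..L}. wcost (take l v))"
    have c: "?c < \<top>" using leaf_cost_finite[OF finite_cost v] .
    have "(\<integral>\<^sup>+p. \<integral>\<^sup>+z. ennreal (\<phi> (snd p) z + b) \<partial>DL \<partial>J) \<le>
      (\<integral>\<^sup>+p. ennreal (\<phi> (snd p) (sel (fst p v)) + b) \<partial>J) + ennreal (a * (2 * lam)) * (\<Sum>l\<in>{1..L}. wcost (take l v))"
    proof (rule transfer_real(1)[OF v _ a])
      show "(\<lambda>p. \<phi> (fst p) (snd p) + b) \<in> borel_measurable (MW \<Otimes>\<^sub>M X L)" using \<phi> by simp
      show "0 \<le> \<phi> w z + b" if "w \<in> space MW" "z \<in> space (X L)" for w z
        using sh[OF that] .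
      show "\<phi> w z + b \<le> \<phi> w' z + b + a * (lam * dist w w')"
        if "w \<in> space MW" "w' \<in> space MW" "z \<in> space (X L)" for w w' z
        using \<phi>_lip[OF that] by simp
    qed
    also have "(\<integral>\<^sup>+p. \<integral>\<^sup>+z. ennreal (\<phi> (snd p) z + b) \<partial>DL \<partial>J) = (\<integral>\<^sup>+p. ennreal ((\<integral>z. \<phi> (snd p) z \<partial>DL) + b) \<partial>J)"
    proof (rule nn_integral_cong)
      fix p assume "p \<in> space J"
      then have w: "snd p \<in> space MW" by (rule pJ)
      have "(\<integral>\<^sup>+z. ennreal (\<phi> (snd p) z + b) \<partial>DL) = ennreal (\<integral>z. \<phi> (snd p) z + b \<partial>DL)"
        using sec[OF w] sh[OF w] by (intro nn_integral_eq_integral) (auto intro!: AE_I2 simp: space_DL)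
      then show "(\<integral>\<^sup>+z. ennreal (\<phi> (snd p) z + b) \<partial>DL) = ennreal ((\<integral>z. \<phi> (snd p) z \<partial>DL) + b)"
        using sec[OF w] by (simp add: DL.prob_space)
    qed
    also have "\<dots> = ennreal (\<integral>p. (\<integral>z. \<phi> (snd p) z \<partial>DL) + b \<partial>J)"
      using pop_i sh_pop pJ by (intro nn_integral_eq_integral) (auto intro!: AE_I2)
    also have "(\<integral>\<^sup>+p. ennreal (\<phi> (snd p) (sel (fst p v)) + b) \<partial>J) = ennreal (\<integral>p. \<phi> (snd p) (sel (fst p v)) + b \<partial>J)"
      using leaf_i[OF v] sh pJ leaf_in_space[OF v] by (intro nn_integral_eq_integral) (auto intro!: AE_I2)
    also have "ennreal (a * (2 * lam)) * (\<Sum>l\<in>{1..L}. wcost (take l v)) = ennreal (a * enn2real ?c)"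
      using a lam c by (simp add: ennreal_mult mult.assoc)
    also have "ennreal (\<integral>p. \<phi> (snd p) (sel (fst p v)) + b \<partial>J) + ennreal (a * enn2real ?c) =
        ennreal ((\<integral>p. \<phi> (snd p) (sel (fst p v)) + b \<partial>J) + a * enn2real ?c)"
      using a sh pJ leaf_in_space[OF v]
      by (intro ennreal_plus[symmetric] integral_nonneg_AE) (auto intro!: AE_I2)
    finally have "(\<integral>p. (\<integral>z. \<phi> (snd p) z \<partial>DL) + b \<partial>J) \<le> (\<integral>p. \<phi> (snd p) (sel (fst p v)) + b \<partial>J) + a * enn2real ?c"
    proof (subst (asm) ennreal_le_iff)
      show "0 \<le> (\<integral>p. \<phi> (snd p) (sel (fst p v)) + b \<partial>J) + a * enn2real ?c"
        using a sh pJ leaf_in_space[OF v]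
        by (intro add_nonneg_nonneg integral_nonneg_AE) (auto intro!: AE_I2)
    qed
    then show ?thesis
      using pop_i leaf_i[OF v] by (simp add: J.prob_space)
  qed
  have "?N * (\<integral>p. risk_gap \<phi> p \<partial>J) = (\<Sum>v\<in>nodes n L. (\<integral>p. (\<integral>z. \<phi> (snd p) z \<partial>DL) \<partial>J) - (\<integral>p. \<phi> (snd p) (sel (fst p v)) \<partial>J))"
    using pop_i leaf_i N unfolding risk_gap_def
    by (simp add: sum_subtractf card_nodes right_diff_distrib)
  also have "\<dots> \<le> (\<Sum>v\<in>nodes n L. a * enn2real (ennreal (2 * lam) * (\<Sum>l\<in>{1..L}. wcost (take l v))))"
    using each by (intro sum_mono) (simp add: algebra_simps)
  also have "\<dots> = a * enn2real (\<Sum>v\<in>nodes n L. ennreal (2 * lam) * (\<Sum>l\<in>{1..L}. wcost (take l v)))"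
    using leaf_cost_finite[OF finite_cost] by (subst enn2real_sum) (auto simp: sum_distrib_left)
  also have "(\<Sum>v\<in>nodes n L. ennreal (2 * lam) * (\<Sum>l\<in>{1..L}. wcost (take l v))) = ennreal ?N * (ennreal (2 * lam) * total_cost)"
    unfolding sum_distrib_left[symmetric] sum_leaf_cost by (rule mult.left_commute)
  also have "a * enn2real \<dots> = ?N * (a * enn2real (ennreal (2 * lam) * total_cost))"
    by (simp add: enn2real_mult)
  finally show "(\<integral>p. risk_gap \<phi> p \<partial>J) \<le> a * enn2real (ennreal (2 * lam) * total_cost)"
    using N by simp
qed

end

lemma integral_excess_tendsto_0:
  fixes u :: "'a \<Rightarrow> real"
  assumes u: "integrable M u"
  shows "integrable M (\<lambda>x. max 0 (u x - real (Suc k)))"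
    and "(\<lambda>k. \<integral>x. max 0 (u x - real (Suc k)) \<partial>M) \<longlonglongrightarrow> 0"
proof -
  have [measurable]: "u \<in> borel_measurable M" using u by simp
  show "integrable M (\<lambda>x. max 0 (u x - real (Suc k)))"
    by (rule Bochner_Integration.integrable_bound[OF u]) auto
  have "(\<lambda>k. \<integral>x. max 0 (u x - real (Suc k)) \<partial>M) \<longlonglongrightarrow> (\<integral>x. 0 \<partial>M)"
  proof (rule integral_dominated_convergence[where w="\<lambda>x. \<bar>u x\<bar>"])
    show "AE x in M. (\<lambda>k. max 0 (u x - real (Suc k))) \<longlonglongrightarrow> 0"
    proof (rule AE_I2)
      fix x
      obtain k0 where "u x \<le> real k0" using real_arch_simple by blast
      then have "eventually (\<lambda>k. max 0 (u x - real (Suc k)) = 0) sequentially"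
        by (intro eventually_sequentiallyI[of k0]) auto
      then show "(\<lambda>k. max 0 (u x - real (Suc k))) \<longlonglongrightarrow> 0"
        by (rule tendsto_eventually)
    qed
  qed (use u in auto)
  then show "(\<lambda>k. \<integral>x. max 0 (u x - real (Suc k)) \<partial>M) \<longlonglongrightarrow> 0" by simp
qed

context lipschitz_learning
begin

lemma loss_w0_measurable: "loss w0 \<in> borel_measurable (X L)"
  using measurable_section[OF loss_meas w0] .

lemma loss_measurable_DL: "w \<in> space MW \<Longrightarrow> loss w \<in> borel_measurable DL"
  using measurable_section[OF loss_meas] by (simp cong: measurable_cong_sets add: sets_DL)

text \<open>By the Lipschitz condition the two losses differ by a bounded function, so integrability
  at a test point is the same for all hypotheses.\<close>

lemma integrable_loss_iff:
  assumes w: "w \<in> space MW" and w': "w' \<in> space MW" and i: "integrable DL (loss w)"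
  shows "integrable DL (loss w')"
proof -
  have "integrable DL (\<lambda>z. loss w' z - loss w z)"
    using loss_measurable_DL[OF w] loss_measurable_DL[OF w'] lip[OF w' w]
    by (intro DL.integrable_const_bound[where B="lam * dist w' w"]) (auto intro!: AE_I2 simp: space_DL)
  then have "integrable DL (\<lambda>z. (loss w' z - loss w z) + loss w z)"
    using i by (rule Bochner_Integration.integrable_add)
  then show ?thesis by simp
qed

text \<open>The gap is multiplied by \<open>\<eta> k\<close>, which keeps it below its absolute
  value, and compared with the gap of the bounded loss \<open>\<phi> k\<close>. The comparison
  errors are tails of integrable functions, so dominated convergence removes both the errors and the
  cutoff, and \<open>1 + e k\<close> tends to 1.\<close>

lemma gen_le_of_integrable:
  assumes f: "integrable DL (loss w0)" and g: "integrable J (risk_gap loss)"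
  shows "(\<integral>p. risk_gap loss p \<partial>J) \<le> enn2real (ennreal (2 * lam) * total_cost)"
proof -
  let ?C = "enn2real (ennreal (2 * lam) * total_cost)" and ?N = "real (Nprod n L)"
  define e where "e k = 1 / real (Suc k)" for k
  have e: "0 < e k" "1 / e k = real (Suc k)" for k by (auto simp: e_def)
  define \<phi> where "\<phi> k w z = cutoff (e k) (env w) * clamp (env w + 1 / e k) (loss w z)" for k w z
  have \<phi>_m: "(\<lambda>p. \<phi> k (fst p) (snd p)) \<in> borel_measurable (MW \<Otimes>\<^sub>M X L)" for k
    unfolding \<phi>_def cutoff_def clamp_def by measurable
  have \<phi>_b: "\<bar>\<phi> k w z\<bar> \<le> exp (1 / e k) / e k" if "w \<in> space MW" for k w z
  proof -
    have "\<bar>\<phi> k w z\<bar> \<le> cutoff (e k) (env w) * (env w + 1 / e k)"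
      using clamp_le[of "env w + 1 / e k" "loss w z"] e[of k] env_nonneg[OF that] cutoff_nonneg[of "e k" "env w"]
      unfolding \<phi>_def abs_mult by (intro mult_mono) auto
    then show ?thesis using cutoff_mult_le[OF e(1) env_nonneg[OF that], of k] by simp
  qed
  have \<phi>_lip: "\<phi> k w z \<le> \<phi> k w' z + (1 + e k) * (lam * dist w w')"
    if "w \<in> space MW" "w' \<in> space MW" "z \<in> space (X L)" for k w w' z
    using cutoff_clamp_lipschitz[OF e(1) env_nonneg[OF that(1)] env_nonneg[OF that(2)] env_lipschitz[OF that(1,2)] lip[OF that], of k]
    unfolding \<phi>_def by linarith
  have a: "0 \<le> 1 + e k" for k using e(1)[of k] by simp
  have gap_i: "integrable J (risk_gap (\<phi> k))" and gap_le: "(\<integral>p. risk_gap (\<phi> k) p \<partial>J) \<le> (1 + e k) * ?C" for k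
    using integral_risk_gap_le[OF \<phi>_m[of k] a[of k] \<phi>_b[of _ k] \<phi>_lip[of _ _ _ k]] by auto
  \<comment> \<open>The leaf has the law of a test point, so the first term is integrable; the
    second controls the deviation that the envelope misses because the hypothesis depends on this
    leaf.\<close>
  define u where "u v p = \<bar>loss w0 (sel (fst p v))\<bar> + exc (snd p) (sel (fst p v))"
    for v and p :: "(nat list \<Rightarrow> ('x \<times> 'x) \<times> bool) \<times> 'w"
  have u_i: "integrable J (u v)" if v: "v \<in> nodes n L" for v
  proof -
    note [measurable] = loss_w0_measurable measurable_J_leaf[OF v]
    have "(\<integral>\<^sup>+p. ennreal \<bar>loss w0 (sel (fst p v))\<bar> \<partial>J) = (\<integral>\<^sup>+z. ennreal \<bar>loss w0 z\<bar> \<partial>DL)"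
      by (rule nn_integral_leaf[OF v]) measurable
    also have "\<dots> < \<infinity>" using f by (simp add: integrable_iff_bounded)
    finally have "integrable J (\<lambda>p. loss w0 (sel (fst p v)))"
      by (simp add: integrable_iff_bounded)
    then show ?thesis
      unfolding u_def[abs_def] using exc_integrable[OF v] by auto
  qed
  define a where "a k = (\<integral>z. max 0 (\<bar>loss w0 z\<bar> - real (Suc k)) \<partial>DL)" for k
  define b where "b k v = (\<integral>p. max 0 (u v p - real (Suc k)) \<partial>J)" for k v
  have abs_f: "integrable DL (\<lambda>z. \<bar>loss w0 z\<bar>)" using f by simp
  define \<eta> where "\<eta> k p = cutoff (e k) (env (snd p))" for k and p :: "(nat list \<Rightarrow> ('x \<times> 'x) \<times> bool) \<times> 'w"
  have pJ: "snd p \<in> space MW" if "p \<in> space J" for p using that by (auto simp: space_J)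
  have \<eta>: "0 \<le> \<eta> k p" "\<eta> k p \<le> 1" if "p \<in> space J" for k p
    using cutoff_nonneg cutoff_le_1[of "e k" "env (snd p)"] e(1)[of k] env_nonneg[OF pJ[OF that]] by (auto simp: \<eta>_def)
  \<comment> \<open>The absolute loss is at most \<open>\<bar>loss w0 z\<bar> + env + exc\<close>.
    Clamping at a level shifted by \<open>env\<close> cancels the envelope, which need not be
    integrable over the hypothesis.\<close>
  have err: "\<bar>\<eta> k p * loss (snd p) z - \<phi> k (snd p) z\<bar> \<le> max 0 (\<bar>loss w0 z\<bar> + exc (snd p) z - real (Suc k))"
    if p: "p \<in> space J" for k p z
  proof -
    have "\<bar>\<eta> k p * loss (snd p) z - \<phi> k (snd p) z\<bar> = \<eta> k p * \<bar>loss (snd p) z - clamp (env (snd p) + 1 / e k) (loss (snd p) z)\<bar>"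
      using \<eta>(1)[OF p, of k] unfolding \<phi>_def \<eta>_def[symmetric] right_diff_distrib[symmetric] by (simp add: abs_mult)
    also have "\<dots> \<le> 1 * \<bar>loss (snd p) z - clamp (env (snd p) + 1 / e k) (loss (snd p) z)\<bar>"
      using \<eta>[OF p, of k] by (intro mult_right_mono) auto
    also have "\<dots> = max 0 (\<bar>loss (snd p) z\<bar> - (env (snd p) + 1 / e k))"
      using clamp_dist[of "env (snd p) + 1 / e k"] env_nonneg[OF pJ[OF p]] e[of k] by simp
    also have "\<dots> \<le> max 0 (\<bar>loss w0 z\<bar> + exc (snd p) z - real (Suc k))"
      using dev_le[of "snd p" z] unfolding e(2) dev_def by (simp add: max_def) linarith
    finally show ?thesis .
  qed
  have step: "\<eta> k p * risk_gap loss p \<le> risk_gap (\<phi> k) p + a k + (1 / ?N) * (\<Sum>v\<in>nodes n L. max 0 (u v p - real (Suc k)))"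
    if p: "p \<in> space J" for k p
  proof -
    note w = pJ[OF p]
    have li: "integrable DL (loss (snd p))" by (rule integrable_loss_iff[OF w0 w f])
    have \<phi>i: "integrable DL (\<phi> k (snd p))"
      using measurable_section[OF \<phi>_m w] \<phi>_b[OF w]
      by (intro DL.integrable_const_bound[where B="exp (1 / e k) / e k"])
        (auto intro!: AE_I2 cong: measurable_cong_sets simp: sets_DL)
    have "\<eta> k p * (\<integral>z. loss (snd p) z \<partial>DL) - (\<integral>z. \<phi> k (snd p) z \<partial>DL) = (\<integral>z. \<eta> k p * loss (snd p) z - \<phi> k (snd p) z \<partial>DL)"
      using li \<phi>i by simp
    also have "\<dots> \<le> a k"
      unfolding a_def
    proof (rule integral_mono_AE)
      show "AE z in DL. \<eta> k p * loss (snd p) z - \<phi> k (snd p) z \<le> max 0 (\<bar>loss w0 z\<bar> - real (Suc k))"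
        using AE_dev_le_env[OF w]
      proof eventually_elim
        case (elim z)
        then have "exc (snd p) z = 0" by (simp add: exc_def)
        with err[OF p, of k z] show ?case by simp
      qed
    qed (use li \<phi>i integral_excess_tendsto_0(1)[OF abs_f] in auto)
    finally have 1: "\<eta> k p * (\<integral>z. loss (snd p) z \<partial>DL) \<le> (\<integral>z. \<phi> k (snd p) z \<partial>DL) + a k" by simp
    have "(\<Sum>v\<in>nodes n L. \<phi> k (snd p) (sel (fst p v))) - \<eta> k p * (\<Sum>v\<in>nodes n L. loss (snd p) (sel (fst p v))) =
        (\<Sum>v\<in>nodes n L. \<phi> k (snd p) (sel (fst p v)) - \<eta> k p * loss (snd p) (sel (fst p v)))"
      by (simp add: sum_subtractf sum_distrib_left)
    also have "\<dots> \<le> (\<Sum>v\<in>nodes n L. max 0 (u v p - real (Suc k)))"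
      unfolding u_def
    proof (rule sum_mono)
      fix v
      show "\<phi> k (snd p) (sel (fst p v)) - \<eta> k p * loss (snd p) (sel (fst p v)) \<le>
          max 0 (\<bar>loss w0 (sel (fst p v))\<bar> + exc (snd p) (sel (fst p v)) - real (Suc k))"
        using err[OF p, of k "sel (fst p v)"] by linarith
    qed
    finally have "(1 / ?N) * ((\<Sum>v\<in>nodes n L. \<phi> k (snd p) (sel (fst p v))) - \<eta> k p * (\<Sum>v\<in>nodes n L. loss (snd p) (sel (fst p v)))) \<le>
        (1 / ?N) * (\<Sum>v\<in>nodes n L. max 0 (u v p - real (Suc k)))"
      by (intro mult_left_mono) auto
    with 1 show ?thesis
      unfolding risk_gap_def right_diff_distrib by (simp add: algebra_simps)
  qed
  have \<eta>_m: "\<eta> k \<in> borel_measurable J" for k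
    unfolding \<eta>_def[abs_def] cutoff_def by measurable
  have \<eta>g_b: "\<bar>\<eta> k p * risk_gap loss p\<bar> \<le> \<bar>risk_gap loss p\<bar>" if "p \<in> space J" for k p
    using \<eta>[OF that, of k] mult_right_mono[of "\<eta> k p" 1 "\<bar>risk_gap loss p\<bar>"] by (simp add: abs_mult)
  have \<eta>g_i: "integrable J (\<lambda>p. \<eta> k p * risk_gap loss p)" for k
    by (rule Bochner_Integration.integrable_bound[OF g])
      (use \<eta>g_b \<eta>_m g in \<open>auto intro!: AE_I2\<close>)
  have ex_i: "integrable J (\<lambda>p. max 0 (u v p - real (Suc k)))" if "v \<in> nodes n L" for v k
    by (rule integral_excess_tendsto_0(1)[OF u_i[OF that]])
  have bound: "(\<integral>p. \<eta> k p * risk_gap loss p \<partial>J) \<le> (1 + e k) * ?C + a k + (1 / ?N) * (\<Sum>v\<in>nodes n L. b k v)" for k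
  proof -
    have "(\<integral>p. \<eta> k p * risk_gap loss p \<partial>J) \<le>
        (\<integral>p. risk_gap (\<phi> k) p + a k + (1 / ?N) * (\<Sum>v\<in>nodes n L. max 0 (u v p - real (Suc k))) \<partial>J)"
      using \<eta>g_i gap_i ex_i step by (intro integral_mono) auto
    also have "\<dots> = (\<integral>p. risk_gap (\<phi> k) p \<partial>J) + a k + (1 / ?N) * (\<Sum>v\<in>nodes n L. b k v)"
      using gap_i ex_i unfolding b_def by (simp add: J.prob_space)
    finally show ?thesis using gap_le[of k] by simp
  qed
  have e0: "e \<longlonglongrightarrow> 0"
    unfolding e_def[abs_def] using LIMSEQ_inverse_real_of_nat by (simp add: inverse_eq_divide)
  have "(\<lambda>k. (1 + e k) * ?C + a k + (1 / ?N) * (\<Sum>v\<in>nodes n L. b k v)) \<longlonglongrightarrow>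
      (1 + 0) * ?C + 0 + (1 / ?N) * (\<Sum>v\<in>nodes n L. 0)"
    unfolding a_def[abs_def] b_def[abs_def]
    by (intro tendsto_intros e0 integral_excess_tendsto_0(2) abs_f u_i)
  moreover have "(\<lambda>k. \<integral>p. \<eta> k p * risk_gap loss p \<partial>J) \<longlonglongrightarrow> (\<integral>p. risk_gap loss p \<partial>J)"
  proof (rule integral_dominated_convergence[where w="\<lambda>p. \<bar>risk_gap loss p\<bar>"])
    show "AE p in J. (\<lambda>k. \<eta> k p * risk_gap loss p) \<longlonglongrightarrow> risk_gap loss p"
    proof (rule AE_I2)
      fix p assume "p \<in> space J"
      then have "(\<lambda>k. \<eta> k p) \<longlonglongrightarrow> 1"
        unfolding \<eta>_def e_def by (intro cutoff_tendsto_1 env_nonneg pJ)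
      from tendsto_mult_right[OF this, of "risk_gap loss p"]
      show "(\<lambda>k. \<eta> k p * risk_gap loss p) \<longlonglongrightarrow> risk_gap loss p" by simp
    qed
  qed (use g \<eta>g_i \<eta>g_b in \<open>auto intro!: AE_I2\<close>)
  ultimately show ?thesis
    using LIMSEQ_le[of "\<lambda>k. \<integral>p. \<eta> k p * risk_gap loss p \<partial>J"] bound by auto
qed

subsection \<open>The case of a non-integrable loss\<close>

lemma env_tail_tendsto_0:
  fixes N :: real
  shows "(\<lambda>k. measure J {p \<in> space J. real k < N * env (snd p)}) \<longlonglongrightarrow> 0"
proof -
  have "(\<lambda>k. measure J {p \<in> space J. real k < N * env (snd p)}) \<longlonglongrightarrow>
      measure J (\<Inter>k. {p \<in> space J. real k < N * env (snd p)})"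
    by (rule J.finite_Lim_measure_decseq) (auto simp: decseq_def)
  moreover have "(\<Inter>k. {p \<in> space J. real k < N * env (snd p)}) = {}"
  proof -
    have "\<exists>k. \<not> real k < x" for x :: real
      using real_arch_simple[of x] by (auto simp: not_less)
    then show ?thesis by auto
  qed
  ultimately show ?thesis by simp
qed

text \<open>If the loss is not integrable, the population risk has the junk value \<open>0\<close>.  The gap is then not
  integrable either: a heavy tail of the leaves survives in the sum over the leaves, and the hypothesis, being
  nearly independent of every single leaf, can only cancel it where the envelope is large.\<close>

lemma risk_gap_not_integrable:
  assumes f: "\<not> integrable DL (loss w0)"
  shows "\<not> integrable J (risk_gap loss)"
proof
  assume g: "integrable J (risk_gap loss)"
  let ?N = "real (Nprod n L)"
  have N: "?N \<ge> 1" using Nprod_pos[of L] by simp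
  have pJ: "snd p \<in> space MW" if "p \<in> space J" for p using that by (auto simp: space_J)
  \<comment> \<open>The population risk is 0 by default, so up to the factor \<open>- ?N\<close> the
    gap is this sum, which is therefore integrable.\<close>
  define s where "s p = (\<Sum>v\<in>nodes n L. loss (snd p) (sel (fst p v)))"
    for p :: "(nat list \<Rightarrow> ('x \<times> 'x) \<times> bool) \<times> 'w"
  have "- ?N * risk_gap loss p = s p" if p: "p \<in> space J" for p
  proof -
    have "\<not> integrable DL (loss (snd p))"
      using integrable_loss_iff[OF pJ[OF p] w0] f by blast
    then show ?thesis
      using N by (simp add: risk_gap_def s_def not_integrable_integral_eq)
  qed
  then have s_i: "integrable J s"
    using Bochner_Integration.integrable_cong[OF refl, of J "\<lambda>p. - ?N * risk_gap loss p" s] g by auto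
  define q where "q p = \<bar>s p\<bar> + (\<Sum>v\<in>nodes n L. exc (snd p) (sel (fst p v)))"
    for p :: "(nat list \<Rightarrow> ('x \<times> 'x) \<times> bool) \<times> 'w"
  have q_nn: "0 \<le> q p" for p
    unfolding q_def by (intro add_nonneg_nonneg sum_nonneg) (auto simp: exc_def)
  have q_i: "integrable J q"
    unfolding q_def[abs_def] using s_i exc_integrable by auto
  have [measurable]: "q \<in> borel_measurable J" using q_i by simp
  define Q where "Q = (\<integral>\<^sup>+p. ennreal (q p) \<partial>J)"
  have Q: "Q < \<top>"
    using q_i q_nn unfolding Q_def integrable_iff_bounded by simp
  note [measurable] = loss_w0_measurable
  define t where "t m = (\<integral>\<^sup>+z. trunc m (loss w0 z) \<partial>DL)" for m
  have t_fin: "t m < \<top>" if "0 \<le> m" for m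
  proof -
    have "t m \<le> (\<integral>\<^sup>+z. ennreal m \<partial>DL)"
      unfolding t_def trunc_def by (intro nn_integral_mono ennreal_leI) auto
    then show ?thesis by (simp add: DL.emeasure_space_1) (metis ennreal_less_top le_less_trans)
  qed
  define c where "c v = ennreal (?N * (2 * lam)) * (\<Sum>l\<in>{1..L}. wcost (take l v))" for v
  have c: "c v < \<top>" if "v \<in> nodes n L" for v
    unfolding c_def using leaf_cost_finite_mult[OF finite_cost that, of ?N] lam by simp
  \<comment> \<open>The part of the truncated reference loss that the envelope leaves room for;
    \<open>?N\<close> appears because the deviations of all leaves together are bounded by
    \<open>?N * env\<close> up to overshoot.\<close>
  define \<phi> where "\<phi> m w z = min (min \<bar>loss w0 z\<bar> m) (?N * env w)" for m w z
  have \<phi>_m: "(\<lambda>p. \<phi> m (fst p) (snd p)) \<in> borel_measurable (MW \<Otimes>\<^sub>M X L)" for m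
    unfolding \<phi>_def by measurable
  have \<phi>_nn: "0 \<le> \<phi> m w z" if "0 \<le> m" "w \<in> space MW" for m w z
    unfolding \<phi>_def using that env_nonneg N by simp
  have \<phi>_leaf: "(\<integral>\<^sup>+p. ennreal (\<phi> m (snd p) (sel (fst p v))) \<partial>J) \<le>
      (\<integral>\<^sup>+p. \<integral>\<^sup>+z. ennreal (\<phi> m (snd p) z) \<partial>DL \<partial>J) + c v" if m: "0 \<le> m" and v: "v \<in> nodes n L" for m v
    unfolding c_def
  proof (rule transfer_real(2)[OF v \<phi>_m])
    show "\<phi> m w z \<le> \<phi> m w' z + ?N * (lam * dist w w')"
      if "w \<in> space MW" "w' \<in> space MW" "z \<in> space (X L)" for w w' z
    proof -
      have "?N * env w \<le> ?N * (env w' + lam * dist w w')"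
        using env_lipschitz_le[OF that(1,2)] by (intro mult_left_mono) auto
      moreover have "0 \<le> ?N * (lam * dist w w')" using lam by simp
      ultimately show ?thesis unfolding \<phi>_def distrib_left by linarith
    qed
  qed (use \<phi>_nn m in auto)
  define A where "A k = {p \<in> space J. real k < ?N * env (snd p)}" for k :: nat
  have A[measurable]: "A k \<in> sets J" for k unfolding A_def by measurable
  \<comment> \<open>Outside \<open>A k\<close> the second bound in \<open>\<phi>\<close> is at most
    \<open>k\<close>. On \<open>A k\<close> the inner integral is at most \<open>t m\<close>, since
    a test point is independent of the hypothesis, and only the probability of \<open>A k\<close>
    remains.\<close>
  have fresh: "(\<integral>\<^sup>+p. \<integral>\<^sup>+z. ennreal (\<phi> m (snd p) z) \<partial>DL \<partial>J) \<le> ennreal (real k) + emeasure J (A k) * t m"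
    if m: "0 \<le> m" for m k
  proof -
    have "(\<integral>\<^sup>+p. \<integral>\<^sup>+z. ennreal (\<phi> m (snd p) z) \<partial>DL \<partial>J) \<le> (\<integral>\<^sup>+p. ennreal (real k) + indicator (A k) p * t m \<partial>J)"
    proof (rule nn_integral_mono)
      fix p assume p: "p \<in> space J"
      show "(\<integral>\<^sup>+z. ennreal (\<phi> m (snd p) z) \<partial>DL) \<le> ennreal (real k) + indicator (A k) p * t m"
      proof (cases "p \<in> A k")
        case True
        have "(\<integral>\<^sup>+z. ennreal (\<phi> m (snd p) z) \<partial>DL) \<le> t m"
          unfolding t_def trunc_def \<phi>_def by (intro nn_integral_mono ennreal_leI) auto
        also have "\<dots> \<le> ennreal (real k) + t m" by simp
        finally show ?thesis using True by simp
      next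
        case False
        then have "(\<integral>\<^sup>+z. ennreal (\<phi> m (snd p) z) \<partial>DL) \<le> (\<integral>\<^sup>+z. ennreal (real k) \<partial>DL)"
          using p unfolding \<phi>_def A_def by (intro nn_integral_mono ennreal_leI) auto
        then show ?thesis using False by (simp add: DL.emeasure_space_1)
      qed
    qed
    also have "\<dots> = ennreal (real k) + emeasure J (A k) * t m"
      by (subst nn_integral_add) (auto simp: J.emeasure_space_1 nn_integral_multc)
    finally show ?thesis .
  qed
  \<comment> \<open>Passing from the hypothesis to \<open>w0\<close> changes the sum by at most the
    deviations, so it is bounded both by \<open>q p + ?N * env\<close> and by its truncated terms.
    The minimum of these bounds is distributed over the leaves.\<close>
  have pointwise: "trunc m (\<Sum>v\<in>nodes n L. loss w0 (sel (fst p v))) \<le>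
      ennreal (q p) + (\<Sum>v\<in>nodes n L. ennreal (\<phi> m (snd p) (sel (fst p v))))"
    if p: "p \<in> space J" and m: "0 \<le> m" for p m
  proof -
    let ?f = "\<lambda>v. loss w0 (sel (fst p v))"
    have R: "0 \<le> ?N * env (snd p)" using env_nonneg[OF pJ[OF p]] N by simp
    have "\<bar>(\<Sum>v\<in>nodes n L. ?f v)\<bar> = \<bar>s p - (\<Sum>v\<in>nodes n L. loss (snd p) (sel (fst p v)) - ?f v)\<bar>"
      by (simp add: s_def sum_subtractf)
    also have "\<dots> \<le> \<bar>s p\<bar> + (\<Sum>v\<in>nodes n L. dev (snd p) (sel (fst p v)))"
      unfolding dev_def by (intro order_trans[OF abs_triangle_ineq4] add_left_mono sum_abs)
    also have "(\<Sum>v\<in>nodes n L. dev (snd p) (sel (fst p v))) \<le> (\<Sum>v\<in>nodes n L. env (snd p) + exc (snd p) (sel (fst p v)))"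
      by (intro sum_mono dev_le)
    also have "\<bar>s p\<bar> + \<dots> = q p + ?N * env (snd p)"
      by (simp add: q_def sum.distrib card_nodes)
    finally have 1: "\<bar>\<Sum>v\<in>nodes n L. ?f v\<bar> \<le> q p + ?N * env (snd p)" by simp
    have min_sum: "min (\<Sum>i\<in>I. b i) r \<le> (\<Sum>i\<in>I. min (b i) r)" if "finite I" "\<And>i. 0 \<le> b i" "0 \<le> r"
      for b :: "nat list \<Rightarrow> real" and r I
      using that(1)
    proof (induction I rule: finite_induct)
      case (insert i I)
      have "0 \<le> (\<Sum>i\<in>I. min (b i) r)" using that by (intro sum_nonneg) auto
      then show ?case using insert that(2)[of i] that(3) by (simp add: min_def split: if_splits)
    qed (use that in auto)
    have 2: "min \<bar>\<Sum>v\<in>nodes n L. ?f v\<bar> m \<le> (\<Sum>v\<in>nodes n L. min \<bar>?f v\<bar> m)"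
    proof -
      have "min \<bar>\<Sum>v\<in>nodes n L. ?f v\<bar> m \<le> min (\<Sum>v\<in>nodes n L. \<bar>?f v\<bar>) m"
        by (intro min.mono sum_abs order_refl)
      also have "\<dots> \<le> (\<Sum>v\<in>nodes n L. min \<bar>?f v\<bar> m)"
        using m by (intro min_sum) auto
      finally show ?thesis .
    qed
    have "min \<bar>\<Sum>v\<in>nodes n L. ?f v\<bar> m \<le> q p + min (\<Sum>v\<in>nodes n L. min \<bar>?f v\<bar> m) (?N * env (snd p))"
      using 1 2 q_nn[of p] by linarith
    also have "min (\<Sum>v\<in>nodes n L. min \<bar>?f v\<bar> m) (?N * env (snd p)) \<le> (\<Sum>v\<in>nodes n L. \<phi> m (snd p) (sel (fst p v)))"
      unfolding \<phi>_def using m R by (intro min_sum) auto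
    finally have "trunc m (\<Sum>v\<in>nodes n L. ?f v) \<le> ennreal (q p + (\<Sum>v\<in>nodes n L. \<phi> m (snd p) (sel (fst p v))))"
      unfolding trunc_def by (intro ennreal_leI) simp
    also have "\<dots> = ennreal (q p) + (\<Sum>v\<in>nodes n L. ennreal (\<phi> m (snd p) (sel (fst p v))))"
      using q_nn[of p] \<phi>_nn[OF m pJ[OF p]] by (simp add: sum_nonneg)
    finally show ?thesis .
  qed
  obtain C where C: "C \<ge> 0"
    "\<And>m f. 0 \<le> m \<Longrightarrow> f \<in> borel_measurable (X L) \<Longrightarrow>
      (\<integral>\<^sup>+z. trunc m (f z) \<partial>DL) \<le> ennreal C * (\<integral>\<^sup>+\<omega>. trunc m (\<Sum>v\<in>nodes n L. f (sel (\<omega> v))) \<partial>ss L)"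
    using trunc_leaf_le_trunc_sum by metis
  have sum_m: "(\<lambda>\<omega>. trunc m (\<Sum>v\<in>nodes n L. loss w0 (sel (\<omega> v)))) \<in> borel_measurable (S L)" for m
  proof (intro measurable_trunc borel_measurable_sum)
    fix v assume v: "v \<in> nodes n L"
    have "(\<lambda>\<omega>. sel (\<omega> v)) \<in> S L \<rightarrow>\<^sub>M X L"
      using measurable_compose[OF measurable_node[OF L order_refl v] measurable_sel_Xn] length_nodes[OF v] by simp
    then show "(\<lambda>\<omega>. loss w0 (sel (\<omega> v))) \<in> borel_measurable (S L)"
      using loss_w0_measurable by (rule measurable_compose)
  qed
  define B where "B k = ennreal C * (Q + (\<Sum>v\<in>nodes n L. ennreal (real k) + c v))" for k :: nat
  have B: "B k < \<top>" for k
    unfolding B_def using Q c by (simp add: ennreal_mult_less_top)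
  \<comment> \<open>The truncated tail is bounded by itself times a coefficient that tends to 0 with
    \<open>k\<close>, while \<open>B k\<close> does not depend on \<open>m\<close>.\<close>
  have key: "t m \<le> B k + ennreal (C * ?N * measure J (A k)) * t m" if m: "0 \<le> m" for m k
  proof -
    have \<phi>_leaf_m: "(\<lambda>p. ennreal (\<phi> m (snd p) (sel (fst p v)))) \<in> borel_measurable J" if v: "v \<in> nodes n L" for v
      using measurable_compose[OF measurable_Pair[OF measurable_J_snd measurable_J_leaf[OF v]] \<phi>_m] by simp
    have "t m \<le> ennreal C * (\<integral>\<^sup>+\<omega>. trunc m (\<Sum>v\<in>nodes n L. loss w0 (sel (\<omega> v))) \<partial>ss L)"
      unfolding t_def by (rule C(2)[OF m loss_w0_measurable])
    also have "(\<integral>\<^sup>+\<omega>. trunc m (\<Sum>v\<in>nodes n L. loss w0 (sel (\<omega> v))) \<partial>ss L) =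
        (\<integral>\<^sup>+p. trunc m (\<Sum>v\<in>nodes n L. loss w0 (sel (fst p v))) \<partial>J)"
      by (rule nn_integral_J_fst[OF sum_m, symmetric])
    also have "\<dots> \<le> (\<integral>\<^sup>+p. ennreal (q p) + (\<Sum>v\<in>nodes n L. ennreal (\<phi> m (snd p) (sel (fst p v)))) \<partial>J)"
      using pointwise m by (intro nn_integral_mono) auto
    also have "\<dots> = Q + (\<Sum>v\<in>nodes n L. \<integral>\<^sup>+p. ennreal (\<phi> m (snd p) (sel (fst p v))) \<partial>J)"
      using \<phi>_leaf_m unfolding Q_def by (subst nn_integral_add) (auto simp: nn_integral_sum)
    also have "\<dots> \<le> Q + (\<Sum>v\<in>nodes n L. (ennreal (real k) + c v) + emeasure J (A k) * t m)"
    proof (intro add_left_mono sum_mono)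
      fix v assume v: "v \<in> nodes n L"
      show "(\<integral>\<^sup>+p. ennreal (\<phi> m (snd p) (sel (fst p v))) \<partial>J) \<le> (ennreal (real k) + c v) + emeasure J (A k) * t m"
        using order_trans[OF \<phi>_leaf[OF m v] add_right_mono[OF fresh[OF m]]] by (simp add: ac_simps)
    qed
    also have "\<dots> = (Q + (\<Sum>v\<in>nodes n L. ennreal (real k) + c v)) + of_nat (Nprod n L) * (emeasure J (A k) * t m)"
      by (simp add: sum.distrib card_nodes distrib_left ac_simps)
    finally have "t m \<le> ennreal C * ((Q + (\<Sum>v\<in>nodes n L. ennreal (real k) + c v)) + of_nat (Nprod n L) * (emeasure J (A k) * t m))"
      by (simp add: mult_left_mono)
    also have "\<dots> = B k + ennreal (C * ?N * measure J (A k)) * t m"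
      using C(1) unfolding B_def distrib_left
      by (simp add: J.emeasure_eq_measure ennreal_mult ennreal_of_nat_eq_real_of_nat mult.assoc)
    finally show ?thesis .
  qed
  have "(\<lambda>k. C * ?N * measure J (A k)) \<longlonglongrightarrow> C * ?N * 0"
    unfolding A_def by (intro tendsto_intros env_tail_tendsto_0)
  then have "eventually (\<lambda>k. C * ?N * measure J (A k) < 1 / 2) sequentially"
    by (rule order_tendstoD(2)) simp
  then obtain k where k: "C * ?N * measure J (A k) < 1 / 2"
    by (auto simp: eventually_sequentially)
  \<comment> \<open>Half of \<open>t m\<close> is absorbed into the left side, which is legitimate
    because \<open>t m\<close> is finite.\<close>
  have t_le: "t m \<le> 2 * B k" if m: "0 \<le> m" for m
  proof -
    have "t m \<le> B k + ennreal (1 / 2) * t m"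
      using k by (intro order_trans[OF key[OF m, of k]] add_left_mono mult_right_mono ennreal_leI) auto
    moreover obtain x where x: "t m = ennreal x" "0 \<le> x" using t_fin[OF m] by (cases "t m") auto
    moreover obtain y where y: "B k = ennreal y" "0 \<le> y" using B[of k] by (cases "B k") auto
    moreover have "ennreal (y + 1 / 2 * x) = ennreal y + ennreal (1 / 2) * ennreal x"
      using ennreal_plus[OF y(2), of "1 / 2 * x"] ennreal_mult[of "1 / 2" x] x(2) by simp
    ultimately have "ennreal x \<le> ennreal (y + 1 / 2 * x)"
      by (simp only:)
    then have "x \<le> 2 * y" using x y by (subst (asm) ennreal_le_iff) auto
    then have "ennreal x \<le> ennreal (2 * y)" by (rule ennreal_leI)
    then show ?thesis using x y by (simp add: ennreal_mult)
  qed
  \<comment> \<open>The bound on \<open>t m\<close> is uniform in \<open>m\<close>, so monotone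
    convergence makes \<open>loss w0\<close> integrable, the desired contradiction.\<close>
  have "(\<integral>\<^sup>+z. ennreal (norm (loss w0 z)) \<partial>DL) \<le> (\<integral>\<^sup>+z. (SUP k. trunc (real k) (loss w0 z)) \<partial>DL)"
  proof (intro nn_integral_mono)
    fix z
    obtain k where "\<bar>loss w0 z\<bar> \<le> real k" using real_arch_simple by blast
    then have "ennreal (norm (loss w0 z)) = trunc (real k) (loss w0 z)" by (simp add: trunc_def min_def)
    then show "ennreal (norm (loss w0 z)) \<le> (SUP k. trunc (real k) (loss w0 z))"
      by (metis SUP_upper UNIV_I)
  qed
  also have "\<dots> = (SUP k. t (real k))"
    unfolding t_def
  proof (rule nn_integral_monotone_convergence_SUP)
    show "incseq (\<lambda>k z. trunc (real k) (loss w0 z))"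
      by (auto simp: incseq_def le_fun_def trunc_def intro!: ennreal_leI)
  qed measurable
  also have "\<dots> \<le> 2 * B k"
    by (intro SUP_least t_le) simp
  also have "\<dots> < \<infinity>" using B[of k] by (simp add: ennreal_mult_less_top)
  finally have "integrable DL (loss w0)"
    by (simp add: integrable_iff_bounded)
  with f show False by simp
qed

text \<open>An integrable gap forces an integrable loss, by the contrapositive of
  \<open>risk_gap_not_integrable\<close>; for a non-integrable gap \<open>gen\<close> is the default
  value 0.\<close>

lemma gen_le_cost: "ennreal (gen n X D \<kappa> L MW K loss) \<le> ennreal (2 * lam) * total_cost"
proof (cases "integrable J (risk_gap loss)")
  case True
  then have "integrable DL (loss w0)" using risk_gap_not_integrable by blast
  then have "gen n X D \<kappa> L MW K loss \<le> enn2real (ennreal (2 * lam) * total_cost)"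
    unfolding gen_eq using True by (rule gen_le_of_integrable)
  then have "ennreal (gen n X D \<kappa> L MW K loss) \<le> ennreal (enn2real (ennreal (2 * lam) * total_cost))"
    by (rule ennreal_leI)
  then show ?thesis using finite_cost by simp
next
  case False
  then show ?thesis by (simp add: gen_eq not_integrable_integral_eq)
qed

end

section \<open>Reduction to finite cost and a nonnegative Lipschitz constant\<close>

theorem theorem1:
  fixes L :: nat and n :: "nat \<Rightarrow> nat"
    and X :: "nat \<Rightarrow> 'x measure" and D :: "'x measure" and \<kappa> :: "nat \<Rightarrow> 'x \<Rightarrow> 'x measure"
    and MW :: "'w::metric_space measure" and loss :: "'w \<Rightarrow> 'x \<Rightarrow> real" and lam :: real
    and K :: "(nat list \<Rightarrow> 'x) \<Rightarrow> 'w measure"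
    and Q1 :: "nat list \<Rightarrow> ('x \<times> 'x) \<times> bool \<Rightarrow> 'w measure"
    and Q2 :: "nat list \<Rightarrow> 'x \<times> 'x \<Rightarrow> 'w measure"
  assumes L: "L \<ge> 1"
    and n: "\<forall>k\<in>{1..L}. n k \<ge> 1"
    and D: "D \<in> space (prob_algebra (X 1))"
    and \<kappa>: "\<forall>l\<in>{2..L}. \<kappa> l \<in> X (l - 1) \<rightarrow>\<^sub>M prob_algebra (X l)"
    and loss_meas: "(\<lambda>p. loss (fst p) (snd p)) \<in> borel_measurable (MW \<Otimes>\<^sub>M X L)"
    and K: "K \<in> tree_space n X L \<rightarrow>\<^sub>M prob_algebra MW"
    and lip: "\<forall>w\<in>space MW. \<forall>w'\<in>space MW. \<forall>z\<in>space (X L).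
                \<bar>loss w z - loss w' z\<bar> \<le> lam * dist w w'"
    and Q1: "\<forall>v\<in>upto_nodes n L. is_cond_law (joint_law n X D \<kappa> L MW K) (Xn X v) MW
                (\<lambda>p. fst p v) snd (Q1 v)"
    and Q2: "\<forall>v\<in>upto_nodes n L. is_cond_law (joint_law n X D \<kappa> L MW K) (Xp X v) MW
                (\<lambda>p. fst (fst p v)) snd (Q2 v)"
  shows "ennreal (gen n X D \<kappa> L MW K loss) \<le>
    ennreal (2 * lam) * (\<Sum>l\<in>{1..L}. ennreal (1 / real (Nprod n l)) *
       (\<Sum>v\<in>nodes n l.
          \<integral>\<^sup>+ a. wasserstein1 MW (Q1 v a) (Q2 v (fst a))
             \<partial>distr (joint_law n X D \<kappa> L MW K) (Xn X v) (\<lambda>p. fst p v)))"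
proof -
  interpret learning L n X D \<kappa> MW K Q1 Q2
    using L n D \<kappa> K Q1 Q2 by unfold_locales (auto simp: is_cond_law_def)
  have cost: "total_cost = (\<Sum>l\<in>{1..L}. ennreal (1 / real (Nprod n l)) *
       (\<Sum>v\<in>nodes n l. \<integral>\<^sup>+ a. wasserstein1 MW (Q1 v a) (Q2 v (fst a))
             \<partial>distr (joint_law n X D \<kappa> L MW K) (Xn X v) (\<lambda>p. fst p v)))"
    by (simp add: total_cost_def wcost_def node_dist_def)
  \<comment> \<open>No sign of \<open>lam\<close> is assumed. Replacing it by
    \<open>max 0 lam\<close> keeps the Lipschitz condition and leaves the bound unchanged, since
    \<open>ennreal\<close> sends negative numbers to 0.\<close>
  have lam_eq: "ennreal (2 * max 0 lam) = ennreal (2 * lam)"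
    by (cases "0 \<le> lam") (auto simp: ennreal_neg)
  show ?thesis
  proof (cases "ennreal (2 * lam) * total_cost = \<top>")
    case True
    then show ?thesis unfolding cost[symmetric] by simp
  next
    case False
    obtain w0 where w0: "w0 \<in> space MW"
      using J.not_empty by (auto simp: space_J)
    interpret lipschitz_learning L n X D \<kappa> MW K Q1 Q2 loss "max 0 lam" w0
    proof unfold_locales
      fix w w' z assume "w \<in> space MW" "w' \<in> space MW" "z \<in> space (X L)"
      then have "\<bar>loss w z - loss w' z\<bar> \<le> lam * dist w w'" using lip by blast
      also have "\<dots> \<le> max 0 lam * dist w w'" by (intro mult_right_mono) auto
      finally show "\<bar>loss w z - loss w' z\<bar> \<le> max 0 lam * dist w w'" .
    qed (use loss_meas w0 False lam_eq in \<open>auto simp: less_top\<close>)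
    show ?thesis
      using gen_le_cost unfolding cost[symmetric] lam_eq .
  qed
qed

end
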